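(* Let $k$ be an algebraically closed field with $\operatorname{char}(k)\nmid(d+1)!$, $V$ an $n$-dimensional $k$-vector space, $S=\operatorname{Sym}V$, and consider the gradient morphism $\nabla\colon\mathbb{P}(S_{d+1})^{c}\to\operatorname{Grass}(n,S_d)$, $\bar f\mapsto\langle\nabla f\rangle$. (A) Suppose $f\in S_{d+1}$ is concise. Then the following are equivalent: (1) $f$ is either a direct sum or an LDS form; (2) $\nabla$ is not injective at $\bar f$, i.e. there exists $\bar g\neq\bar f$ in $\mathbb{P}(S_{d+1})^c$ with $\nabla f=\nabla g$; (3) $\nabla$ has positive fiber dimension at $\bar f$, i.e. $\nabla^{-1}(\nabla\bar f)$ has dimension $\geq1$ at $\bar f$. (B) If $f\in S_{d+1}$ is GIT semistable with respect to the standard $\mathrm{SL}(n)$-action, then the following are equivalent: (1) $f$ is a direct sum; (2) $\nabla$ is not injective at $\bar f$; (3) $\nabla$ has positive fiber dimension at $\bar f$.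
   Context: $\langle\nabla f\rangle$ is the span of the first partials of $f$ in $S_d$. $\mathbb{P}(S_{d+1})^c=\{\bar f\in\mathbb{P}S_{d+1}\mid\dim_k\langle\nabla f\rangle=n\}$; under the characteristic assumption this is the locus of concise forms, i.e. forms not expressible as polynomials in fewer than $n$ linear forms. A form $f$ is a direct sum if $V=U\oplus W$ and $f=f_1+f_2$ with nonzero $f_1\in\operatorname{Sym}^{d+1}U$, $f_2\in\operatorname{Sym}^{d+1}W$. A form $f$ is LDS if, after a linear change of variables, $f=\sum_{i=1}^{\ell}x_i\,\frac{\partial H(x_{\ell+1},\dots,x_{2\ell})}{\partial x_{\ell+i}}+G(x_{\ell+1},\dots,x_n)$ with $H,G$ forms of degree $d+1$ in $\ell$ and $n-\ell$ variables. *)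

theory Defs
  imports Main "HOL-Library.Function_Algebras" "HOL-Combinatorics.Permutations"
    "HOL-Computational_Algebra.Polynomial"
begin

definition alg_closed :: "'k::field itself \<Rightarrow> bool" where
  "alg_closed _ \<longleftrightarrow> (\<forall>p::'k poly. 0 < degree p \<longrightarrow> (\<exists>x. poly p x = 0))"

text \<open>A polynomial in the variables from a finite set I (of type 'v) is a finitely
  supported coefficient function on exponent vectors m :: 'v => nat whose monomials
  only involve variables from I.\<close>

definition is_poly :: "'v set \<Rightarrow> (('v \<Rightarrow> nat) \<Rightarrow> 'k::field) \<Rightarrow> bool" where
  "is_poly I P \<longleftrightarrow> finite {m. P m \<noteq> 0} \<and> (\<forall>m. P m \<noteq> 0 \<longrightarrow> (\<forall>v. v \<notin> I \<longrightarrow> m v = 0))"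

definition is_hpoly :: "'v set \<Rightarrow> nat \<Rightarrow> (('v \<Rightarrow> nat) \<Rightarrow> 'k::field) \<Rightarrow> bool" where
  "is_hpoly I r P \<longleftrightarrow> is_poly I P \<and> (\<forall>m. P m \<noteq> 0 \<longrightarrow> (\<Sum>v\<in>I. m v) = r)"

definition peval :: "'v set \<Rightarrow> (('v \<Rightarrow> nat) \<Rightarrow> 'k::field) \<Rightarrow> ('v \<Rightarrow> 'k) \<Rightarrow> 'k" where
  "peval I P x = (\<Sum>m\<in>{m. P m \<noteq> 0}. P m * (\<Prod>v\<in>I. x v ^ m v))"

text \<open>Forms of degree e in the n coordinates x_0,...,x_(n-1) of V = k^n.
  Elements of S_e are coefficient functions on exponent vectors.\<close>
type_synonym 'k form = "(nat \<Rightarrow> nat) \<Rightarrow> 'k"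

definition form :: "nat \<Rightarrow> nat \<Rightarrow> 'k::field form \<Rightarrow> bool" where
  "form n e f \<longleftrightarrow> is_hpoly {..<n} e f"

definition feval :: "nat \<Rightarrow> 'k::field form \<Rightarrow> (nat \<Rightarrow> 'k) \<Rightarrow> 'k" where
  "feval n f x = peval {..<n} f x"

definition coeff_idx :: "nat \<Rightarrow> nat \<Rightarrow> (nat \<Rightarrow> nat) set" where
  "coeff_idx n e = {\<alpha>. (\<forall>i. n \<le> i \<longrightarrow> \<alpha> i = 0) \<and> (\<Sum>i<n. \<alpha> i) = e}"

definition pderiv_form :: "nat \<Rightarrow> 'k::field form \<Rightarrow> 'k form" where
  "pderiv_form i f = (\<lambda>\<beta>. of_nat (Suc (\<beta> i)) * f (\<beta>(i := Suc (\<beta> i))))"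

definition fscale :: "'k::field \<Rightarrow> 'k form \<Rightarrow> 'k form" where
  "fscale c g = (\<lambda>\<beta>. c * g \<beta>)"

definition grad_span :: "nat \<Rightarrow> 'k::field form \<Rightarrow> 'k form set" where
  "grad_span n f = module.span fscale {pderiv_form i f | i. i < n}"

definition grad_dim :: "nat \<Rightarrow> 'k::field form \<Rightarrow> nat" where
  "grad_dim n f = vector_space.dim fscale (grad_span n f)"

definition lin :: "nat \<Rightarrow> (nat \<Rightarrow> nat \<Rightarrow> 'k::field) \<Rightarrow> (nat \<Rightarrow> 'k) \<Rightarrow> (nat \<Rightarrow> 'k)" where
  "lin n A x = (\<lambda>i. \<Sum>j<n. A i j * x j)"

definition mdet :: "nat \<Rightarrow> (nat \<Rightarrow> nat \<Rightarrow> 'k::field) \<Rightarrow> 'k" where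
  "mdet n A = (\<Sum>p | p permutes {..<n}. of_int (sign p) * (\<Prod>i<n. A i (p i)))"

definition concise :: "nat \<Rightarrow> nat \<Rightarrow> 'k::field form \<Rightarrow> bool" where
  "concise n e f \<longleftrightarrow> \<not> (\<exists>m<n. \<exists>(L::nat \<Rightarrow> nat \<Rightarrow> 'k) h. form m e h \<and>
      (\<forall>x. feval n f x = feval m h (\<lambda>i. \<Sum>j<n. L i j * x j)))"

text \<open>Direct sum: after an invertible linear change of coordinates adapted to V = U (+) W
  (U spanned by the first m coordinates, W by the remaining n - m),
  f = f1 + f2 with nonzero f1 in Sym^e U and f2 in Sym^e W.\<close>
definition direct_sum :: "nat \<Rightarrow> nat \<Rightarrow> 'k::field form \<Rightarrow> bool" where
  "direct_sum n e f \<longleftrightarrow> (\<exists>A m f1 f2. mdet n A \<noteq> 0 \<and> m \<le> n \<and>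
      form m e f1 \<and> f1 \<noteq> (\<lambda>_. 0) \<and> form (n - m) e f2 \<and> f2 \<noteq> (\<lambda>_. 0) \<and>
      (\<forall>x. feval n f (lin n A x) = feval m f1 x + feval (n - m) f2 (\<lambda>j. x (m + j))))"

definition LDS :: "nat \<Rightarrow> nat \<Rightarrow> 'k::field form \<Rightarrow> bool" where
  "LDS n d f \<longleftrightarrow> (\<exists>A l H G. mdet n A \<noteq> 0 \<and> 1 \<le> l \<and> 2 * l \<le> n \<and>
      form l (d + 1) H \<and> form (n - l) (d + 1) G \<and>
      (\<forall>x. feval n f (lin n A x) =
            (\<Sum>i<l. x i * feval l (pderiv_form i H) (\<lambda>j. x (l + j)))
            + feval (n - l) G (\<lambda>j. x (l + j))))"

text \<open>A point of P(S_e) is represented by any nonzero form of degree e; subsets of P(S_e)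
  are represented by their (scaling-stable) sets of nonzero representatives.\<close>
definition Pforms :: "nat \<Rightarrow> nat \<Rightarrow> 'k::field form set" where
  "Pforms n e = {f. form n e f \<and> f \<noteq> (\<lambda>_. 0)}"

definition same_point :: "'k::field form \<Rightarrow> 'k form \<Rightarrow> bool" where
  "same_point f g \<longleftrightarrow> (\<exists>c. g = fscale c f)"

definition Pc :: "nat \<Rightarrow> nat \<Rightarrow> 'k::field form set" where
  "Pc n d = {f \<in> Pforms n (d + 1). grad_dim n f = n}"

definition zclosed :: "nat \<Rightarrow> nat \<Rightarrow> 'k::field form set \<Rightarrow> bool" where
  "zclosed n e Z \<longleftrightarrow> (\<exists>\<P> :: (nat \<times> (((nat \<Rightarrow> nat) \<Rightarrow> nat) \<Rightarrow> 'k)) set.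
      (\<forall>(r, P)\<in>\<P>. is_hpoly (coeff_idx n e) r P) \<and>
      Z = {f \<in> Pforms n e. \<forall>(r, P)\<in>\<P>. peval (coeff_idx n e) P f = 0})"

definition zclosed_in :: "nat \<Rightarrow> nat \<Rightarrow> 'k::field form set \<Rightarrow> 'k form set \<Rightarrow> bool" where
  "zclosed_in n e Y T \<longleftrightarrow> (\<exists>Z. zclosed n e Z \<and> T = Y \<inter> Z)"

text \<open>Irreducible subsets (irreducibility is intrinsic to the subspace topology of T).\<close>
definition zirreducible :: "nat \<Rightarrow> nat \<Rightarrow> 'k::field form set \<Rightarrow> bool" where
  "zirreducible n e T \<longleftrightarrow> T \<noteq> {} \<and>
     (\<forall>Z1 Z2. zclosed n e Z1 \<and> zclosed n e Z2 \<and> T \<subseteq> Z1 \<union> Z2 \<longrightarrow> T \<subseteq> Z1 \<or> T \<subseteq> Z2)"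

definition local_dim_ge :: "nat \<Rightarrow> nat \<Rightarrow> 'k::field form set \<Rightarrow> 'k form \<Rightarrow> nat \<Rightarrow> bool" where
  "local_dim_ge n e Y x r \<longleftrightarrow> (\<exists>T :: nat \<Rightarrow> 'k form set.
      (\<forall>i\<le>r. zclosed_in n e Y (T i) \<and> zirreducible n e (T i)) \<and>
      (\<forall>i<r. T i \<subset> T (Suc i)) \<and> x \<in> T r)"

definition grad_fiber :: "nat \<Rightarrow> nat \<Rightarrow> 'k::field form \<Rightarrow> 'k form set" where
  "grad_fiber n d f = {g \<in> Pc n d. grad_span n g = grad_span n f}"

definition grad_not_injective_at :: "nat \<Rightarrow> nat \<Rightarrow> 'k::field form \<Rightarrow> bool" where
  "grad_not_injective_at n d f \<longleftrightarrow>
     (\<exists>g \<in> Pc n d. \<not> same_point f g \<and> grad_span n g = grad_span n f)"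

definition grad_pos_fiber_dim_at :: "nat \<Rightarrow> nat \<Rightarrow> 'k::field form \<Rightarrow> bool" where
  "grad_pos_fiber_dim_at n d f \<longleftrightarrow> local_dim_ge n (d + 1) (grad_fiber n d f) f 1"

definition SL_orbit :: "nat \<Rightarrow> nat \<Rightarrow> 'k::field form \<Rightarrow> 'k form set" where
  "SL_orbit n e f = {g. form n e g \<and> (\<exists>A. mdet n A = 1 \<and> (\<forall>x. feval n g x = feval n f (lin n A x)))}"

text \<open>f is semistable iff 0 is not in the Zariski closure of its SL(n)-orbit in the
  affine space S_e, i.e. some polynomial function on S_e vanishes on the orbit but not at 0.\<close>
definition semistable :: "nat \<Rightarrow> nat \<Rightarrow> 'k::field form \<Rightarrow> bool" where
  "semistable n e f \<longleftrightarrow> (\<exists>P :: ((nat \<Rightarrow> nat) \<Rightarrow> nat) \<Rightarrow> 'k. is_poly (coeff_idx n e) P \<and>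
      (\<forall>g \<in> SL_orbit n e f. peval (coeff_idx n e) P g = 0) \<and> peval (coeff_idx n e) P (\<lambda>_. 0) \<noteq> 0)"

end

theory Submission
  imports Defs "Jordan_Normal_Form.Char_Poly"
begin

text \<open>
  If f is concise and h has its gradient span inside that of f, then there is a linear map P with
  \<open>\<partial>\<^sub>v h = \<partial>\<^bsub>P v\<^esub> f\<close> for all v; by symmetry of second derivatives P is self-adjoint for the Hessian
  of f. So are \<open>Q = P - a\<close>, a an eigenvalue of P, and its powers. If Q is not nilpotent, the Fitting
  decomposition \<open>ker Q\<^sup>r \<oplus> im Q\<^sup>r\<close> is orthogonal for the Hessian and f is a direct sum. If Q is
  nilpotent and h is not a multiple of f, a power N of Q satisfies \<open>N \<noteq> 0\<close> and \<open>N\<^sup>2 = 0\<close>; the closed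
  one-form \<open>v \<mapsto> \<partial>\<^bsub>N v\<^esub> f\<close> has a primitive g, and \<open>f (y + N u) = f y + \<partial>\<^sub>u g y\<close> is the LDS normal
  form.

  The fibre of the gradient morphism through f is an open part of the linear space of all such h:
  a line through f in it leaves the fibre in finitely many points, where a pencil of matrices
  becomes singular. Hence the gradient is not injective at f as soon as this space contains a form
  that is not a multiple of f, such as one summand of a direct sum, or the form H of an LDS form.
  Moreover the fibre is irreducible, and of positive dimension as soon as it contains a second
  point.

  For \<open>d \<ge> 2\<close> explicit one-parameter subgroups drive LDS forms to 0, so these are not semistable,
  and likewise for forms that are not concise; concise quadratic forms in at least two variables are
  direct sums.
\<close>

hide_const (open) Module.smult

subsection \<open>Homogeneous polynomials\<close>

definition monomials :: "'v set \<Rightarrow> nat \<Rightarrow> ('v \<Rightarrow> nat) set" where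
  "monomials I e = {m. (\<forall>v. v \<notin> I \<longrightarrow> m v = 0) \<and> sum m I = e}"

lemma coeff_idx_eq_monomials: "coeff_idx n e = monomials {..<n} e"
  by (auto simp: coeff_idx_def monomials_def)

lemma monomials_le:
  assumes "finite I" "m \<in> monomials I e"
  shows "m v \<le> e"
  using assms member_le_sum[of v I m] by (cases "v \<in> I") (auto simp: monomials_def)

lemma finite_monomials:
  assumes "finite I"
  shows "finite (monomials I e)"
proof (rule finite_subset)
  show "monomials I e \<subseteq> {m. \<forall>v. (v \<in> I \<longrightarrow> m v \<in> {..e}) \<and> (v \<notin> I \<longrightarrow> m v = 0)}"
    using monomials_le[OF assms] by (auto simp: monomials_def)
qed (rule finite_set_of_finite_funs[OF assms finite_atMost])

lemma monomials_0: "finite I \<Longrightarrow> monomials I 0 = {\<lambda>_. 0}"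
  by (auto simp: monomials_def fun_eq_iff)

lemma is_hpoly_iff:
  assumes "finite I"
  shows "is_hpoly I e P \<longleftrightarrow> (\<forall>m. P m \<noteq> 0 \<longrightarrow> m \<in> monomials I e)"
proof
  assume support: "\<forall>m. P m \<noteq> 0 \<longrightarrow> m \<in> monomials I e"
  then have "finite {m. P m \<noteq> 0}"
    by (intro finite_subset[OF _ finite_monomials[OF assms]]) auto
  with support show "is_hpoly I e P"
    by (auto simp: is_hpoly_def is_poly_def monomials_def)
qed (auto simp: is_hpoly_def is_poly_def monomials_def)

lemma peval_hpoly:
  assumes "finite I" "is_hpoly I e P"
  shows "peval I P x = (\<Sum>m\<in>monomials I e. P m * (\<Prod>v\<in>I. x v ^ m v))"
  unfolding peval_def using assms
  by (intro sum.mono_neutral_left finite_monomials) (auto simp: is_hpoly_iff)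

lemma peval_cong: "(\<And>v. v \<in> I \<Longrightarrow> x v = y v) \<Longrightarrow> peval I P x = peval I P y"
  by (simp add: peval_def)

lemma peval_homogeneous:
  assumes "is_hpoly I e P"
  shows "peval I P (\<lambda>v. c * x v) = c ^ e * peval I P x"
  unfolding peval_def sum_distrib_left
proof (rule sum.cong[OF refl])
  fix m assume "m \<in> {m. P m \<noteq> 0}"
  then have "sum m I = e" using assms by (auto simp: is_hpoly_def)
  then show "P m * (\<Prod>v\<in>I. (c * x v) ^ m v) = c ^ e * (P m * (\<Prod>v\<in>I. x v ^ m v))"
    by (simp add: power_mult_distrib prod.distrib flip: power_sum)
qed

lemma ex_poly_peval: "\<exists>r. \<forall>t. poly r t = peval I P (\<lambda>v. poly (q v) t)"
  by (rule exI[of _ "\<Sum>m | P m \<noteq> 0. smult (P m) (\<Prod>v\<in>I. q v ^ m v)"])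
    (simp add: peval_def poly_sum poly_prod)

definition hpoly_fun :: "'v set \<Rightarrow> nat \<Rightarrow> (('v \<Rightarrow> 'k::field) \<Rightarrow> 'k) \<Rightarrow> bool" where
  "hpoly_fun I e F \<longleftrightarrow> (\<exists>a. \<forall>x. F x = (\<Sum>m\<in>monomials I e. a m * (\<Prod>v\<in>I. x v ^ m v)))"

lemma ex_hpoly:
  assumes "finite I" "hpoly_fun I e F"
  obtains P where "is_hpoly I e P" "\<And>x. peval I P x = F x"
proof -
  obtain a where a: "\<And>x. F x = (\<Sum>m\<in>monomials I e. a m * (\<Prod>v\<in>I. x v ^ m v))"
    using assms(2) unfolding hpoly_fun_def by blast
  let ?P = "\<lambda>m. if m \<in> monomials I e then a m else 0"
  have "is_hpoly I e ?P" by (simp add: is_hpoly_iff[OF assms(1)])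
  moreover from this have "peval I ?P x = F x" for x
    unfolding peval_hpoly[OF assms(1) \<open>is_hpoly I e ?P\<close>] a by simp
  ultimately show thesis by (rule that)
qed

lemma hpoly_fun_add:
  assumes "hpoly_fun I e F" "hpoly_fun I e G"
  shows "hpoly_fun I e (\<lambda>x. F x + G x)"
proof -
  obtain a b where "\<And>x. F x = (\<Sum>m\<in>monomials I e. a m * (\<Prod>v\<in>I. x v ^ m v))"
    "\<And>x. G x = (\<Sum>m\<in>monomials I e. b m * (\<Prod>v\<in>I. x v ^ m v))"
    using assms unfolding hpoly_fun_def by blast
  then show ?thesis
    unfolding hpoly_fun_def
    by (intro exI[of _ "\<lambda>m. a m + b m"]) (simp add: distrib_right sum.distrib)
qed

lemma hpoly_fun_cmult:
  assumes "hpoly_fun I e F"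
  shows "hpoly_fun I e (\<lambda>x. c * F x)"
proof -
  obtain a where "\<And>x. F x = (\<Sum>m\<in>monomials I e. a m * (\<Prod>v\<in>I. x v ^ m v))"
    using assms unfolding hpoly_fun_def by blast
  then show ?thesis
    unfolding hpoly_fun_def
    by (intro exI[of _ "\<lambda>m. c * a m"]) (simp add: sum_distrib_left mult.assoc)
qed

lemma hpoly_fun_sum:
  "(\<And>i. i \<in> A \<Longrightarrow> hpoly_fun I e (F i)) \<Longrightarrow> hpoly_fun I e (\<lambda>x. \<Sum>i\<in>A. F i x)"
proof (induction A rule: infinite_finite_induct)
  case (insert i A)
  then show ?case by (simp add: hpoly_fun_add)
qed (auto simp: hpoly_fun_def intro: exI[of _ "\<lambda>_. 0"])

lemma hpoly_fun_monomial:
  assumes "finite I" "m \<in> monomials I e"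
  shows "hpoly_fun I e (\<lambda>x. \<Prod>v\<in>I. x v ^ m v)"
  unfolding hpoly_fun_def
  by (rule exI[of _ "\<lambda>\<mu>. if \<mu> = m then 1 else 0"])
    (simp add: assms finite_monomials if_distrib[of "\<lambda>c. c * _"] cong: if_cong)

lemma hpoly_fun_mult:
  assumes "finite I" "hpoly_fun I d F" "hpoly_fun I e G"
  shows "hpoly_fun I (d + e) (\<lambda>x. F x * G x)"
proof -
  let ?X = "\<lambda>m x. \<Prod>v\<in>I. x v ^ m v"
  obtain a b where a: "\<And>x. F x = (\<Sum>m\<in>monomials I d. a m * ?X m x)"
    and b: "\<And>x. G x = (\<Sum>m\<in>monomials I e. b m * ?X m x)"
    using assms(2,3) unfolding hpoly_fun_def by blast
  have "F x * G x = (\<Sum>m\<in>monomials I d. \<Sum>\<mu>\<in>monomials I e. (a m * b \<mu>) * ?X (\<lambda>v. m v + \<mu> v) x)" for x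
    unfolding a b sum_product by (simp add: power_add prod.distrib mult_ac)
  moreover have "(\<lambda>v. m v + \<mu> v) \<in> monomials I (d + e)"
    if "m \<in> monomials I d" "\<mu> \<in> monomials I e" for m \<mu>
    using that by (simp add: monomials_def sum.distrib)
  ultimately show ?thesis
    by (simp only:) (intro hpoly_fun_sum hpoly_fun_cmult hpoly_fun_monomial assms(1))
qed

lemma hpoly_fun_1: "finite I \<Longrightarrow> hpoly_fun I 0 (\<lambda>_. 1)"
  using hpoly_fun_monomial[of I "\<lambda>_. 0" 0] by (simp add: monomials_0)

lemma hpoly_fun_power: "finite I \<Longrightarrow> hpoly_fun I e F \<Longrightarrow> hpoly_fun I (k * e) (\<lambda>x. F x ^ k)"
  by (induction k) (auto intro: hpoly_fun_1 hpoly_fun_mult)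

lemma hpoly_fun_prod:
  assumes "finite I" "\<And>v. v \<in> A \<Longrightarrow> hpoly_fun I (e v) (F v)"
  shows "hpoly_fun I (sum e A) (\<lambda>x. \<Prod>v\<in>A. F v x)"
  using assms(2)
  by (induction A rule: infinite_finite_induct) (auto intro: hpoly_fun_1 hpoly_fun_mult assms(1))

lemma hpoly_fun_var:
  assumes "finite I" "v \<in> I"
  shows "hpoly_fun I 1 (\<lambda>x. x v :: 'k::field)"
proof -
  let ?m = "\<lambda>w. if w = v then 1 else 0 :: nat"
  have "hpoly_fun I 1 (\<lambda>x. \<Prod>w\<in>I. x w ^ ?m w :: 'k)"
    by (rule hpoly_fun_monomial) (use assms in \<open>auto simp: monomials_def\<close>)
  moreover have "(\<Prod>w\<in>I. x w ^ ?m w) = x v" for x :: "'a \<Rightarrow> 'k"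
    using assms by (simp add: if_distrib[of "power _"] cong: if_cong)
  ultimately show ?thesis by simp
qed

lemma hpoly_fun_linear: "finite I \<Longrightarrow> hpoly_fun I 1 (\<lambda>x. \<Sum>v\<in>I. a v * x v)"
  by (intro hpoly_fun_sum hpoly_fun_cmult hpoly_fun_var)

lemma hpoly_fun_linear_subst:
  assumes "finite I" "finite J" "is_hpoly I e P" "\<And>v. v \<in> I \<Longrightarrow> hpoly_fun J 1 (L v)"
  shows "hpoly_fun J e (\<lambda>x. peval I P (\<lambda>v. L v x))"
  unfolding peval_hpoly[OF assms(1,3)]
proof (intro hpoly_fun_sum hpoly_fun_cmult)
  fix m assume "m \<in> monomials I e"
  then have "(\<Sum>v\<in>I. m v * 1) = e" by (simp add: monomials_def)
  moreover have "hpoly_fun J (\<Sum>v\<in>I. m v * 1) (\<lambda>x. \<Prod>v\<in>I. L v x ^ m v)"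
    by (intro hpoly_fun_prod hpoly_fun_power assms(2,4))
  ultimately show "hpoly_fun J e (\<lambda>x. \<Prod>v\<in>I. L v x ^ m v)" by simp
qed

subsection \<open>Forms and directional derivatives\<close>

definition vscale :: "'k::field \<Rightarrow> (nat \<Rightarrow> 'k) \<Rightarrow> nat \<Rightarrow> 'k" where
  "vscale c v = (\<lambda>i. c * v i)"

global_interpretation vectors: vector_space "vscale :: 'k::field \<Rightarrow> (nat \<Rightarrow> 'k) \<Rightarrow> nat \<Rightarrow> 'k"
  by unfold_locales (auto simp: vscale_def algebra_simps)

global_interpretation forms: vector_space "fscale :: 'k::field \<Rightarrow> 'k form \<Rightarrow> 'k form"
  by unfold_locales (auto simp: fscale_def algebra_simps)

lemma sum_fun_apply: "(\<Sum>i\<in>I. F i) x = (\<Sum>i\<in>I. F i x)"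
  by (induction I rule: infinite_finite_induct) auto

lemma form_iff: "form n e f \<longleftrightarrow> (\<forall>m. f m \<noteq> 0 \<longrightarrow> m \<in> monomials {..<n} e)"
  by (simp add: form_def is_hpoly_iff)

lemma feval_form:
  "form n e f \<Longrightarrow> feval n f x = (\<Sum>m\<in>monomials {..<n} e. f m * (\<Prod>i<n. x i ^ m i))"
  by (simp add: form_def feval_def peval_hpoly)

lemma form_degree_0_eqI:
  "form n 0 g \<Longrightarrow> form n 0 h \<Longrightarrow> g (\<lambda>_. 0) = h (\<lambda>_. 0) \<Longrightarrow> g = h"
  by (rule ext) (metis finite_lessThan form_iff monomials_0 singletonD)

lemma feval_cong: "(\<And>i. i < n \<Longrightarrow> x i = y i) \<Longrightarrow> feval n f x = feval n f y"
  unfolding feval_def by (rule peval_cong) simp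

lemma feval_homogeneous: "form n e f \<Longrightarrow> feval n f (vscale c x) = c ^ e * feval n f x"
  by (simp add: form_def feval_def vscale_def peval_homogeneous)

lemma feval_at_0: "form n (Suc e) f \<Longrightarrow> feval n f 0 = 0"
  using feval_homogeneous[of n "Suc e" f 0 0] by simp

lemma form_0 [simp]: "form n e 0"
  and form_add: "form n e f \<Longrightarrow> form n e g \<Longrightarrow> form n e (f + g)"
  and form_fscale: "form n e f \<Longrightarrow> form n e (fscale c f)"
  unfolding form_iff fscale_def by (auto, metis add.right_neutral)

lemma subspace_forms: "forms.subspace {f. form n e f}"
  by (auto intro!: forms.subspaceI form_add form_fscale)

lemma form_diff: "form n e f \<Longrightarrow> form n e g \<Longrightarrow> form n e (f - g)"
  using forms.subspace_diff[OF subspace_forms] by blast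

lemma form_sum: "(\<And>i. i \<in> I \<Longrightarrow> form n e (F i)) \<Longrightarrow> form n e (\<Sum>i\<in>I. F i)"
  using forms.subspace_sum[OF subspace_forms, of I F] by blast

lemma feval_0 [simp]: "feval n 0 x = 0"
  by (simp add: feval_def peval_def)

lemma feval_add:
  assumes "form n e f" "form n e g"
  shows "feval n (f + g) x = feval n f x + feval n g x"
  by (simp add: feval_form[OF form_add[OF assms]] feval_form[OF assms(1)] feval_form[OF assms(2)]
      distrib_right sum.distrib)

lemma feval_fscale: "form n e f \<Longrightarrow> feval n (fscale c f) x = c * feval n f x"
  using feval_form[OF form_fscale, of n e f]
  by (simp add: feval_form fscale_def sum_distrib_left mult.assoc)

lemma feval_diff:
  assumes "form n e f" "form n e g"
  shows "feval n (f - g) x = feval n f x - feval n g x"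
  using feval_add[OF form_diff[OF assms] assms(2)] by simp

lemma feval_sum:
  "(\<And>i. i \<in> I \<Longrightarrow> form n e (F i)) \<Longrightarrow> feval n (\<Sum>i\<in>I. F i) x = (\<Sum>i\<in>I. feval n (F i) x)"
  by (induction I rule: infinite_finite_induct) (auto simp: feval_add[of n e] form_sum)

lemma ex_form_linear_subst:
  assumes "form m e f"
  obtains h where "form n e h" "\<And>x. feval n h x = feval m f (lin n A x)"
proof -
  have "hpoly_fun {..<n} e (\<lambda>x. peval {..<m} f (\<lambda>i. lin n A x i))"
    using assms unfolding form_def lin_def
    by (intro hpoly_fun_linear_subst hpoly_fun_linear) auto
  then show thesis
    using that unfolding form_def feval_def by (rule ex_hpoly[rotated]) auto
qed

global_interpretation pderiv_form: Vector_Spaces.linear fscale fscale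
  "pderiv_form i :: 'k::field form \<Rightarrow> 'k form" for i
  by (auto simp: Vector_Spaces.linear_iff forms.vector_space_axioms pderiv_form_def fscale_def
      algebra_simps)

lemma pderiv_form_commute: "pderiv_form i (pderiv_form j f) = pderiv_form j (pderiv_form i f)"
  by (cases "i = j") (auto simp: pderiv_form_def fun_upd_twist)

lemma monomials_Suc_iff:
  assumes "finite I" "i \<in> I"
  shows "m(i := Suc (m i)) \<in> monomials I (Suc e) \<longleftrightarrow> m \<in> monomials I e"
proof -
  have "sum (m(i := Suc (m i))) I = Suc (sum m I)"
    using assms by (simp add: sum.remove)
  then show ?thesis using assms(2) by (auto simp: monomials_def)
qed

lemma form_pderiv_form: "form n (Suc e) f \<Longrightarrow> i < n \<Longrightarrow> form n e (pderiv_form i f)"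
  unfolding form_iff pderiv_form_def using monomials_Suc_iff[of "{..<n}" i] by fastforce

definition dir_deriv :: "nat \<Rightarrow> (nat \<Rightarrow> 'k::field) \<Rightarrow> 'k form \<Rightarrow> 'k form" where
  "dir_deriv n v f = (\<Sum>i<n. fscale (v i) (pderiv_form i f))"

lemma dir_deriv_apply: "dir_deriv n v f m = (\<Sum>i<n. v i * pderiv_form i f m)"
  by (simp add: dir_deriv_def sum_fun_apply fscale_def)

lemma form_dir_deriv: "form n (Suc e) f \<Longrightarrow> form n e (dir_deriv n v f)"
  unfolding dir_deriv_def by (intro form_sum form_fscale form_pderiv_form) auto

global_interpretation dir_deriv_vec: Vector_Spaces.linear vscale fscale "\<lambda>v. dir_deriv n v f"
  for n and f :: "'k::field form"
  by (auto simp: Vector_Spaces.linear_iff forms.vector_space_axioms vectors.vector_space_axioms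
      dir_deriv_def vscale_def forms.scale_left_distrib sum.distrib forms.scale_sum_right)

global_interpretation dir_deriv_form: Vector_Spaces.linear fscale fscale "dir_deriv n v"
  for n and v :: "nat \<Rightarrow> 'k::field"
  by (auto simp: Vector_Spaces.linear_iff forms.vector_space_axioms dir_deriv_def pderiv_form.add
      pderiv_form.scale forms.scale_right_distrib sum.distrib forms.scale_sum_right mult.commute)

lemma dir_deriv_cong: "(\<And>i. i < n \<Longrightarrow> u i = v i) \<Longrightarrow> dir_deriv n u f = dir_deriv n v f"
  by (simp add: dir_deriv_def)

lemma dir_deriv_commute: "dir_deriv n u (dir_deriv n v f) = dir_deriv n v (dir_deriv n u f)"
proof -
  have "dir_deriv n u (dir_deriv n v f)
      = (\<Sum>i<n. \<Sum>j<n. fscale (u i * v j) (pderiv_form i (pderiv_form j f)))" for u v :: "nat \<Rightarrow> 'a"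
    by (simp add: dir_deriv_def pderiv_form.sum pderiv_form.scale forms.scale_sum_right)
  from this[of u v] this[of v u] show ?thesis
    by (simp add: pderiv_form_commute[of _ _ f] mult.commute, subst sum.swap)
      (simp add: pderiv_form_commute)
qed

definition std_basis :: "nat \<Rightarrow> nat \<Rightarrow> 'k::field" where
  "std_basis i = (\<lambda>j. if j = i then 1 else 0)"

lemma dir_deriv_std_basis: "i < n \<Longrightarrow> dir_deriv n (std_basis i) f = pderiv_form i f"
  by (simp add: dir_deriv_def std_basis_def if_distrib[of "\<lambda>c. fscale c _"] cong: if_cong)

lemma sum_monomials_Suc:
  assumes "finite I" "i \<in> I" "\<And>m. m i = 0 \<Longrightarrow> g m = 0"
  shows "sum g (monomials I (Suc e)) = (\<Sum>m\<in>monomials I e. g (m(i := Suc (m i))))"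
proof -
  have "sum g (monomials I (Suc e)) = sum g {m \<in> monomials I (Suc e). m i \<noteq> 0}"
    using assms(1,3) by (intro sum.mono_neutral_right) (auto simp: finite_monomials)
  also have "\<dots> = (\<Sum>m\<in>monomials I e. g (m(i := Suc (m i))))"
  proof (rule sum.reindex_bij_witness[of _ "\<lambda>m. m(i := Suc (m i))" "\<lambda>m. m(i := m i - 1)"])
    fix m assume m: "m \<in> {m \<in> monomials I (Suc e). m i \<noteq> 0}"
    then show shift: "(m(i := m i - 1))(i := Suc ((m(i := m i - 1)) i)) = m" by auto
    then show "m(i := m i - 1) \<in> monomials I e"
      using m monomials_Suc_iff[OF assms(1,2), of "m(i := m i - 1)" e] by simp
    show "g ((m(i := m i - 1))(i := Suc ((m(i := m i - 1)) i))) = g m" by (simp only: shift)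
  next
    fix m assume "m \<in> monomials I e"
    then show "m(i := Suc (m i)) \<in> {m \<in> monomials I (Suc e). m i \<noteq> 0}"
      by (simp add: monomials_Suc_iff[OF assms(1,2), simplified])
  qed simp
  finally show ?thesis .
qed

definition xmul :: "nat \<Rightarrow> 'k::field form \<Rightarrow> 'k form" where
  "xmul i f = (\<lambda>m. if m i = 0 then 0 else f (m(i := m i - 1)))"

global_interpretation xmul: Vector_Spaces.linear fscale fscale
  "xmul i :: 'k::field form \<Rightarrow> 'k form" for i
  by (auto simp: Vector_Spaces.linear_iff forms.vector_space_axioms xmul_def fscale_def)

lemma form_xmul:
  assumes "form n e f" "i < n"
  shows "form n (Suc e) (xmul i f)"
  unfolding form_iff
proof (intro allI impI)
  fix m assume "xmul i f m \<noteq> 0"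
  then have "m i \<noteq> 0" "m(i := m i - 1) \<in> monomials {..<n} e"
    using assms(1) by (auto simp: xmul_def form_iff split: if_splits)
  then show "m \<in> monomials {..<n} (Suc e)"
    using assms(2) monomials_Suc_iff[of "{..<n}" i "m(i := m i - 1)" e] by simp
qed

lemma feval_xmul:
  assumes "form n e f" "i < n"
  shows "feval n (xmul i f) x = x i * feval n f x"
proof -
  have "feval n (xmul i f) x = (\<Sum>m\<in>monomials {..<n} e. f m * (\<Prod>j<n. x j ^ (m(i := Suc (m i))) j))"
    unfolding feval_form[OF form_xmul[OF assms]] using assms(2)
    by (subst sum_monomials_Suc[of _ i]) (auto simp: xmul_def)
  also have "\<dots> = (\<Sum>m\<in>monomials {..<n} e. f m * (x i * (\<Prod>j<n. x j ^ m j)))"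
    using assms(2) by (simp add: prod.remove[of _ i] mult.assoc)
  finally show ?thesis by (simp add: feval_form[OF assms(1)] sum_distrib_left mult_ac)
qed

lemma pderiv_form_xmul:
  "pderiv_form j (xmul i f) = (if i = j then f else 0) + xmul i (pderiv_form j f)"
proof
  fix m
  show "pderiv_form j (xmul i f) m = ((if i = j then f else 0) + xmul i (pderiv_form j f)) m"
    by (cases "m i") (auto simp: pderiv_form_def xmul_def fun_upd_twist fun_upd_idem algebra_simps)
qed

lemma Euler_identity_form:
  assumes "form n e f"
  shows "(\<Sum>i<n. xmul i (pderiv_form i f)) = fscale (of_nat e) f"
proof
  fix m
  have "xmul i (pderiv_form i f) m = of_nat (m i) * f m" for i
    by (cases "m i") (auto simp: xmul_def pderiv_form_def fun_upd_idem)
  moreover have "sum m {..<n} = e" if "f m \<noteq> 0"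
    using assms that by (auto simp: form_iff monomials_def)
  ultimately show "(\<Sum>i<n. xmul i (pderiv_form i f)) m = fscale (of_nat e) f m"
    by (cases "f m = 0")
      (auto simp: sum_fun_apply fscale_def simp flip: sum_distrib_right of_nat_sum)
qed

text \<open>Poincar\'e's lemma; the primitive comes from Euler's identity.\<close>

lemma ex_primitive_form:
  fixes h :: "nat \<Rightarrow> 'k::field form"
  assumes char: "of_nat (Suc d) \<noteq> (0::'k)" and h: "\<And>i. i < n \<Longrightarrow> form n d (h i)"
    and closed: "\<And>i j. i < n \<Longrightarrow> j < n \<Longrightarrow> pderiv_form j (h i) = pderiv_form i (h j)"
  obtains g where "form n (Suc d) g" "\<And>i. i < n \<Longrightarrow> pderiv_form i g = h i"
proof -
  define g where "g = (\<Sum>i<n. xmul i (h i))"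
  have g: "form n (Suc d) g" unfolding g_def by (intro form_sum form_xmul h) auto
  have dg: "pderiv_form j g = fscale (of_nat (Suc d)) (h j)" if j: "j < n" for j
  proof -
    have "pderiv_form j g = (\<Sum>i<n. (if i = j then h i else 0) + xmul i (pderiv_form j (h i)))"
      by (simp add: g_def pderiv_form.sum pderiv_form_xmul)
    also have "\<dots> = h j + (\<Sum>i<n. xmul i (pderiv_form i (h j)))"
      using j by (simp add: sum.distrib closed[OF _ j])
    also have "\<dots> = fscale (of_nat (Suc d)) (h j)"
      by (simp add: Euler_identity_form[OF h[OF j]] forms.scale_left_distrib)
    finally show ?thesis .
  qed
  show thesis
  proof (rule that)
    let ?c = "inverse (of_nat (Suc d)) :: 'k"
    show "form n (Suc d) (fscale ?c g)" by (rule form_fscale[OF g])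
    show "pderiv_form j (fscale ?c g) = h j" if "j < n" for j
      using char by (simp add: pderiv_form.scale dg[OF that] del: of_nat_Suc)
  qed
qed

subsection \<open>Restriction of a form to a line\<close>

lemma of_nat_neq_0_if_fact_neq_0:
  assumes "of_nat (fact e) \<noteq> (0::'k::field)" "0 < k" "k \<le> e"
  shows "of_nat k \<noteq> (0::'k)"
proof -
  have "k dvd fact e" using assms(2,3) by (simp add: dvd_fact)
  then show ?thesis using assms(1) by (auto elim!: dvdE)
qed

lemma of_nat_fact_neq_0_mono:
  assumes "of_nat (fact e) \<noteq> (0::'k::field)" "k \<le> e"
  shows "of_nat (fact k) \<noteq> (0::'k)"
proof -
  have "(fact k :: nat) dvd fact e" using assms(2) by (rule fact_dvd)
  then show ?thesis using assms(1) by (metis dvdE mult_zero_left of_nat_mult)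
qed

lemma poly_eqI_of_nat_fact:
  fixes p q :: "'k::field poly"
  assumes "of_nat (fact e) \<noteq> (0::'k)" "degree p \<le> e" "degree q \<le> e" "\<And>t. poly p t = poly q t"
  shows "p = q"
proof -
  have "(of_nat j :: 'k) \<noteq> of_nat k" if "j < k" "k \<le> e" for j k
    using of_nat_neq_0_if_fact_neq_0[OF assms(1) _ order.trans[OF diff_le_self that(2)], of j] that
    by (auto simp: of_nat_diff)
  then have "inj_on (of_nat :: nat \<Rightarrow> 'k) {..e}"
    by (intro linorder_inj_onI) auto
  then have "card ((of_nat :: nat \<Rightarrow> 'k) ` {..e}) = Suc e" by (simp add: card_image)
  then show ?thesis using assms(2-4) by (intro poly_eqI_degree[of "of_nat ` {..e}"]) auto
qed

lemma degree_eq_0_if_pderiv_eq_0: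
  fixes p :: "'k::field poly"
  assumes "of_nat (fact e) \<noteq> (0::'k)" "degree p \<le> e" "pderiv p = 0"
  shows "degree p = 0"
proof (rule ccontr)
  assume *: "degree p \<noteq> 0"
  then have "of_nat (degree p) * lead_coeff p = coeff (pderiv p) (degree p - 1)"
    by (simp add: coeff_pderiv del: of_nat_Suc)
  moreover have "of_nat (degree p) \<noteq> (0::'k)"
    using * assms(2) by (intro of_nat_neq_0_if_fact_neq_0[OF assms(1)]) auto
  ultimately show False using * assms(3) by auto
qed

lemma pderiv_prod_power:
  assumes "finite I"
  shows "pderiv (\<Prod>i\<in>I. p i ^ m i)
    = (\<Sum>i\<in>I. smult (of_nat (m i)) (\<Prod>j\<in>I. p j ^ (m(i := m i - 1)) j) * pderiv (p i))"
  unfolding pderiv_prod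
proof (rule sum.cong[OF refl])
  fix i assume i: "i \<in> I"
  have "(\<Prod>j\<in>I. p j ^ (m(i := m i - 1)) j) = p i ^ (m i - 1) * (\<Prod>j\<in>I - {i}. p j ^ m j)"
    using i assms by (simp add: prod.remove)
  then show "(\<Prod>j\<in>I - {i}. p j ^ m j) * pderiv (p i ^ m i)
      = smult (of_nat (m i)) (\<Prod>j\<in>I. p j ^ (m(i := m i - 1)) j) * pderiv (p i)"
    by (simp add: pderiv_power mult_ac)
qed

definition line_poly :: "nat \<Rightarrow> 'k::field form \<Rightarrow> (nat \<Rightarrow> 'k) \<Rightarrow> (nat \<Rightarrow> 'k) \<Rightarrow> 'k poly" where
  "line_poly n f x v = (\<Sum>m | f m \<noteq> 0. smult (f m) (\<Prod>i<n. [:x i, v i:] ^ m i))"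

lemma poly_line_poly: "poly (line_poly n f x v) t = feval n f (x + vscale t v)"
  by (simp add: line_poly_def feval_def peval_def poly_sum poly_prod vscale_def)

lemma line_poly_form:
  assumes "form n e f"
  shows "line_poly n f x v = (\<Sum>m\<in>monomials {..<n} e. smult (f m) (\<Prod>i<n. [:x i, v i:] ^ m i))"
  unfolding line_poly_def using assms
  by (intro sum.mono_neutral_left) (auto simp: form_iff finite_monomials)

lemma degree_line_poly:
  assumes "form n e f"
  shows "degree (line_poly n f x v) \<le> e"
  unfolding line_poly_form[OF assms]
proof (rule degree_sum_le)
  fix m assume m: "m \<in> monomials {..<n} e"
  have "degree (\<Prod>i<n. [:x i, v i:] ^ m i) \<le> (\<Sum>i<n. degree ([:x i, v i:] ^ m i))"
    using degree_prod_sum_le[of "{..<n}" "\<lambda>i. [:x i, v i:] ^ m i"] by (simp add: o_def)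
  also have "\<dots> \<le> (\<Sum>i<n. m i)"
  proof (rule sum_mono)
    fix i
    show "degree ([:x i, v i:] ^ m i) \<le> m i"
      using degree_power_le[of "[:x i, v i:]" "m i"] by (cases "v i = 0") auto
  qed
  also have "\<dots> = e" using m by (simp add: monomials_def)
  finally show "degree (smult (f m) (\<Prod>i<n. [:x i, v i:] ^ m i)) \<le> e"
    using degree_smult_le le_trans by blast
qed (simp add: finite_monomials)

lemma pderiv_line_poly:
  assumes "form n (Suc e) f"
  shows "pderiv (line_poly n f x v) = line_poly n (dir_deriv n v f) x v"
proof -
  define X where "X m = (\<Prod>i<n. [:x i, v i:] ^ m i)" for m :: "nat \<Rightarrow> nat"
  let ?M = "monomials {..<n}"
  have pderiv_X: "pderiv (X m) = (\<Sum>i<n. smult (v i * of_nat (m i)) (X (m(i := m i - 1))))" for m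
    unfolding X_def by (simp add: pderiv_prod_power pderiv_pCons mult.commute)
  have "pderiv (line_poly n f x v) = (\<Sum>m\<in>?M (Suc e). smult (f m) (pderiv (X m)))"
    by (simp add: line_poly_form[OF assms] X_def pderiv_sum pderiv_smult)
  also have "\<dots> = (\<Sum>i<n. \<Sum>m\<in>?M (Suc e). smult (f m * v i * of_nat (m i)) (X (m(i := m i - 1))))"
    unfolding pderiv_X smult_sum2 by (subst sum.swap) (simp add: mult.assoc)
  also have "\<dots> = (\<Sum>i<n. \<Sum>m\<in>?M e. smult (fscale (v i) (pderiv_form i f) m) (X m))"
  proof (rule sum.cong[OF refl])
    fix i assume "i \<in> {..<n}"
    then show "(\<Sum>m\<in>?M (Suc e). smult (f m * v i * of_nat (m i)) (X (m(i := m i - 1))))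
        = (\<Sum>m\<in>?M e. smult (fscale (v i) (pderiv_form i f) m) (X m))"
      by (subst sum_monomials_Suc[of _ i]) (auto simp: fscale_def pderiv_form_def mult_ac)
  qed
  also have "\<dots> = line_poly n (dir_deriv n v f) x v"
    unfolding line_poly_form[OF form_dir_deriv[OF assms]] X_def[symmetric]
    by (subst sum.swap) (simp add: dir_deriv_def sum_fun_apply smult_sum)
  finally show ?thesis .
qed

lemma feval_dir_deriv_eqI:
  fixes f h :: "'k::field form"
  assumes char: "of_nat (fact (Suc e)) \<noteq> (0::'k)"
    and f: "form n (Suc e) f" and h: "form m (Suc e) h"
    and eq: "\<And>t. feval n f (x + vscale t v) = feval m h (y + vscale t w)"
  shows "feval n (dir_deriv n v f) x = feval m (dir_deriv m w h) y"
proof -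
  have "line_poly n f x v = line_poly m h y w"
    by (rule poly_eqI_of_nat_fact[OF char])
      (simp_all add: degree_line_poly[OF f] degree_line_poly[OF h] poly_line_poly eq)
  then have "line_poly n (dir_deriv n v f) x v = line_poly m (dir_deriv m w h) y w"
    by (simp flip: pderiv_line_poly[OF f] pderiv_line_poly[OF h])
  then have "poly (line_poly n (dir_deriv n v f) x v) 0
      = poly (line_poly m (dir_deriv m w h) y w) 0"
    by simp
  then show ?thesis by (simp add: poly_line_poly)
qed

lemma form_eq_0_if_pderivs_0:
  fixes f :: "'k::field form"
  assumes "of_nat (Suc e) \<noteq> (0::'k)" "form n (Suc e) f" "\<And>i. i < n \<Longrightarrow> pderiv_form i f = 0"
  shows "f = 0"
  using Euler_identity_form[OF assms(2)] assms(1,3) by (simp add: xmul.zero del: of_nat_Suc)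

lemma form_eq_0_if_feval_0:
  fixes f :: "'k::field form"
  shows "of_nat (fact e) \<noteq> (0::'k) \<Longrightarrow> form n e f \<Longrightarrow> (\<And>x. feval n f x = 0) \<Longrightarrow> f = 0"
proof (induction e arbitrary: f)
  case 0
  have "f (\<lambda>_. 0) = 0"
    using 0(3)[of 0] by (simp add: feval_form[OF 0(2)] monomials_0)
  then show ?case
    using 0(2) by (auto simp: form_iff monomials_0)
next
  case (Suc e)
  show ?case
  proof (rule form_eq_0_if_pderivs_0[OF _ Suc.prems(2)])
    show "of_nat (Suc e) \<noteq> (0::'k)"
      by (rule of_nat_neq_0_if_fact_neq_0[OF Suc.prems(1)]) auto
    fix i assume i: "i < n"
    show "pderiv_form i f = 0"
    proof (rule Suc.IH)
      show "of_nat (fact e) \<noteq> (0::'k)" using of_nat_fact_neq_0_mono[OF Suc.prems(1)] by simp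
      show "form n e (pderiv_form i f)" by (rule form_pderiv_form[OF Suc.prems(2) i])
      have "feval n (dir_deriv n (std_basis i) f) x = feval n (dir_deriv n 0 f) x" for x
        by (rule feval_dir_deriv_eqI[OF Suc.prems(1,2,2)]) (simp add: Suc.prems(3))
      then show "feval n (pderiv_form i f) x = 0" for x
        using i by (simp add: dir_deriv_std_basis dir_deriv_vec.zero)
    qed
  qed
qed

lemma form_eqI:
  fixes f g :: "'k::field form"
  assumes "of_nat (fact e) \<noteq> (0::'k)" "form n e f" "form n e g" "\<And>x. feval n f x = feval n g x"
  shows "f = g"
  using form_eq_0_if_feval_0[OF assms(1) form_diff[OF assms(2,3)]] assms(4)
  by (simp add: feval_diff[OF assms(2,3)])

lemma feval_translate_if_dir_deriv_0:
  fixes f :: "'k::field form"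
  assumes "of_nat (fact e) \<noteq> (0::'k)" "form n e f" "dir_deriv n v f = 0"
  shows "feval n f (x + v) = feval n f x"
proof -
  let ?p = "line_poly n f x v"
  have "degree ?p = 0"
  proof (cases e)
    case 0
    then show ?thesis using degree_line_poly[OF assms(2), of x v] by simp
  next
    case (Suc e')
    then have "pderiv ?p = 0"
      using assms(2,3) by (simp add: pderiv_line_poly) (simp add: line_poly_def)
    then show ?thesis
      by (rule degree_eq_0_if_pderiv_eq_0[OF assms(1) degree_line_poly[OF assms(2)]])
  qed
  then obtain c where "?p = [:c:]" by (rule degree_eq_zeroE)
  then have "poly ?p 1 = poly ?p 0" by simp
  then show ?thesis by (simp add: poly_line_poly)
qed

lemma dir_deriv_eq_0_iff:
  fixes f :: "'k::field form"
  assumes char: "of_nat (fact (Suc e)) \<noteq> (0::'k)" and f: "form n (Suc e) f"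
  shows "dir_deriv n v f = 0 \<longleftrightarrow> (\<forall>x t. feval n f (x + vscale t v) = feval n f x)"
proof
  assume "dir_deriv n v f = 0"
  then show "\<forall>x t. feval n f (x + vscale t v) = feval n f x"
    using feval_translate_if_dir_deriv_0[OF char f] by (simp add: dir_deriv_vec.scale)
next
  assume invariant: "\<forall>x t. feval n f (x + vscale t v) = feval n f x"
  have "feval n (dir_deriv n v f) x = feval n (dir_deriv n 0 f) x" for x
    by (rule feval_dir_deriv_eqI[OF char f f]) (simp add: invariant)
  then show "dir_deriv n v f = 0"
    using of_nat_fact_neq_0_mono[OF char, of e]
    by (intro form_eq_0_if_feval_0[OF _ form_dir_deriv[OF f]]) (simp_all add: dir_deriv_vec.zero)
qed

lemma feval_translate_if_dir_deriv_dir_deriv_0: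
  fixes f :: "'k::field form"
  assumes char: "of_nat (fact (Suc e)) \<noteq> (0::'k)" and f: "form n (Suc e) f"
    and zero: "dir_deriv n v (dir_deriv n v f) = 0"
  shows "feval n f (x + v) = feval n f x + feval n (dir_deriv n v f) x"
proof -
  let ?p = "line_poly n f x v" and ?b = "feval n (dir_deriv n v f) x"
  have char': "of_nat (fact e) \<noteq> (0::'k)" using of_nat_fact_neq_0_mono[OF char] by simp
  have "poly (pderiv ?p) t = ?b" for t
    using feval_translate_if_dir_deriv_0[OF char' form_dir_deriv[OF f], of "vscale t v" v x] zero
    by (simp add: pderiv_line_poly[OF f] poly_line_poly dir_deriv_vec.scale)
  then have "pderiv ?p = [:?b:]"
    by (intro poly_eqI_of_nat_fact[OF char'])
      (simp_all add: pderiv_line_poly[OF f] degree_line_poly[OF form_dir_deriv[OF f]])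
  then have "pderiv (?p - [:0, ?b:]) = 0" by (simp add: pderiv_diff pderiv_pCons)
  moreover have "degree (?p - [:0, ?b:]) \<le> Suc e"
    by (rule degree_diff_le) (auto simp: degree_line_poly[OF f])
  ultimately have "degree (?p - [:0, ?b:]) = 0"
    by (intro degree_eq_0_if_pderiv_eq_0[OF char])
  then obtain c where "?p - [:0, ?b:] = [:c:]" by (rule degree_eq_zeroE)
  then have "poly (?p - [:0, ?b:]) 1 = poly (?p - [:0, ?b:]) 0" by simp
  then show ?thesis by (simp add: poly_line_poly algebra_simps)
qed

lemma feval_add_if_dir_deriv_dir_deriv_0:
  fixes f :: "'k::field form"
  assumes char: "of_nat (fact (Suc e)) \<noteq> (0::'k)" and f: "form n (Suc e) f"
    and orth: "dir_deriv n u (dir_deriv n w f) = 0"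
  shows "feval n f (u + w) = feval n f u + feval n f w"
proof -
  let ?p = "line_poly n f w u - line_poly n f 0 u"
  have char': "of_nat (fact e) \<noteq> (0::'k)" using of_nat_fact_neq_0_mono[OF char] by simp
  have "feval n (dir_deriv n u f) (w + vscale t u) = feval n (dir_deriv n u f) (vscale t u)" for t
    using feval_translate_if_dir_deriv_0[OF char' form_dir_deriv[OF f], of w u "vscale t u"] orth
    by (simp add: dir_deriv_commute[of n w] add.commute)
  then have "line_poly n (dir_deriv n u f) w u = line_poly n (dir_deriv n u f) 0 u"
    by (intro poly_eqI_of_nat_fact[OF char'] degree_line_poly form_dir_deriv f)
      (simp add: poly_line_poly)
  then have "pderiv ?p = 0" by (simp add: pderiv_diff pderiv_line_poly[OF f])
  moreover have "degree ?p \<le> Suc e" by (intro degree_diff_le degree_line_poly f)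
  ultimately have "degree ?p = 0" by (intro degree_eq_0_if_pderiv_eq_0[OF char])
  then obtain c where "?p = [:c:]" by (rule degree_eq_zeroE)
  then have "poly ?p 1 = poly ?p 0" by simp
  then show ?thesis by (simp add: poly_line_poly feval_at_0[OF f] algebra_simps)
qed

subsection \<open>Finite-dimensional subspaces\<close>

definition append_family :: "nat \<Rightarrow> (nat \<Rightarrow> 'a) \<Rightarrow> (nat \<Rightarrow> 'a) \<Rightarrow> nat \<Rightarrow> 'a" where
  "append_family m a b = (\<lambda>j. if j < m then a j else b (j - m))"

lemma append_family_simps [simp]:
  "j < m \<Longrightarrow> append_family m a b j = a j" "append_family m a b (m + j) = b j"
  by (auto simp: append_family_def)

lemma lessThan_add_cases:
  assumes "j < m + (k::nat)"
  obtains "j < m" | i where "j = m + i" "i < k"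
  using assms by (metis add_less_cancel_left le_add_diff_inverse not_le)

lemma lessThan_add_eq: "{..<m + k} = {..<m} \<union> (+) m ` {..<k}" for m k :: nat
  by (auto elim: lessThan_add_cases)

lemma (in comm_monoid_set) lessThan_add:
  "F g {..<m + k} = f (F g {..<m}) (F (\<lambda>j. g (m + j)) {..<k})"
  for m k :: nat
  by (induction k) (simp_all add: assoc)

lemma sum_split_lessThan:
  fixes l n :: nat
  assumes "l \<le> n"
  shows "sum g {..<n} = sum g {..<l} + (\<Sum>j<n - l. g (l + j))"
  using sum.lessThan_add[where g = g and m = l and k = "n - l"] assms by simp

lemma image_append_family: "append_family m a b ` {..<m + k} = a ` {..<m} \<union> b ` {..<k}"
  unfolding lessThan_add_eq image_Un by (simp add: image_image)

lemma bij_betw_append_family: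
  assumes "bij_betw a {..<m} A" "bij_betw b {..<k} B" "A \<inter> B = {}"
  shows "bij_betw (append_family m a b) {..<m + k} (A \<union> B)"
  unfolding lessThan_add_eq
proof (rule bij_betw_combine[OF _ _ assms(3)])
  show "bij_betw (append_family m a b) {..<m} A"
    using assms(1) by (rule bij_betw_cong[THEN iffD1, rotated]) simp
  show "bij_betw (append_family m a b) ((+) m ` {..<k}) B"
    using assms(2) by (auto simp: bij_betw_def inj_on_def image_image)
qed

locale finite_dimensional_subspace = vector_space scale
  for scale :: "'a::field \<Rightarrow> 'b::ab_group_add \<Rightarrow> 'b" (infixr \<open>*s\<close> 75) +
  fixes V B :: "'b set"
  assumes subspace_V: "subspace V" and finite_B: "finite B" and span_B: "V \<subseteq> span B"
begin

definition lincomb :: "nat \<Rightarrow> (nat \<Rightarrow> 'b) \<Rightarrow> (nat \<Rightarrow> 'a) \<Rightarrow> 'b" where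
  "lincomb m b c = (\<Sum>j<m. c j *s b j)"

lemma lincomb_0: "(\<And>j. j < m \<Longrightarrow> c j = 0) \<Longrightarrow> lincomb m b c = 0"
  by (simp add: lincomb_def)

lemma lincomb_in: "subspace S \<Longrightarrow> (\<And>j. j < m \<Longrightarrow> b j \<in> S) \<Longrightarrow> lincomb m b c \<in> S"
  unfolding lincomb_def by (intro subspace_sum subspace_scale) auto

lemma lincomb_append:
  "lincomb (m + k) (append_family m a b) c = lincomb m a c + lincomb k b (\<lambda>j. c (m + j))"
  by (simp add: lincomb_def sum.lessThan_add)

lemma lincomb_append_coeffs:
  "lincomb (m + k) (append_family m a b) (append_family m c c') = lincomb m a c + lincomb k b c'"
  unfolding lincomb_append by (simp add: lincomb_def)

lemma linear_lincomb:
  assumes "Vector_Spaces.linear scale scale T"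
  shows "T (lincomb m b c) = lincomb m (\<lambda>j. T (b j)) c"
proof -
  interpret T: Vector_Spaces.linear scale scale T by (rule assms)
  show ?thesis by (simp add: lincomb_def T.sum T.scale)
qed

lemma range_lincomb: "range (lincomb m b) = span (b ` {..<m})"
proof
  show "range (lincomb m b) \<subseteq> span (b ` {..<m})"
    by (auto simp: lincomb_def intro!: span_sum span_scale intro: span_base)
  have "subspace (range (lincomb m b))"
  proof (rule subspaceI)
    show "0 \<in> range (lincomb m b)"
      by (rule range_eqI[of _ _ "\<lambda>_. 0"]) (simp add: lincomb_def)
    show "x + y \<in> range (lincomb m b)" if xy: "x \<in> range (lincomb m b)" "y \<in> range (lincomb m b)"
        for x y
    proof -
      obtain c c' where "x = lincomb m b c" "y = lincomb m b c'" using xy by blast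
      then have "x + y = lincomb m b (\<lambda>j. c j + c' j)"
        by (simp add: lincomb_def scale_left_distrib sum.distrib)
      then show ?thesis by blast
    qed
    show "r *s x \<in> range (lincomb m b)" if "x \<in> range (lincomb m b)" for r x
    proof -
      obtain c where "x = lincomb m b c" using \<open>x \<in> _\<close> by blast
      then have "r *s x = lincomb m b (\<lambda>j. r * c j)"
        by (simp add: lincomb_def scale_sum_right)
      then show ?thesis by blast
    qed
  qed
  moreover have "b j \<in> range (lincomb m b)" if "j < m" for j
    by (rule range_eqI[of _ _ "\<lambda>i. if i = j then 1 else 0"])
      (use that in \<open>simp add: lincomb_def if_distrib[of "\<lambda>c. c *s _"] cong: if_cong\<close>)
  ultimately show "span (b ` {..<m}) \<subseteq> range (lincomb m b)"
    by (intro span_minimal) auto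
qed

lemma inj_on_if_lincomb_coeffs_zero:
  assumes zero: "\<forall>c. lincomb m b c = 0 \<longrightarrow> (\<forall>j<m. c j = 0)"
  shows "inj_on b {..<m}"
proof (rule inj_onI, rule ccontr)
  fix i j assume ij: "i \<in> {..<m}" "j \<in> {..<m}" "b i = b j" "i \<noteq> j"
  define c :: "nat \<Rightarrow> 'a" where "c k = (if k = i then 1 else 0) - (if k = j then 1 else 0)" for k
  have "lincomb m b c = 0"
    using ij by (simp add: lincomb_def c_def scale_left_diff_distrib sum_subtractf
        if_distrib[of "\<lambda>a. a *s _"] cong: if_cong)
  then have "c i = 0" using zero ij(1) by blast
  then show False using ij(4) by (simp add: c_def)
qed

lemma lincomb_eq_0_imp_iff:
  "(\<forall>c. lincomb m b c = 0 \<longrightarrow> (\<forall>j<m. c j = 0)) \<longleftrightarrow> inj_on b {..<m} \<and> independent (b ` {..<m})"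
    (is "?L \<longleftrightarrow> ?R")
proof
  assume L: ?L
  then have inj: "inj_on b {..<m}" by (rule inj_on_if_lincomb_coeffs_zero)
  moreover have "independent (b ` {..<m})"
  proof (rule independent_if_scalars_zero)
    fix s w assume s: "(\<Sum>w\<in>b ` {..<m}. s w *s w) = 0" and w: "w \<in> b ` {..<m}"
    have "lincomb m b (\<lambda>j. s (b j)) = 0"
      using s by (simp add: lincomb_def sum.reindex[OF inj])
    with L w show "s w = 0" by blast
  qed simp
  ultimately show ?R ..
next
  assume R: ?R
  then have inj: "inj_on b {..<m}" ..
  show ?L
  proof (intro allI impI)
    fix c j assume c: "lincomb m b c = 0" and j: "j < m"
    define s where "s w = c (the_inv_into {..<m} b w)" for w
    have s: "s (b j) = c j" if "j < m" for j
      using that by (simp add: s_def the_inv_into_f_f[OF inj])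
    have "(\<Sum>w\<in>b ` {..<m}. s w *s w) = 0"
      using c by (simp add: sum.reindex[OF inj] lincomb_def s)
    then have "s (b j) = 0"
      by (rule independentD[rotated 3]) (use R j in auto)
    then show "c j = 0" by (simp add: s[OF j])
  qed
qed

definition basis_family :: "'b set \<Rightarrow> nat \<Rightarrow> (nat \<Rightarrow> 'b) \<Rightarrow> bool" where
  "basis_family S m b \<longleftrightarrow> range (lincomb m b) = S \<and> (\<forall>c. lincomb m b c = 0 \<longrightarrow> (\<forall>j<m. c j = 0))"

lemma basis_familyD:
  assumes "basis_family S m b"
  shows "lincomb m b c \<in> S" and "v \<in> S \<Longrightarrow> \<exists>c. v = lincomb m b c"
    and "lincomb m b c = 0 \<Longrightarrow> j < m \<Longrightarrow> c j = 0"
  using assms unfolding basis_family_def by blast+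

lemma basis_family_iff:
  "basis_family S m b \<longleftrightarrow> bij_betw b {..<m} (b ` {..<m}) \<and> independent (b ` {..<m})
      \<and> span (b ` {..<m}) = S"
  by (auto simp: basis_family_def lincomb_eq_0_imp_iff range_lincomb bij_betw_def)

lemma basis_family_in: "basis_family S m b \<Longrightarrow> j < m \<Longrightarrow> b j \<in> S"
  by (auto simp: basis_family_iff intro: span_base)

lemma subspace_basis_family: "basis_family S m b \<Longrightarrow> subspace S"
  by (auto simp: basis_family_iff)

lemma dim_basis_family: "basis_family S m b \<Longrightarrow> dim S = m"
  by (metis basis_family_iff bij_betw_same_card card_lessThan dim_span_eq_card_independent)

lemma ex_basis_family_extend:
  assumes b: "basis_family S l b" and T: "subspace T" "S \<subseteq> T" "T \<subseteq> V"
  obtains k w where "basis_family T (l + k) (append_family l b w)"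
proof -
  define A where "A = b ` {..<l}"
  have A: "independent A" "A \<subseteq> T" "bij_betw b {..<l} A"
    using b T(2) basis_family_in[OF b] by (auto simp: basis_family_iff A_def)
  obtain C where C: "A \<subseteq> C" "C \<subseteq> T" "independent C" "T \<subseteq> span C"
    using maximal_independent_subset_extend[OF A(2,1)] by blast
  have "finite C"
    using independent_span_bound[OF finite_B C(3)] C(2) T(3) span_B by blast
  then obtain w where "bij_betw w {..<card (C - A)} (C - A)"
    using ex_bij_betw_nat_finite[of "C - A"] by (auto simp: atLeast0LessThan)
  then have "bij_betw (append_family l b w) {..<l + card (C - A)} (A \<union> (C - A))"
    by (intro bij_betw_append_family A(3)) auto
  moreover have "A \<union> (C - A) = C" using C(1) by blast
  ultimately have bij: "bij_betw (append_family l b w) {..<l + card (C - A)} C" by simp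
  show thesis
  proof (rule that)
    show "basis_family T (l + card (C - A)) (append_family l b w)"
      using bij bij_betw_imp_surj_on[OF bij] C(3) span_subspace[OF C(2,4) T(1)]
      by (simp add: basis_family_iff)
  qed
qed

lemma basis_family_empty: "basis_family {0} 0 b"
  by (auto simp: basis_family_def lincomb_def)

lemma ex_basis_family:
  assumes "subspace S" "S \<subseteq> V"
  obtains m b where "basis_family S m b"
proof -
  have "{0} \<subseteq> S" using subspace_0[OF assms(1)] by simp
  from ex_basis_family_extend[OF basis_family_empty assms(1) this assms(2)] that
  show thesis by blast
qed

lemma dim_mono_subspace:
  assumes "subspace S" "subspace T" "S \<subseteq> T" "T \<subseteq> V"
  shows "dim S \<le> dim T"
proof -
  obtain l b where b: "basis_family S l b" using ex_basis_family[OF assms(1)] assms(3,4) by blast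
  obtain k w where "basis_family T (l + k) (append_family l b w)"
    using ex_basis_family_extend[OF b assms(2-4)] .
  then show ?thesis using dim_basis_family[OF b] dim_basis_family by fastforce
qed

lemma subspace_eqI_dim:
  assumes "subspace S" "subspace T" "S \<subseteq> T" "T \<subseteq> V" "dim T \<le> dim S"
  shows "S = T"
proof -
  obtain l b where b: "basis_family S l b" using ex_basis_family[OF assms(1)] assms(3,4) by blast
  obtain k w where w: "basis_family T (l + k) (append_family l b w)"
    using ex_basis_family_extend[OF b assms(2-4)] .
  have "k = 0" using assms(5) dim_basis_family[OF b] dim_basis_family[OF w] by simp
  then have "lincomb (l + k) (append_family l b w) c = lincomb l b c" for c
    unfolding lincomb_append by (simp add: lincomb_0)
  then show ?thesis using b w unfolding basis_family_def by auto
qed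

lemma ascending_chain_stabilizes:
  assumes K: "\<And>i. subspace (K i)" "\<And>i. K i \<subseteq> V" "mono K"
  obtains r where "\<And>i. r \<le> i \<Longrightarrow> K i = K (r::nat)"
proof -
  have "dim (K i) < Suc (dim V)" for i
    using dim_mono_subspace[OF K(1) subspace_V K(2)] by (simp add: less_Suc_eq_le)
  then obtain r where r: "\<And>i. dim (K i) \<le> dim (K r)"
    using ex_has_greatest_nat[of "\<lambda>_. True" 0 "\<lambda>i. dim (K i)"] by blast
  show thesis
  proof (rule that)
    fix i assume "r \<le> i"
    then have "K r \<subseteq> K i" using K(3) by (rule monoD[rotated])
    from subspace_eqI_dim[OF K(1) K(1) this K(2) r] show "K i = K r" by simp
  qed
qed

lemma linear_injective_on_imp_surjective_on:
  assumes W: "subspace W" "W \<subseteq> V"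
    and T: "Vector_Spaces.linear scale scale T" "T ` W \<subseteq> W" "\<And>w. w \<in> W \<Longrightarrow> T w = 0 \<Longrightarrow> w = 0"
  shows "T ` W = W"
proof -
  obtain m b where b: "basis_family W m b" using ex_basis_family[OF W] .
  have "range (lincomb m (\<lambda>j. T (b j))) = T ` W"
    using b by (auto simp: basis_family_def linear_lincomb[OF T(1), symmetric])
  moreover have "c j = 0" if "lincomb m (\<lambda>j. T (b j)) c = 0" "j < m" for c j
    using that T(3)[OF basis_familyD(1)[OF b]] basis_familyD(3)[OF b]
    by (auto simp: linear_lincomb[OF T(1), symmetric])
  ultimately have Tb: "basis_family (T ` W) m (\<lambda>j. T (b j))" by (auto simp: basis_family_def)
  show ?thesis
    using dim_basis_family[OF b] dim_basis_family[OF Tb]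
    by (intro subspace_eqI_dim[OF subspace_basis_family[OF Tb] W(1) T(2) W(2)]) simp
qed

definition direct_decomposition :: "'b set \<Rightarrow> 'b set \<Rightarrow> 'b set \<Rightarrow> bool" where
  "direct_decomposition X U W \<longleftrightarrow>
    subspace U \<and> subspace W \<and> U \<inter> W = {0} \<and> {u + w | u w. u \<in> U \<and> w \<in> W} = X"

lemma direct_decomposition_commute: "direct_decomposition X U W \<longleftrightarrow> direct_decomposition X W U"
proof -
  have "{u + w | u w. u \<in> U \<and> w \<in> W} = {w + u | w u. w \<in> W \<and> u \<in> U}"
    using add.commute by blast
  then show ?thesis by (auto simp: direct_decomposition_def)
qed

lemma direct_decomposition_subset:
  assumes "direct_decomposition X U W"
  shows "U \<subseteq> X" and "W \<subseteq> X"
proof -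
  have X: "X = {u + w | u w. u \<in> U \<and> w \<in> W}" and zero: "0 \<in> U" "0 \<in> W"
    using assms subspace_0 by (auto simp: direct_decomposition_def)
  have "u + 0 \<in> X" if "u \<in> U" for u unfolding X using that zero(2) by blast
  then show "U \<subseteq> X" by auto
  have "0 + w \<in> X" if "w \<in> W" for w unfolding X using that zero(1) by blast
  then show "W \<subseteq> X" by auto
qed

lemma basis_family_append:
  assumes decomp: "direct_decomposition X U W"
    and a: "basis_family U m a" and b: "basis_family W k b"
  shows "basis_family X (m + k) (append_family m a b)"
  unfolding basis_family_def
proof (intro conjI allI impI)
  show "range (lincomb (m + k) (append_family m a b)) = X"
  proof (intro equalityI subsetI)
    fix v assume "v \<in> X"
    then obtain u w where "u \<in> U" "w \<in> W" and v: "v = u + w"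
      using decomp unfolding direct_decomposition_def by blast
    then obtain c c' where "u = lincomb m a c" "w = lincomb k b c'"
      using basis_familyD(2)[OF a] basis_familyD(2)[OF b] by blast
    then have "v = lincomb (m + k) (append_family m a b) (append_family m c c')"
      by (simp add: v lincomb_append_coeffs)
    then show "v \<in> range (lincomb (m + k) (append_family m a b))" by blast
  qed (use decomp basis_familyD(1)[OF a] basis_familyD(1)[OF b] in
      \<open>auto simp: lincomb_append direct_decomposition_def\<close>)
next
  fix c j assume c: "lincomb (m + k) (append_family m a b) c = 0" and j: "j < m + k"
  let ?u = "lincomb m a c" and ?w = "lincomb k b (\<lambda>j. c (m + j))"
  have W: "subspace W" and disj: "U \<inter> W = {0}" using decomp by (auto simp: direct_decomposition_def)
  have sum: "?u + ?w = 0" using c by (simp add: lincomb_append)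
  then have "?u \<in> W"
    using subspace_neg[OF W basis_familyD(1)[OF b]] by (metis add_eq_0_iff2)
  then have u: "?u = 0" using disj basis_familyD(1)[OF a, of c] by blast
  with sum have w: "?w = 0" by simp
  from j show "c j = 0"
    by (cases rule: lessThan_add_cases)
      (use basis_familyD(3)[OF a u] basis_familyD(3)[OF b w] in auto)
qed

definition endomorphism :: "('b \<Rightarrow> 'b) \<Rightarrow> bool" where
  "endomorphism T \<longleftrightarrow> Vector_Spaces.linear scale scale T \<and> T ` V \<subseteq> V"

lemma linear_endomorphism: "endomorphism T \<Longrightarrow> Vector_Spaces.linear scale scale T"
  and endomorphism_in: "endomorphism T \<Longrightarrow> v \<in> V \<Longrightarrow> T v \<in> V"
  by (auto simp: endomorphism_def)

lemma endomorphism_funpow: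
  assumes T: "endomorphism T"
  shows "endomorphism (T ^^ r)"
proof (induction r)
  case 0
  then show ?case using linear_ident by (simp add: endomorphism_def id_def)
next
  case (Suc r)
  have "Vector_Spaces.linear scale scale (T \<circ> T ^^ r)"
    by (rule Vector_Spaces.linear_compose[OF linear_endomorphism[OF Suc] linear_endomorphism[OF T]])
  then show ?case
    using endomorphism_in[OF Suc] endomorphism_in[OF T] by (auto simp: endomorphism_def comp_def)
qed

lemma endomorphism_0: "endomorphism T \<Longrightarrow> T 0 = 0"
  using module_hom.zero[OF module_hom_linearI[OF linear_endomorphism]] .

lemma subspace_kernel_endomorphism:
  assumes "endomorphism T"
  shows "subspace {v \<in> V. T v = 0}"
proof -
  interpret T: Vector_Spaces.linear scale scale T by (rule linear_endomorphism[OF assms])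
  show ?thesis using subspace_inter[OF subspace_V T.subspace_kernel] by (simp add: Int_def)
qed

lemma subspace_image_endomorphism:
  assumes "endomorphism T"
  shows "subspace (T ` V)"
proof -
  interpret T: Vector_Spaces.linear scale scale T by (rule linear_endomorphism[OF assms])
  show ?thesis by (rule T.subspace_image[OF subspace_V])
qed

lemma square_zero_power_if_nilpotent:
  assumes Q: "endomorphism Q" "\<exists>v\<in>V. Q v \<noteq> 0" and nil: "\<forall>v\<in>V. (Q ^^ r) v = 0"
  obtains s where "\<exists>v\<in>V. (Q ^^ s) v \<noteq> 0" "\<And>v. v \<in> V \<Longrightarrow> (Q ^^ s) ((Q ^^ s) v) = 0"
proof -
  define s where "s = (LEAST s. \<forall>v\<in>V. (Q ^^ s) v = 0)"
  have s: "(Q ^^ s) v = 0" if "v \<in> V" for v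
    using LeastI[of "\<lambda>s. \<forall>v\<in>V. (Q ^^ s) v = 0" r] nil that unfolding s_def by blast
  have s_min: "\<exists>v\<in>V. (Q ^^ i) v \<noteq> 0" if "i < s" for i
    using not_less_Least[of i] that unfolding s_def by blast
  obtain v where v: "v \<in> V" "Q v \<noteq> 0" using Q(2) by blast
  have "s \<noteq> 0" using s[OF endomorphism_in[OF Q(1) v(1)]] v(2) by (intro notI) simp
  moreover have "s \<noteq> 1" using s[OF v(1)] v(2) by (intro notI) simp
  ultimately obtain i where i: "s = Suc (Suc i)" by (metis One_nat_def not0_implies_Suc)
  show thesis
  proof (rule that)
    show "\<exists>v\<in>V. (Q ^^ Suc i) v \<noteq> 0" by (rule s_min) (simp add: i)
    fix v assume "v \<in> V"
    then have "(Q ^^ s) ((Q ^^ i) v) = 0"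
      by (intro s endomorphism_in[OF endomorphism_funpow[OF Q(1)]])
    moreover have "Q ^^ Suc i \<circ> Q ^^ Suc i = Q ^^ s \<circ> Q ^^ i"
      unfolding funpow_add[symmetric] i by simp
    ultimately show "(Q ^^ Suc i) ((Q ^^ Suc i) v) = 0" by (metis comp_apply)
  qed
qed

lemma kernel_power_stabilizes:
  assumes Q: "endomorphism Q"
  obtains r where "1 \<le> r" "\<And>v. v \<in> V \<Longrightarrow> (Q ^^ r) ((Q ^^ r) v) = 0 \<Longrightarrow> (Q ^^ r) v = 0"
proof -
  define K where "K i = {v \<in> V. (Q ^^ i) v = 0}" for i
  have "subspace (K i)" for i
    unfolding K_def by (rule subspace_kernel_endomorphism[OF endomorphism_funpow[OF Q]])
  moreover have "mono K"
  proof (rule monoI, rule subsetI)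
    fix i j v assume "i \<le> j" "v \<in> K i"
    then show "v \<in> K j" using funpow_add[of "j - i" i Q]
      by (simp add: K_def endomorphism_0[OF endomorphism_funpow[OF Q]])
  qed
  ultimately obtain r where r: "\<And>i. r \<le> i \<Longrightarrow> K i = K r"
    using ascending_chain_stabilizes[of K] by (auto simp: K_def)
  show thesis
  proof (rule that)
    fix v assume "v \<in> V" "(Q ^^ Suc r) ((Q ^^ Suc r) v) = 0"
    then have "v \<in> K (Suc r + Suc r)" by (simp only: K_def funpow_add comp_apply mem_Collect_eq)
    also have "\<dots> = K (Suc r)" using r[of "Suc r + Suc r"] r[of "Suc r"] by simp
    finally show "(Q ^^ Suc r) v = 0" by (simp add: K_def)
  qed simp
qed

lemma fitting_decomposition:
  assumes Q: "endomorphism Q"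
  obtains r where "1 \<le> r" "direct_decomposition V {v \<in> V. (Q ^^ r) v = 0} ((Q ^^ r) ` V)"
proof -
  obtain r where "1 \<le> r" and ker: "\<And>v. v \<in> V \<Longrightarrow> (Q ^^ r) ((Q ^^ r) v) = 0 \<Longrightarrow> (Q ^^ r) v = 0"
    using kernel_power_stabilizes[OF Q] by blast
  let ?K = "{v \<in> V. (Q ^^ r) v = 0}" and ?W = "(Q ^^ r) ` V"
  have Qr: "endomorphism (Q ^^ r)" by (rule endomorphism_funpow[OF Q])
  interpret Qr: Vector_Spaces.linear scale scale "Q ^^ r" by (rule linear_endomorphism[OF Qr])
  have K: "subspace ?K" by (rule subspace_kernel_endomorphism[OF Qr])
  have W: "subspace ?W" "?W \<subseteq> V"
    using subspace_image_endomorphism[OF Qr] endomorphism_in[OF Qr] by auto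
  have surj: "(Q ^^ r) ` ?W = ?W"
    by (rule linear_injective_on_imp_surjective_on[OF W Qr.linear_axioms])
      (use endomorphism_in[OF Qr] ker in auto)
  have "{u + w | u w. u \<in> ?K \<and> w \<in> ?W} = V"
  proof (intro equalityI subsetI)
    fix x assume x: "x \<in> V"
    then have "(Q ^^ r) x \<in> (Q ^^ r) ` ?W" unfolding surj by (rule imageI)
    then obtain w where w: "w \<in> ?W" "(Q ^^ r) x = (Q ^^ r) w" by blast
    then have "x - w \<in> ?K" using x W(2) subspace_diff[OF subspace_V] by (auto simp: Qr.diff)
    moreover have "x = (x - w) + w" by simp
    ultimately show "x \<in> {u + w | u w. u \<in> ?K \<and> w \<in> ?W}" using w(1) by blast
  qed (use W(2) in \<open>auto intro: subspace_add[OF subspace_V]\<close>)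
  moreover have "?K \<inter> ?W = {0}"
    using subspace_0[OF K] subspace_0[OF W(1)] ker by auto
  ultimately have "direct_decomposition V ?K ?W"
    using K W(1) by (simp add: direct_decomposition_def)
  with \<open>1 \<le> r\<close> show thesis by (rule that)
qed

lemma basis_family_kernel_image:
  assumes N: "Vector_Spaces.linear scale scale N" and u: "\<And>j. j < l \<Longrightarrow> u j \<in> V"
    and t: "basis_family {v \<in> V. N v = 0} m t" and b: "basis_family (N ` V) l (\<lambda>j. N (u j))"
  shows "basis_family V (m + l) (append_family m t u)"
  unfolding basis_family_def
proof (intro conjI allI impI)
  interpret N: Vector_Spaces.linear scale scale N by (rule N)
  have lincomb_u: "lincomb l u c \<in> V" for c by (rule lincomb_in[OF subspace_V u])
  have lincomb_t: "lincomb m t c \<in> V" "N (lincomb m t c) = 0" for c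
    using basis_familyD(1)[OF t] by auto
  show "range (lincomb (m + l) (append_family m t u)) = V"
  proof (intro equalityI subsetI)
    fix v assume v: "v \<in> V"
    obtain c where c: "N v = N (lincomb l u c)"
      using basis_familyD(2)[OF b] v unfolding linear_lincomb[OF N] by blast
    then have "v - lincomb l u c \<in> {v \<in> V. N v = 0}"
      using v lincomb_u by (simp add: N.diff subspace_diff[OF subspace_V])
    then obtain a where "v - lincomb l u c = lincomb m t a" using basis_familyD(2)[OF t] by blast
    then have "v = lincomb (m + l) (append_family m t u) (append_family m a c)"
      by (simp add: lincomb_append_coeffs diff_eq_eq)
    then show "v \<in> range (lincomb (m + l) (append_family m t u))" by blast
  qed (auto simp: lincomb_append lincomb_u lincomb_t subspace_add[OF subspace_V])
  fix c j assume c: "lincomb (m + l) (append_family m t u) c = 0" and j: "j < m + l"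
  from arg_cong[OF c, of N] have "lincomb l (\<lambda>j. N (u j)) (\<lambda>j. c (m + j)) = 0"
    by (simp add: lincomb_append N.add lincomb_t N.zero flip: linear_lincomb[OF N])
  then have c_u: "c (m + i) = 0" if "i < l" for i using basis_familyD(3)[OF b] that by blast
  then have "lincomb m t c = 0" using c by (simp add: lincomb_append lincomb_0)
  from j basis_familyD(3)[OF t this] c_u show "c j = 0" by (auto elim: lessThan_add_cases)
qed

lemma basis_family_reorder:
  assumes "basis_family S m b" "b' ` {..<m} = b ` {..<m}"
  shows "basis_family S m b'"
proof -
  have "card (b' ` {..<m}) = card {..<m}"
    using assms by (metis basis_family_iff bij_betw_same_card)
  then have "inj_on b' {..<m}" by (intro eq_card_imp_inj_on) auto
  then show ?thesis using assms by (simp add: basis_family_iff bij_betw_def)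
qed

lemma square_zero_basis_family:
  assumes N: "endomorphism N"
    and sq: "\<And>v. v \<in> V \<Longrightarrow> N (N v) = 0"
    and nz: "\<exists>v\<in>V. N v \<noteq> 0"
  obtains l k u w where "1 \<le> l" "\<And>j. j < k \<Longrightarrow> N (w j) = 0"
    and "basis_family V (l + (l + k)) (append_family l (\<lambda>j. N (u j)) (append_family l u w))"
proof -
  let ?T = "{v \<in> V. N v = 0}"
  have T: "subspace ?T" "N ` V \<subseteq> ?T" "?T \<subseteq> V"
    using subspace_kernel_endomorphism[OF N] sq endomorphism_in[OF N] by auto
  obtain l b where b: "basis_family (N ` V) l b"
    using ex_basis_family[OF subspace_image_endomorphism[OF N]] endomorphism_in[OF N] by blast
  define u where "u j = inv_into V N (b j)" for j
  have u: "u j \<in> V" "N (u j) = b j" if "j < l" for j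
    using basis_family_in[OF b that] unfolding u_def by (rule inv_into_into, rule f_inv_into_f)
  have Nu: "basis_family (N ` V) l (\<lambda>j. N (u j))"
    by (rule basis_family_reorder[OF b]) (auto simp: u(2))
  obtain k w where w: "basis_family ?T (l + k) (append_family l (\<lambda>j. N (u j)) w)"
    using ex_basis_family_extend[OF Nu T] .
  let ?A = "append_family (l + k) (append_family l (\<lambda>j. N (u j)) w) u"
  let ?B = "append_family l (\<lambda>j. N (u j)) (append_family l u w)"
  have "basis_family V (l + k + l) ?A"
    by (rule basis_family_kernel_image[OF linear_endomorphism[OF N] u(1) w Nu])
  moreover have "?B ` {..<l + (l + k)} = ?A ` {..<l + k + l}"
    by (simp only: image_append_family Un_ac)
  ultimately have "basis_family V (l + (l + k)) ?B"
    using basis_family_reorder[of V "l + k + l" ?A ?B] by (simp add: add.assoc add.commute[of k])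
  moreover have "N (w j) = 0" if "j < k" for j
    using basis_family_in[OF w, of "l + j"] that by simp
  moreover have "1 \<le> l"
    using nz basis_familyD(2)[OF b] by (cases l) (auto simp: lincomb_def)
  ultimately show thesis using that by blast
qed

end

subsection \<open>Coordinate vectors and matrices\<close>

definition coord_space :: "nat \<Rightarrow> (nat \<Rightarrow> 'k::field) set" where
  "coord_space n = {v. \<forall>i\<ge>n. v i = 0}"

lemma subspace_coord_space: "vectors.subspace (coord_space n)"
  by (auto simp: vectors.subspace_def coord_space_def vscale_def)

lemma std_basis_in_coord_space: "i < n \<Longrightarrow> std_basis i \<in> coord_space n"
  by (auto simp: coord_space_def std_basis_def)

lemma std_basis_neq_0: "(std_basis i :: nat \<Rightarrow> 'k::field) \<noteq> 0"
  by (auto simp: std_basis_def fun_eq_iff)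

lemma coord_space_expansion:
  assumes "v \<in> coord_space n"
  shows "v = (\<Sum>i<n. vscale (v i) (std_basis i))"
proof
  fix j
  show "v j = (\<Sum>i<n. vscale (v i) (std_basis i)) j"
    using assms
    by (simp add: sum_fun_apply vscale_def std_basis_def coord_space_def if_distrib[of "\<lambda>c. _ * c"]
        cong: if_cong)
qed

global_interpretation coords: finite_dimensional_subspace
  "vscale :: 'k::field \<Rightarrow> (nat \<Rightarrow> 'k) \<Rightarrow> nat \<Rightarrow> 'k" "coord_space n" "std_basis ` {..<n}" for n
proof
  show "(coord_space n :: (nat \<Rightarrow> 'k) set) \<subseteq> vectors.span (std_basis ` {..<n})"
  proof
    fix v :: "nat \<Rightarrow> 'k" assume "v \<in> coord_space n"
    then show "v \<in> vectors.span (std_basis ` {..<n})"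
      by (subst coord_space_expansion)
        (auto intro!: vectors.span_sum vectors.span_scale intro: vectors.span_base)
  qed
qed (auto simp: subspace_coord_space)

lemma basis_family_std_basis:
  "coords.basis_family (coord_space n :: (nat \<Rightarrow> 'k::field) set) n std_basis"
proof -
  have lincomb: "coords.lincomb n std_basis c i = (if i < n then c i else 0)"
    for c :: "nat \<Rightarrow> 'k" and i
    by (simp add: coords.lincomb_def sum_fun_apply vscale_def std_basis_def
        if_distrib[of "\<lambda>a. _ * a"] cong: if_cong)
  have "v \<in> range (coords.lincomb n std_basis)" if "v \<in> coord_space n" for v :: "nat \<Rightarrow> 'k"
    by (rule range_eqI[of _ _ v]) (use that in \<open>auto simp: lincomb coord_space_def\<close>)
  moreover have "coords.lincomb n std_basis c \<in> coord_space n" for c :: "nat \<Rightarrow> 'k"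
    by (simp add: coord_space_def lincomb)
  moreover have "c j = 0" if "coords.lincomb n std_basis c = 0" "j < n" for c :: "nat \<Rightarrow> 'k" and j
    using lincomb[of c j] that by simp
  ultimately show ?thesis unfolding coords.basis_family_def by blast
qed

lemma basis_family_coord_space_length:
  fixes b :: "nat \<Rightarrow> nat \<Rightarrow> 'k::field"
  assumes "coords.basis_family (coord_space n) m b"
  shows "m = n"
  using coords.dim_basis_family[OF assms]
    coords.dim_basis_family[OF basis_family_std_basis[of n, where ?'k = 'k]] by simp

lemma lin_columns: "lin n (\<lambda>i j. b j i) x = coords.lincomb n b x"
  by (simp add: lin_def coords.lincomb_def fun_eq_iff sum_fun_apply vscale_def mult.commute)

global_interpretation lin: Vector_Spaces.linear vscale vscale "lin n A"
  for n and A :: "nat \<Rightarrow> nat \<Rightarrow> 'k::field"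
  by (auto simp: Vector_Spaces.linear_iff vectors.vector_space_axioms lin_def vscale_def fun_eq_iff
      distrib_left sum.distrib sum_distrib_left mult_ac)

lemma lin_cong: "(\<And>j. j < n \<Longrightarrow> x j = y j) \<Longrightarrow> lin n A x = lin n A y"
  by (simp add: lin_def)

definition mmul :: "nat \<Rightarrow> (nat \<Rightarrow> nat \<Rightarrow> 'k::field) \<Rightarrow> (nat \<Rightarrow> nat \<Rightarrow> 'k) \<Rightarrow> nat \<Rightarrow> nat \<Rightarrow> 'k" where
  "mmul n A B i j = (\<Sum>k<n. A i k * B k j)"

lemma lin_mmul: "lin n (mmul n A B) x = lin n A (lin n B x)"
  unfolding lin_def mmul_def sum_distrib_left sum_distrib_right mult.assoc
  by (rule ext, rule sum.swap)

definition sq_mat :: "nat \<Rightarrow> (nat \<Rightarrow> nat \<Rightarrow> 'k::field) \<Rightarrow> 'k mat" where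
  "sq_mat n A = mat n n (\<lambda>(i, j). A i j)"

lemma sq_mat_carrier [simp]: "sq_mat n A \<in> carrier_mat n n"
  by (simp add: sq_mat_def)

lemma sq_mat_mmul: "sq_mat n (mmul n A B) = sq_mat n A * sq_mat n B"
  by (rule eq_matI) (auto simp: sq_mat_def mmul_def scalar_prod_def atLeast0LessThan)

lemma sq_mat_mult_vec: "sq_mat n A *\<^sub>v vec n x = vec n (lin n A x)"
  by (rule eq_vecI) (auto simp: sq_mat_def scalar_prod_def lin_def atLeast0LessThan)

lemma det_sq_mat: "det (sq_mat n A) = mdet n A"
  unfolding det_def'[OF sq_mat_carrier] mdet_def atLeast0LessThan
proof (rule sum.cong[OF refl])
  fix p assume "p \<in> {p. p permutes {..<n}}"
  then have "p i < n" if "i < n" for i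
    using permutes_in_image[of p "{..<n}" i] that by simp
  then show "signof p * (\<Prod>i<n. sq_mat n A $$ (i, p i)) = of_int (sign p) * (\<Prod>i<n. A i (p i))"
    by (simp add: sq_mat_def)
qed

lemma mdet_mmul: "mdet n (mmul n A B) = mdet n A * mdet n B"
  by (simp add: sq_mat_mmul det_mult[OF sq_mat_carrier sq_mat_carrier] flip: det_sq_mat)

lemma mdet_diag: "mdet n (\<lambda>i j. if i = j then s i else 0) = (\<Prod>i<n. s i)"
proof -
  let ?D = "sq_mat n (\<lambda>i j. if i = j then s i else 0)"
  have "upper_triangular ?D" by (auto simp: sq_mat_def)
  then have "det ?D = prod_list (diag_mat ?D)"
    by (rule det_upper_triangular) (rule sq_mat_carrier)
  also have "\<dots> = (\<Prod>i<n. s i)" by (simp add: prod_list_diag_prod sq_mat_def atLeast0LessThan)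
  finally show ?thesis by (simp add: det_sq_mat)
qed

lemma carrier_vec_coords:
  assumes "v \<in> carrier_vec n"
  obtains x where "x \<in> coord_space n" "v = vec n x"
proof
  show "(\<lambda>i. if i < n then v $ i else 0) \<in> coord_space n" by (simp add: coord_space_def)
  show "v = vec n (\<lambda>i. if i < n then v $ i else 0)" using assms by auto
qed

lemma vec_eq_0_iff: "x \<in> coord_space n \<Longrightarrow> vec n x = 0\<^sub>v n \<longleftrightarrow> x = 0"
  by (auto simp: vec_eq_iff coord_space_def fun_eq_iff) (metis not_le)

lemma mdet_eq_0_iff:
  fixes A :: "nat \<Rightarrow> nat \<Rightarrow> 'k::field"
  shows "mdet n A = 0 \<longleftrightarrow> (\<exists>x\<in>coord_space n. x \<noteq> 0 \<and> (\<forall>i<n. lin n A x i = 0))"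
proof
  assume "mdet n A = 0"
  then obtain v where v: "v \<in> carrier_vec n" "v \<noteq> 0\<^sub>v n" "sq_mat n A *\<^sub>v v = 0\<^sub>v n"
    using det_0_iff_vec_prod_zero_field[OF sq_mat_carrier, of n A] by (auto simp: det_sq_mat)
  then obtain x where x: "x \<in> coord_space n" "v = vec n x" by (elim carrier_vec_coords)
  then have "lin n A x i = 0" if "i < n" for i
    using v(3) that by (metis index_vec index_zero_vec(1) sq_mat_mult_vec)
  with x v(2) show "\<exists>x\<in>coord_space n. x \<noteq> 0 \<and> (\<forall>i<n. lin n A x i = 0)"
    by (auto simp: vec_eq_0_iff)
next
  assume "\<exists>x\<in>coord_space n. x \<noteq> 0 \<and> (\<forall>i<n. lin n A x i = 0)"
  then obtain x where "x \<in> coord_space n" "x \<noteq> 0" "\<forall>i<n. lin n A x i = 0" by blast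
  then have "vec n x \<noteq> 0\<^sub>v n" "sq_mat n A *\<^sub>v vec n x = 0\<^sub>v n"
    by (auto simp: sq_mat_mult_vec vec_eq_0_iff)
  then show "mdet n A = 0"
    unfolding det_sq_mat[symmetric] det_0_iff_vec_prod_zero_field[OF sq_mat_carrier]
    by (intro exI[of _ "vec n x"]) simp
qed

lemma ex_inverse_matrix:
  fixes A :: "nat \<Rightarrow> nat \<Rightarrow> 'k::field"
  assumes "mdet n A \<noteq> 0"
  obtains B where "\<And>x i. i < n \<Longrightarrow> lin n A (lin n B x) i = x i"
    and "\<And>x i. i < n \<Longrightarrow> lin n B (lin n A x) i = x i" and "mdet n A * mdet n B = 1"
proof -
  from det_non_zero_imp_unit[OF sq_mat_carrier, of n A] assms
  have "sq_mat n A \<in> Units (ring_mat TYPE('k) n undefined)" by (simp add: det_sq_mat)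
  then obtain C where C: "C \<in> carrier_mat n n" "C * sq_mat n A = 1\<^sub>m n" "sq_mat n A * C = 1\<^sub>m n"
    unfolding Units_def ring_mat_def by auto
  define B where "B i j = C $$ (i, j)" for i j
  have CB: "C = sq_mat n B" using C(1) by (auto simp: sq_mat_def B_def)
  have inverse: "lin n X (lin n Y x) i = x i" if XY: "sq_mat n X * sq_mat n Y = 1\<^sub>m n" and "i < n"
      for X Y x i
  proof -
    have "vec n (lin n X (lin n Y x)) = 1\<^sub>m n *\<^sub>v vec n x"
      by (simp add: sq_mat_mmul XY flip: lin_mmul sq_mat_mult_vec)
    then show ?thesis using \<open>i < n\<close> by (metis index_vec one_mult_mat_vec vec_carrier)
  qed
  have "mdet n A * mdet n B = 1"
    using det_mult[OF sq_mat_carrier C(1), of A] C(3) by (simp add: CB det_sq_mat)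
  then show thesis using inverse[OF C(3)[unfolded CB]] inverse[OF C(2)[unfolded CB]] that by blast
qed

lemma infinite_UNIV_if_alg_closed:
  assumes "alg_closed TYPE('k::field)"
  shows "infinite (UNIV :: 'k set)"
proof
  assume fin: "finite (UNIV :: 'k set)"
  let ?p = "(\<Prod>a\<in>(UNIV::'k set). [:- a, 1:])"
  have deg: "degree ?p = card (UNIV :: 'k set)"
    by (subst degree_prod_eq_sum_degree) auto
  have "0 < card (UNIV :: 'k set)" using fin by (simp add: card_gt_0_iff)
  then have "0 < degree (?p + 1)" using deg by (subst degree_add_eq_left) auto
  then obtain x where "poly (?p + 1) x = 0" using assms unfolding alg_closed_def by blast
  moreover have "poly ?p x = 0" using fin by (auto simp: poly_prod)
  ultimately show False by simp
qed

lemma ex_eigenvector: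
  fixes A :: "nat \<Rightarrow> nat \<Rightarrow> 'k::field"
  assumes "alg_closed TYPE('k)" "0 < n"
  obtains a x where "x \<in> coord_space n" "x \<noteq> 0" "\<And>i. i < n \<Longrightarrow> lin n A x i = a * x i"
proof -
  have "degree (char_poly (sq_mat n A)) = n"
    using degree_monic_char_poly[OF sq_mat_carrier] by blast
  then obtain a where "poly (char_poly (sq_mat n A)) a = 0"
    using assms unfolding alg_closed_def by metis
  then obtain v where "eigenvector (sq_mat n A) v a"
    using eigenvalue_root_char_poly[OF sq_mat_carrier] unfolding eigenvalue_def by blast
  then have v: "v \<in> carrier_vec n" "v \<noteq> 0\<^sub>v n" "sq_mat n A *\<^sub>v v = a \<cdot>\<^sub>v v"
    by (auto simp: eigenvector_def sq_mat_def)
  then obtain x where x: "x \<in> coord_space n" "v = vec n x" by (elim carrier_vec_coords)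
  then have "lin n A x i = a * x i" if "i < n" for i
    using v(3) that by (metis dim_vec index_smult_vec(1) index_vec sq_mat_mult_vec)
  with x v(2) show thesis by (intro that) (auto simp: vec_eq_0_iff)
qed

lemma ex_kernel_vector:
  fixes L :: "nat \<Rightarrow> nat \<Rightarrow> 'k::field"
  assumes "m < n"
  obtains c where "c \<in> coord_space n" "c \<noteq> 0" "\<And>i. i < m \<Longrightarrow> lin n L c i = 0"
proof -
  define A where "A i j = (if i < m then L i j else 0)" for i j
  have "(\<Prod>i<n. A i (p i)) = 0" for p
    using assms by (intro prod_zero bexI[of _ m]) (auto simp: A_def)
  then have "mdet n A = 0" unfolding mdet_def by (simp only: mult_zero_right sum.neutral_const)
  then obtain c where "c \<in> coord_space n" "c \<noteq> 0" and "\<forall>i<n. lin n A c i = 0"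
    unfolding mdet_eq_0_iff by blast
  moreover have "lin n L c i = lin n A c i" if "i < m" for i
    using that by (simp add: lin_def A_def)
  ultimately show thesis using assms that by simp
qed

lemma finite_singular_pencil:
  fixes A C :: "nat \<Rightarrow> nat \<Rightarrow> 'k::field"
  assumes "mdet n A \<noteq> 0"
  shows "finite {t. mdet n (\<lambda>i j. A i j + t * C i j) = 0}"
proof -
  define p where "p = (\<Sum>\<pi> | \<pi> permutes {..<n}. of_int (sign \<pi>) * (\<Prod>i<n. [:A i (\<pi> i), C i (\<pi> i):]))"
  have p: "poly p t = mdet n (\<lambda>i j. A i j + t * C i j)" for t
    unfolding p_def mdet_def by (simp add: poly_sum poly_prod)
  have "p \<noteq> 0" using p[of 0] assms by auto
  then show ?thesis using poly_roots_finite[of p] by (simp add: p)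
qed

lemma mdet_basis_family:
  assumes "coords.basis_family (coord_space n) n b"
  shows "mdet n (\<lambda>i j. b j i) \<noteq> 0"
  unfolding mdet_eq_0_iff
proof safe
  fix x assume x: "x \<in> coord_space n" "x \<noteq> 0" and "\<forall>i<n. lin n (\<lambda>i j. b j i) x i = 0"
  then have "coords.lincomb n b x = 0"
    using coords.basis_familyD(1)[OF assms, of x]
    by (auto simp: lin_columns coord_space_def fun_eq_iff) (metis not_le)
  then have "x j = 0" if "j < n" for j using coords.basis_familyD(3)[OF assms] that by blast
  with x show False by (auto simp: coord_space_def fun_eq_iff) (metis not_le)
qed

subsection \<open>Linear substitutions\<close>

lemma feval_dir_deriv_linear_subst:
  fixes f g :: "'k::field form"
  assumes char: "of_nat (fact (Suc e)) \<noteq> (0::'k)"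
    and f: "form n (Suc e) f" and g: "form m (Suc e) g"
    and g_eq: "\<And>x. feval m g x = feval n f (lin m A x)"
  shows "feval m (dir_deriv m v g) x = feval n (dir_deriv n (lin m A v) f) (lin m A x)"
  by (rule feval_dir_deriv_eqI[OF char g f]) (simp only: g_eq lin.add lin.scale)

lemma ex_form_lincomb_subst:
  assumes "form n e f"
  obtains h where "form m e h" "\<And>x. feval m h x = feval n f (coords.lincomb m b x)"
  using ex_form_linear_subst[OF assms, of m "\<lambda>i j. b j i"] that unfolding lin_columns by blast

lemma feval_pderiv_form_lincomb_subst:
  fixes f h :: "'k::field form"
  assumes char: "of_nat (fact (Suc e)) \<noteq> (0::'k)"
    and f: "form n (Suc e) f" and h: "form m (Suc e) h"
    and h_eq: "\<And>x. feval m h x = feval n f (coords.lincomb m b x)" and i: "i < m"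
  shows "feval m (pderiv_form i h) x = feval n (dir_deriv n (b i) f) (coords.lincomb m b x)"
proof -
  have "coords.lincomb m b (std_basis i) = b i"
    using i by (simp add: coords.lincomb_def std_basis_def if_distrib[of "\<lambda>c. vscale c _"]
        cong: if_cong)
  then show ?thesis
    using feval_dir_deriv_linear_subst[OF char f h, of "\<lambda>i j. b j i" "std_basis i" x] h_eq
    by (simp add: lin_columns dir_deriv_std_basis[OF i])
qed

subsection \<open>Concise forms\<close>

lemma ex_eliminating_substitution:
  fixes f :: "'k::field form"
  assumes f: "form n e f" and c: "c \<in> coord_space n" "c \<noteq> 0"
    and inv: "\<And>x t. feval n f (x + vscale t c) = feval n f x"
  obtains A h
    where "mdet n A \<noteq> 0" "form (n - 1) e h" "\<And>x. feval n f (lin n A x) = feval (n - 1) h x"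
proof -
  have "coords.basis_family (vectors.span {c}) 1 (\<lambda>_. c)"
    using c(2) by (simp add: coords.basis_family_iff bij_betw_def lessThan_Suc)
  moreover have "vectors.span {c} \<subseteq> coord_space n"
    using c(1) by (intro vectors.span_minimal subspace_coord_space) simp
  ultimately obtain k w
      where w: "coords.basis_family (coord_space n) (1 + k) (append_family 1 (\<lambda>_. c) w)"
    using coords.ex_basis_family_extend[OF _ subspace_coord_space] by blast
  have "append_family k w (\<lambda>_. c) ` {..<k + 1} = append_family 1 (\<lambda>_. c) w ` {..<1 + k}"
    by (simp only: image_append_family Un_commute)
  then have basis: "coords.basis_family (coord_space n) (k + 1) (append_family k w (\<lambda>_. c))"
    using coords.basis_family_reorder[OF w] by (simp only: add.commute[of k])
  then have n: "n = k + 1" by (rule basis_family_coord_space_length[symmetric])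
  let ?A = "\<lambda>i j. append_family k w (\<lambda>_. c) j i"
  obtain h where h: "form k e h" "\<And>x. feval k h x = feval n f (coords.lincomb k w x)"
    using ex_form_lincomb_subst[OF f] by blast
  show thesis
  proof (rule that)
    show "mdet n ?A \<noteq> 0" using mdet_basis_family basis n by blast
    show "form (n - 1) e h" using h(1) n by simp
    fix x
    have "lin n ?A x = coords.lincomb k w x + vscale (x k) c"
      unfolding lin_columns n coords.lincomb_append by (simp add: coords.lincomb_def)
    then show "feval n f (lin n ?A x) = feval (n - 1) h x" using inv h(2) by (simp add: n)
  qed
qed

lemma concise_iff:
  fixes f :: "'k::field form"
  assumes f: "form n e f"
  shows "concise n e f \<longleftrightarrow>
    (\<forall>c\<in>coord_space n. (\<forall>x t. feval n f (x + vscale t c) = feval n f x) \<longrightarrow> c = 0)"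
proof (intro iffI ballI impI)
  fix c assume "concise n e f"
      and c: "c \<in> coord_space n" "\<forall>x t. feval n f (x + vscale t c) = feval n f x"
  show "c = 0"
  proof (rule ccontr)
    assume "c \<noteq> 0"
    obtain A h where A: "mdet n A \<noteq> 0"
        and h: "form (n - 1) e h" "\<And>x. feval n f (lin n A x) = feval (n - 1) h x"
      using ex_eliminating_substitution[OF f c(1) \<open>c \<noteq> 0\<close>] c(2) by metis
    obtain B where B: "\<And>x i. i < n \<Longrightarrow> lin n A (lin n B x) i = x i"
      using ex_inverse_matrix[OF A] by metis
    have "feval n f x = feval (n - 1) h (\<lambda>i. \<Sum>j<n. B i j * x j)" for x
      using h(2)[of "lin n B x"] B feval_cong[of n "lin n A (lin n B x)" x f] by (simp add: lin_def)
    moreover have "n - 1 < n"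
      using c(1) \<open>c \<noteq> 0\<close> by (cases n) (auto simp: coord_space_def fun_eq_iff)
    ultimately show False using \<open>concise n e f\<close> h(1) unfolding concise_def by blast
  qed
next
  assume trivial: "\<forall>c\<in>coord_space n. (\<forall>x t. feval n f (x + vscale t c) = feval n f x) \<longrightarrow> c = 0"
  show "concise n e f"
    unfolding concise_def
  proof (clarify)
    fix m L h assume m: "m < n" and "\<forall>x. feval n f x = feval m h (\<lambda>i. \<Sum>j<n. L i j * x j)"
    then have f_eq: "feval n f x = feval m h (lin n L x)" for x by (simp add: lin_def)
    obtain c where c: "c \<in> coord_space n" "c \<noteq> 0" "\<And>i. i < m \<Longrightarrow> lin n L c i = 0"
      using ex_kernel_vector[OF m] by metis
    have "feval n f (x + vscale t c) = feval n f x" for x t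
      unfolding f_eq
      by (rule feval_cong) (simp add: lin.add lin.scale vscale_def[of t "lin n L c"] c(3))
    then show False using trivial c(1,2) by blast
  qed
qed

subsection \<open>Forms in a block of the variables\<close>

lemma form_mono:
  assumes "form k e f" "k \<le> n"
  shows "form n e f" and "feval n f x = feval k f x"
proof -
  have outside: "\<forall>i\<in>{..<n} - {..<k}. m i = 0" if "f m \<noteq> 0" for m
    using assms(1) that by (auto simp: form_iff monomials_def)
  have "sum m {..<n} = sum m {..<k}" if "f m \<noteq> 0" for m
    using outside[OF that] assms(2) by (intro sum.mono_neutral_right) auto
  then show "form n e f"
    using assms by (auto simp: form_iff monomials_def)
  have "(\<Prod>i<n. x i ^ m i) = (\<Prod>i<k. x i ^ m i)" if "f m \<noteq> 0" for m
    using outside[OF that] assms(2) by (intro prod.mono_neutral_right) auto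
  then show "feval n f x = feval k f x" by (simp add: feval_def peval_def)
qed

lemma pderiv_form_eq_0:
  assumes "form k e f" "k \<le> i"
  shows "pderiv_form i f = 0"
proof
  fix m
  have "m(i := Suc (m i)) \<notin> monomials {..<k} e" using assms(2) by (auto simp: monomials_def)
  then show "pderiv_form i f m = 0 m" using assms(1) by (auto simp: form_iff pderiv_form_def)
qed

definition shift_form :: "nat \<Rightarrow> 'k::field form \<Rightarrow> 'k form" where
  "shift_form p f = (\<lambda>m. if \<forall>i<p. m i = 0 then f (\<lambda>j. m (p + j)) else 0)"

lemma shift_form_0 [simp]: "shift_form p 0 = 0"
  by (auto simp: shift_form_def)

lemma shift_form_neq_0D:
  assumes "form k e f" "shift_form p f m \<noteq> 0"
  shows "(\<lambda>j. m (p + j)) \<in> monomials {..<k} e" and "i < p \<Longrightarrow> m i = 0"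
  using assms by (auto simp: shift_form_def form_iff split: if_splits)

lemma form_shift_form_add:
  assumes "form k e f"
  shows "form (p + k) e (shift_form p f)"
  unfolding form_iff
proof (intro allI impI)
  fix m assume "shift_form p f m \<noteq> 0"
  note m = shift_form_neq_0D[OF assms this]
  have outside: "m (p + j) = 0" if "j \<notin> {..<k}" for j
    using m(1) that by (auto simp only: monomials_def)
  have "m i = 0" if "p + k \<le> i" for i
    using outside[of "i - p"] that
    by (metis add_leD1 le_add_diff_inverse lessThan_iff nat_add_left_cancel_le not_le)
  then show "m \<in> monomials {..<p + k} e"
    using m by (simp add: monomials_def sum.lessThan_add)
qed

lemma feval_shift_form_add: "feval (p + k) (shift_form p f) x = feval k f (\<lambda>j. x (p + j))"
  unfolding feval_def peval_def
proof (rule sum.reindex_bij_witness[of _ "append_family p (\<lambda>_. 0)" "\<lambda>m j. m (p + j)"])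
  fix m assume "m \<in> {m. shift_form p f m \<noteq> 0}"
  then have m: "\<forall>i<p. m i = 0" "f (\<lambda>j. m (p + j)) \<noteq> 0"
    by (auto simp: shift_form_def split: if_splits)
  then show "append_family p (\<lambda>_. 0) (\<lambda>j. m (p + j)) = m"
    by (auto simp: append_family_def)
  show "(\<lambda>j. m (p + j)) \<in> {m. f m \<noteq> 0}" using m by simp
  show "f (\<lambda>j. m (p + j)) * (\<Prod>v<k. x (p + v) ^ m (p + v))
      = shift_form p f m * (\<Prod>v<p + k. x v ^ m v)"
    using m by (simp add: shift_form_def prod.lessThan_add)
qed (auto simp: shift_form_def)

lemma form_shift_form: "form k e f \<Longrightarrow> p + k \<le> n \<Longrightarrow> form n e (shift_form p f)"
  using form_mono(1)[OF form_shift_form_add] .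

lemma feval_shift_form:
  "form k e f \<Longrightarrow> p + k \<le> n \<Longrightarrow> feval n (shift_form p f) x = feval k f (\<lambda>j. x (p + j))"
  using form_mono(2)[OF form_shift_form_add] by (simp add: feval_shift_form_add)

lemma pderiv_form_shift_form:
  "pderiv_form (p + i) (shift_form p f) = shift_form p (pderiv_form i f)"
proof
  fix m
  have "(\<lambda>j. (m(p + i := Suc (m (p + i)))) (p + j)) = (\<lambda>j. m (p + j))(i := Suc (m (p + i)))"
    by auto
  then show "pderiv_form (p + i) (shift_form p f) m = shift_form p (pderiv_form i f) m"
    by (auto simp: pderiv_form_def shift_form_def)
qed

lemma pderiv_form_shift_form_less: "i < p \<Longrightarrow> pderiv_form i (shift_form p f) = 0"
  by (auto simp: pderiv_form_def shift_form_def fun_eq_iff)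

definition LDS_form :: "nat \<Rightarrow> 'k::field form \<Rightarrow> 'k form \<Rightarrow> 'k form" where
  "LDS_form l H G = (\<Sum>i<l. xmul i (shift_form l (pderiv_form i H))) + shift_form l G"

lemma
  assumes l: "2 * l \<le> n" and H: "form l (Suc d) H" and G: "form (n - l) (Suc d) G"
  shows form_LDS_form: "form n (Suc d) (LDS_form l H G)"
    and feval_LDS_form: "feval n (LDS_form l H G) x =
      (\<Sum>i<l. x i * feval l (pderiv_form i H) (\<lambda>j. x (l + j))) + feval (n - l) G (\<lambda>j. x (l + j))"
proof -
  have dH: "form l d (pderiv_form i H)" if "i < l" for i by (rule form_pderiv_form[OF H that])
  have shift_dH: "form n d (shift_form l (pderiv_form i H))" if "i < l" for i
    using l by (intro form_shift_form[OF dH[OF that]]) simp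
  have terms: "form n (Suc d) (xmul i (shift_form l (pderiv_form i H)))" if "i \<in> {..<l}" for i
    using that l by (intro form_xmul shift_dH) auto
  have sum: "form n (Suc d) (\<Sum>i<l. xmul i (shift_form l (pderiv_form i H)))"
    by (rule form_sum[OF terms])
  have shift_G: "form n (Suc d) (shift_form l G)"
    using l by (intro form_shift_form[OF G]) simp
  show "form n (Suc d) (LDS_form l H G)"
    unfolding LDS_form_def by (rule form_add[OF sum shift_G])
  have "feval n (LDS_form l H G) x =
      (\<Sum>i<l. feval n (xmul i (shift_form l (pderiv_form i H))) x) + feval n (shift_form l G) x"
    unfolding LDS_form_def feval_add[OF sum shift_G] by (subst feval_sum[OF terms]) simp_all
  then show "feval n (LDS_form l H G) x =
      (\<Sum>i<l. x i * feval l (pderiv_form i H) (\<lambda>j. x (l + j))) + feval (n - l) G (\<lambda>j. x (l + j))"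
    using l by (simp add: feval_xmul[OF shift_dH] feval_shift_form[OF dH] feval_shift_form[OF G])
qed

lemma pderiv_LDS_form:
  assumes "j < l"
  shows "pderiv_form j (LDS_form l H G) = shift_form l (pderiv_form j H)"
proof -
  have "pderiv_form j (LDS_form l H G)
      = (\<Sum>i<l. if i = j then shift_form l (pderiv_form i H) else 0)"
    using assms
    by (simp add: LDS_form_def pderiv_form.add pderiv_form.sum pderiv_form_xmul
        pderiv_form_shift_form_less xmul.zero)
  then show ?thesis using assms by simp
qed

lemma LDS_iff_LDS_form:
  "LDS n d f \<longleftrightarrow> (\<exists>A l H G. mdet n A \<noteq> 0 \<and> 1 \<le> l \<and> 2 * l \<le> n \<and> form l (Suc d) H \<and>
    form (n - l) (Suc d) G \<and> (\<forall>x. feval n f (lin n A x) = feval n (LDS_form l H G) x))"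
  unfolding LDS_def Suc_eq_plus1[symmetric]
  by (intro iff_exI conj_cong refl) (simp add: feval_LDS_form)

subsection \<open>The span of the gradient\<close>

lemma pderiv_form_in_grad_span: "i < n \<Longrightarrow> pderiv_form i f \<in> grad_span n f"
  unfolding grad_span_def by (rule forms.span_base) auto

lemma zero_in_grad_span: "0 \<in> grad_span n f"
  unfolding grad_span_def by (rule forms.span_zero)

lemma grad_span_subsetI:
  "(\<And>i. i < n \<Longrightarrow> pderiv_form i g \<in> grad_span n f) \<Longrightarrow> grad_span n g \<subseteq> grad_span n f"
  unfolding grad_span_def by (intro forms.span_minimal) auto

lemma partials_eq_image:
  "{pderiv_form i f | i. i < n} = (\<lambda>v. dir_deriv n v f) ` std_basis ` {..<n}"
  by (auto simp: dir_deriv_std_basis image_iff)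

lemma grad_span_eq_range: "grad_span n f = range (\<lambda>v. dir_deriv n v f)"
proof
  show "grad_span n f \<subseteq> range (\<lambda>v. dir_deriv n v f)"
    unfolding grad_span_def partials_eq_image dir_deriv_vec.span_image by blast
  show "range (\<lambda>v. dir_deriv n v f) \<subseteq> grad_span n f"
    unfolding grad_span_def dir_deriv_def
    by (auto intro!: forms.span_sum forms.span_scale intro: forms.span_base)
qed

lemma grad_span_subset_iff:
  "grad_span n g \<subseteq> grad_span n f \<longleftrightarrow> (\<forall>v. \<exists>w. dir_deriv n v g = dir_deriv n w f)"
  unfolding grad_span_eq_range by blast

lemma dir_deriv_matrix_if_grad_span_subset:
  fixes f g :: "'k::field form"
  assumes "grad_span n g \<subseteq> grad_span n f"
  obtains M where "\<And>v. dir_deriv n v g = dir_deriv n (lin n M v) f" "\<And>v. lin n M v \<in> coord_space n"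
proof -
  obtain W where W: "\<And>v. dir_deriv n v g = dir_deriv n (W v) f"
    using assms unfolding grad_span_subset_iff by metis
  define M where "M i j = (if i < n then W (std_basis j) i else 0)" for i j
  have "dir_deriv n v g = dir_deriv n (lin n M v) f" for v
  proof -
    have "dir_deriv n v g = (\<Sum>j<n. fscale (v j) (dir_deriv n (W (std_basis j)) f))"
      by (simp add: dir_deriv_def[of n v] dir_deriv_std_basis flip: W)
    also have "\<dots> = dir_deriv n (\<Sum>j<n. vscale (v j) (W (std_basis j))) f"
      by (simp add: dir_deriv_vec.sum dir_deriv_vec.scale)
    also have "\<dots> = dir_deriv n (lin n M v) f"
      by (rule dir_deriv_cong) (simp add: lin_def M_def sum_fun_apply vscale_def mult.commute)
    finally show ?thesis .
  qed
  moreover have "lin n M v \<in> coord_space n" for v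
    by (simp add: coord_space_def lin_def M_def)
  ultimately show thesis by (rule that)
qed

lemma grad_span_eqI_matrix:
  assumes "mdet n R \<noteq> 0" "\<And>v. dir_deriv n v g = dir_deriv n (lin n R v) f"
  shows "grad_span n g = grad_span n f"
proof -
  obtain B where "\<And>v i. i < n \<Longrightarrow> lin n R (lin n B v) i = v i"
    using ex_inverse_matrix[OF assms(1)] by metis
  then have "dir_deriv n v f = dir_deriv n (lin n B v) g" for v
    unfolding assms(2) by (intro dir_deriv_cong) simp
  then show ?thesis
    unfolding set_eq_subset grad_span_subset_iff using assms(2) by metis
qed

lemma grad_span_neq_0:
  fixes f :: "'k::field form"
  assumes "of_nat (Suc e) \<noteq> (0::'k)" "form n (Suc e) f" "f \<noteq> 0"
  shows "grad_span n f \<noteq> grad_span n 0"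
proof
  assume "grad_span n f = grad_span n 0"
  then have "pderiv_form i f = 0" if "i < n" for i
    using pderiv_form_in_grad_span[OF that, of f]
    by (auto simp: grad_span_eq_range dir_deriv_form.zero)
  then show False using form_eq_0_if_pderivs_0[OF assms(1,2)] assms(3) by blast
qed

lemma grad_span_subset_linear_subst:
  fixes f g h h' :: "'k::field form"
  assumes char: "of_nat (fact (Suc d)) \<noteq> (0::'k)"
    and f: "form n (Suc d) f" and g: "form n (Suc d) g" "\<And>x. feval n g x = feval n f (lin n A x)"
    and h: "form n (Suc d) h" and h': "form n (Suc d) h'" "\<And>x. feval n h' x = feval n h (lin n B x)"
    and AB: "\<And>x i. i < n \<Longrightarrow> lin n A (lin n B x) i = x i" and span: "grad_span n h \<subseteq> grad_span n g"
  shows "grad_span n h' \<subseteq> grad_span n f"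
  unfolding grad_span_subset_iff
proof
  fix v
  have char': "of_nat (fact d) \<noteq> (0::'k)" using of_nat_fact_neq_0_mono[OF char] by simp
  obtain w where w: "dir_deriv n (lin n B v) h = dir_deriv n w g"
    using span unfolding grad_span_subset_iff by blast
  have "dir_deriv n v h' = dir_deriv n (lin n A w) f"
  proof (rule form_eqI[OF char' form_dir_deriv[OF h'(1)] form_dir_deriv[OF f]])
    fix x
    have "feval n (dir_deriv n v h') x = feval n (dir_deriv n w g) (lin n B x)"
      by (simp only: feval_dir_deriv_linear_subst[OF char h h'] w)
    also have "\<dots> = feval n (dir_deriv n (lin n A w) f) (lin n A (lin n B x))"
      by (rule feval_dir_deriv_linear_subst[OF char f g])
    also have "\<dots> = feval n (dir_deriv n (lin n A w) f) x" by (rule feval_cong) (rule AB)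
    finally show "feval n (dir_deriv n v h') x = feval n (dir_deriv n (lin n A w) f) x" .
  qed
  then show "\<exists>w. dir_deriv n v h' = dir_deriv n w f" by blast
qed

lemma grad_dim_eqI:
  fixes f :: "'k::field form"
  assumes "\<And>v. v \<in> coord_space n \<Longrightarrow> dir_deriv n v f = 0 \<Longrightarrow> v = 0"
  shows "grad_dim n f = n"
proof -
  let ?D = "\<lambda>v. dir_deriv n v f" and ?E = "std_basis ` {..<n} :: (nat \<Rightarrow> 'k) set"
  have E: "inj_on (std_basis :: nat \<Rightarrow> nat \<Rightarrow> 'k) {..<n}" "vectors.independent ?E"
      "vectors.span ?E = coord_space n"
    using basis_family_std_basis[of n, where ?'k = 'k]
    by (auto simp: coords.basis_family_iff bij_betw_def)
  have inj: "inj_on ?D (vectors.span ?E)"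
    using assms by (subst dir_deriv_vec.inj_on_iff_eq_0[OF vectors.subspace_span]) (simp add: E(3))
  have "grad_dim n f = card (?D ` ?E)"
    unfolding grad_dim_def grad_span_def partials_eq_image
    by (intro forms.dim_span_eq_card_independent dir_deriv_vec.independent_injective_image E(2) inj)
  also have "\<dots> = n"
    using card_image[OF inj_on_subset[OF inj vectors.span_superset]] card_image[OF E(1)] by simp
  finally show ?thesis .
qed

subsection \<open>Lines in the fibres of the gradient map\<close>

lemma Pc_iff: "f \<in> Pc n d \<longleftrightarrow> form n (Suc d) f \<and> f \<noteq> 0 \<and> grad_dim n f = n"
  by (auto simp: Pc_def Pforms_def zero_fun_def)

lemma grad_fiber_iff:
  "g \<in> grad_fiber n d f \<longleftrightarrow>
    form n (Suc d) g \<and> g \<noteq> 0 \<and> grad_dim n g = n \<and> grad_span n g = grad_span n f"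
  by (auto simp: grad_fiber_def Pc_iff)

lemma finite_line_exits_grad_fiber:
  fixes f g h :: "'k::field form"
  assumes char: "of_nat (Suc d) \<noteq> (0::'k)" and g: "g \<in> grad_fiber n d f"
    and h: "form n (Suc d) h" "grad_span n h \<subseteq> grad_span n f"
  shows "finite {t. g + fscale t h \<notin> grad_fiber n d f}"
proof -
  have g': "form n (Suc d) g" "g \<noteq> 0" "grad_dim n g = n" "grad_span n g = grad_span n f"
    using g by (auto simp: grad_fiber_iff)
  obtain M where M: "\<And>v. dir_deriv n v h = dir_deriv n (lin n M v) g"
    using dir_deriv_matrix_if_grad_span_subset h(2) g'(4) by metis
  define R where "R t i j = (if i = j then 1 else 0) + t * M i j" for t i j
  have "mdet n (\<lambda>i j. if i = j then 1 else 0 :: 'k) \<noteq> 0" by (simp add: mdet_diag)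
  then have fin: "finite {t. mdet n (R t) = 0}" unfolding R_def by (rule finite_singular_pencil)
  have "g + fscale t h \<in> grad_fiber n d f" if det: "mdet n (R t) \<noteq> 0" for t
  proof -
    let ?g = "g + fscale t h"
    have "dir_deriv n v ?g = dir_deriv n (lin n (R t) v) g" for v
    proof -
      have "dir_deriv n v ?g = dir_deriv n (v + vscale t (lin n M v)) g"
        by (simp add: dir_deriv_form.add dir_deriv_form.scale M dir_deriv_vec.add
            dir_deriv_vec.scale)
      also have "\<dots> = dir_deriv n (lin n (R t) v) g"
        by (rule dir_deriv_cong)
          (simp add: lin_def R_def vscale_def distrib_right sum.distrib sum_distrib_left mult.assoc
            if_distrib[of "\<lambda>c. c * _"] cong: if_cong)
      finally show ?thesis .
    qed
    then have span: "grad_span n ?g = grad_span n g" by (rule grad_span_eqI_matrix[OF det])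
    have "?g \<noteq> 0" using grad_span_neq_0[OF char g'(1,2)] by (metis span)
    with span g' form_add[OF g'(1) form_fscale[OF h(1)]] show ?thesis
      by (simp add: grad_fiber_iff grad_dim_def)
  qed
  then have "{t. g + fscale t h \<notin> grad_fiber n d f} \<subseteq> {t. mdet n (R t) = 0}" by blast
  then show ?thesis using fin by (rule finite_subset)
qed

lemma same_point_if_no_vars: "form 0 (Suc d) h \<Longrightarrow> same_point f h"
  by (auto simp: same_point_def form_iff monomials_def fscale_def fun_eq_iff intro: exI[of _ 0])

subsection \<open>Non-injectivity of the gradient at concise forms\<close>

locale concise_form =
  fixes n d :: nat and f :: "'k::field form"
  assumes fact_neq_0: "of_nat (fact (Suc d)) \<noteq> (0::'k)"
    and form_f: "form n (Suc d) f" and concise_f: "concise n (Suc d) f"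
begin

lemma fact_neq_0': "of_nat (fact d) \<noteq> (0::'k)"
  using of_nat_fact_neq_0_mono[OF fact_neq_0] by simp

lemma Suc_neq_0: "of_nat (Suc d) \<noteq> (0::'k)"
  by (rule of_nat_neq_0_if_fact_neq_0[OF fact_neq_0]) auto

lemma dir_deriv_f_eq_0_iff:
  assumes "v \<in> coord_space n"
  shows "dir_deriv n v f = 0 \<longleftrightarrow> v = 0"
  using assms concise_f
  by (auto simp: concise_iff[OF form_f] dir_deriv_eq_0_iff[OF fact_neq_0 form_f])

lemma pderiv_form_f_neq_0: "i < n \<Longrightarrow> pderiv_form i f \<noteq> 0"
  using dir_deriv_f_eq_0_iff[OF std_basis_in_coord_space] std_basis_neq_0
  by (simp flip: dir_deriv_std_basis)

lemma f_in_Pc: "0 < n \<Longrightarrow> f \<in> Pc n d"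
  using form_f pderiv_form_f_neq_0[of 0] dir_deriv_f_eq_0_iff
  by (auto simp: Pc_iff pderiv_form.zero intro!: grad_dim_eqI)

lemma f_in_grad_fiber: "0 < n \<Longrightarrow> f \<in> grad_fiber n d f"
  using f_in_Pc by (simp add: grad_fiber_def)

lemma concise_form_linear_subst:
  assumes A: "mdet n A \<noteq> 0" and g: "form n (Suc d) g" "\<And>x. feval n g x = feval n f (lin n A x)"
  shows "concise_form n d g"
proof
  obtain B where B: "\<And>x i. i < n \<Longrightarrow> lin n A (lin n B x) i = x i"
    using ex_inverse_matrix[OF A] by metis
  have f_eq: "feval n f x = feval n g (lin n B x)" for x
    unfolding g(2) by (rule feval_cong) (simp add: B)
  show "concise n (Suc d) g"
    unfolding concise_def
  proof (clarify)
    fix m L h assume m: "m < n"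
        and h: "form m (Suc d) h" "\<forall>x. feval n g x = feval m h (\<lambda>i. \<Sum>j<n. L i j * x j)"
    then have "feval n f x = feval m h (lin n (mmul n L B) x)" for x
      by (simp add: f_eq lin_mmul lin_def[of n L])
    then show False using concise_f m h(1) unfolding concise_def lin_def by blast
  qed
qed (use fact_neq_0 g(1) in auto)

lemma grad_not_injective_at_iff:
  assumes inf: "infinite (UNIV :: 'k set)"
  shows "grad_not_injective_at n d f \<longleftrightarrow>
    (\<exists>h. form n (Suc d) h \<and> \<not> same_point f h \<and> grad_span n h \<subseteq> grad_span n f)"
proof
  assume "\<exists>h. form n (Suc d) h \<and> \<not> same_point f h \<and> grad_span n h \<subseteq> grad_span n f"
  then obtain h where h: "form n (Suc d) h" "\<not> same_point f h" "grad_span n h \<subseteq> grad_span n f"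
    by blast
  have "0 < n" using same_point_if_no_vars h(1,2) by (cases n) auto
  then have "finite ({0} \<union> {t. f + fscale t h \<notin> grad_fiber n d f})"
    using finite_line_exits_grad_fiber[OF Suc_neq_0 f_in_grad_fiber h(1,3)] by blast
  then obtain t where t: "t \<noteq> 0" "f + fscale t h \<in> grad_fiber n d f"
    using ex_new_if_finite[OF inf] by blast
  have "\<not> same_point f (f + fscale t h)"
  proof
    assume "same_point f (f + fscale t h)"
    then obtain c where "f + fscale t h = fscale c f" by (auto simp: same_point_def)
    then have "fscale t h = fscale (c - 1) f"
      by (simp add: forms.scale_left_diff_distrib eq_diff_eq add.commute)
    then have "fscale (inverse t) (fscale t h) = fscale (inverse t * (c - 1)) f" by simp
    then have "h = fscale (inverse t * (c - 1)) f" using t(1) by simp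
    with h(2) show False unfolding same_point_def by blast
  qed
  then show "grad_not_injective_at n d f"
    using t(2) unfolding grad_not_injective_at_def grad_fiber_def by blast
qed (auto simp: grad_not_injective_at_def Pc_iff)

lemma grad_not_injective_at_if_linear_subst:
  assumes inf: "infinite (UNIV :: 'k set)" and A: "mdet n A \<noteq> 0"
    and g: "form n (Suc d) g" "\<And>x. feval n g x = feval n f (lin n A x)"
    and ni: "grad_not_injective_at n d g"
  shows "grad_not_injective_at n d f"
proof -
  interpret g: concise_form n d g by (rule concise_form_linear_subst[OF A g])
  obtain h where h: "form n (Suc d) h" "\<not> same_point g h" "grad_span n h \<subseteq> grad_span n g"
    using ni unfolding g.grad_not_injective_at_iff[OF inf] by blast
  obtain B where B: "\<And>x i. i < n \<Longrightarrow> lin n A (lin n B x) i = x i"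
      "\<And>x i. i < n \<Longrightarrow> lin n B (lin n A x) i = x i"
    using ex_inverse_matrix[OF A] by metis
  obtain h' where h': "form n (Suc d) h'" "\<And>x. feval n h' x = feval n h (lin n B x)"
    using ex_form_linear_subst[OF h(1)] by blast
  have "grad_span n h' \<subseteq> grad_span n f"
    by (rule grad_span_subset_linear_subst[OF fact_neq_0 form_f g h(1) h' B(1) h(3)])
  moreover have "\<not> same_point f h'"
  proof
    assume "same_point f h'"
    then obtain c where c: "h' = fscale c f" by (auto simp: same_point_def)
    have "h = fscale c g"
    proof (rule form_eqI[OF fact_neq_0 h(1) form_fscale[OF g(1)]])
      fix x
      have "feval n h x = feval n h' (lin n A x)"
        unfolding h'(2) by (rule feval_cong) (simp add: B(2))
      then show "feval n h x = feval n (fscale c g) x"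
        by (simp add: c feval_fscale[OF form_f] feval_fscale[OF g(1)] g(2))
    qed
    with h(2) show False by (auto simp: same_point_def)
  qed
  ultimately show ?thesis using h'(1) unfolding grad_not_injective_at_iff[OF inf] by blast
qed

subsection \<open>Direct sums and LDS forms are not determined by their gradient span\<close>

lemma grad_not_injective_at_if_split:
  assumes inf: "infinite (UNIV :: 'k set)" and m: "m \<le> n" and f_eq: "f = f1 + shift_form m f2"
    and f1: "form m (Suc d) f1" "f1 \<noteq> 0" and f2: "form (n - m) (Suc d) f2" "f2 \<noteq> 0"
  shows "grad_not_injective_at n d f"
  unfolding grad_not_injective_at_iff[OF inf]
proof (intro exI conjI)
  show "form n (Suc d) f1" using form_mono(1)[OF f1(1) m] .
  show "grad_span n f1 \<subseteq> grad_span n f"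
  proof (rule grad_span_subsetI)
    fix i assume i: "i < n"
    show "pderiv_form i f1 \<in> grad_span n f"
    proof (cases "i < m")
      case True
      then have "pderiv_form i f = pderiv_form i f1"
        by (simp add: f_eq pderiv_form.add pderiv_form_shift_form_less)
      with pderiv_form_in_grad_span[OF i, of f] show ?thesis by simp
    next
      case False
      then show ?thesis using pderiv_form_eq_0[OF f1(1)] zero_in_grad_span by simp
    qed
  qed
  show "\<not> same_point f f1"
  proof
    assume "same_point f f1"
    then obtain c where c: "f1 = fscale c f" by (auto simp: same_point_def)
    have "m \<noteq> n"
      using f2 by (auto simp: form_iff monomials_def)
    then have "m < n" using m by simp
    moreover have "fscale c (pderiv_form m f) = pderiv_form m f1"
      by (subst c) (simp add: pderiv_form.scale)
    ultimately have "c = 0" using pderiv_form_eq_0[OF f1(1), of m] pderiv_form_f_neq_0 by simp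
    then show False using c f1(2) by simp
  qed
qed

lemma grad_not_injective_at_if_LDS_form:
  assumes inf: "infinite (UNIV :: 'k set)" and l: "1 \<le> l" "2 * l \<le> n" and H: "form l (Suc d) H"
    and f_eq: "f = LDS_form l H G"
  shows "grad_not_injective_at n d f"
  unfolding grad_not_injective_at_iff[OF inf]
proof (intro exI conjI)
  let ?H = "shift_form l H"
  show "form n (Suc d) ?H" using l by (intro form_shift_form[OF H]) simp
  have dH: "pderiv_form (l + i) ?H = pderiv_form i f" if "i < l" for i
    using that by (simp add: f_eq pderiv_form_shift_form pderiv_LDS_form)
  have dH_0: "pderiv_form i ?H = 0" if "i < l \<or> 2 * l \<le> i" for i
  proof (cases "i < l")
    case False
    then obtain j where j: "i = l + j" using le_Suc_ex[of l i] by auto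
    then have "l \<le> j" using that False by simp
    with j show ?thesis using pderiv_form_eq_0[OF H] by (simp add: pderiv_form_shift_form)
  qed (rule pderiv_form_shift_form_less)
  show "grad_span n ?H \<subseteq> grad_span n f"
  proof (rule grad_span_subsetI)
    fix i assume "i < n"
    consider (outside) "i < l \<or> 2 * l \<le> i" | (inside) j where "i = l + j" "j < l"
      by (metis add_less_cancel_left le_add_diff_inverse mult_2 not_le)
    then show "pderiv_form i ?H \<in> grad_span n f"
    proof cases
      case outside
      then show ?thesis by (simp only: dH_0 zero_in_grad_span)
    next
      case (inside j)
      then show ?thesis using l pderiv_form_in_grad_span[of j n f] by (simp add: dH)
    qed
  qed
  show "\<not> same_point f ?H"
  proof
    assume "same_point f ?H"
    then obtain c where c: "?H = fscale c f" by (auto simp: same_point_def)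
    then have "fscale c (pderiv_form 0 f) = 0" using dH_0[of 0] l by (simp add: pderiv_form.scale)
    then have "?H = 0" using pderiv_form_f_neq_0[of 0] l c by auto
    then show False using dH[of 0] pderiv_form_f_neq_0[of 0] l by (simp add: pderiv_form.zero)
  qed
qed

lemma grad_not_injective_at_if_direct_sum:
  assumes inf: "infinite (UNIV :: 'k set)" and ds: "direct_sum n (Suc d) f"
  shows "grad_not_injective_at n d f"
proof -
  obtain A m f1 f2 where A: "mdet n A \<noteq> 0" and m: "m \<le> n"
    and f1: "form m (Suc d) f1" "f1 \<noteq> 0" and f2: "form (n - m) (Suc d) f2" "f2 \<noteq> 0"
    and f_A: "\<And>x. feval n f (lin n A x) = feval m f1 x + feval (n - m) f2 (\<lambda>j. x (m + j))"
    using ds unfolding direct_sum_def zero_fun_def by blast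
  let ?g = "f1 + shift_form m f2"
  have forms: "form n (Suc d) f1" "form n (Suc d) (shift_form m f2)"
    using m form_mono(1)[OF f1(1)] form_shift_form[OF f2(1)] by auto
  then have g: "form n (Suc d) ?g" by (rule form_add)
  have g_A: "feval n ?g x = feval n f (lin n A x)" for x
    using m by (simp add: f_A feval_add[OF forms] form_mono(2)[OF f1(1) m]
        feval_shift_form[OF f2(1)])
  interpret g: concise_form n d ?g by (rule concise_form_linear_subst[OF A g g_A])
  show ?thesis
    using g.grad_not_injective_at_if_split[OF inf m refl f1 f2]
    by (rule grad_not_injective_at_if_linear_subst[OF inf A g g_A])
qed

lemma grad_not_injective_at_if_LDS:
  assumes inf: "infinite (UNIV :: 'k set)" and lds: "LDS n d f"
  shows "grad_not_injective_at n d f"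
proof -
  obtain A l H G where A: "mdet n A \<noteq> 0" and l: "1 \<le> l" "2 * l \<le> n"
    and H: "form l (Suc d) H" and G: "form (n - l) (Suc d) G"
    and f_A: "\<And>x. feval n f (lin n A x) = feval n (LDS_form l H G) x"
    using lds unfolding LDS_iff_LDS_form by blast
  have g: "form n (Suc d) (LDS_form l H G)" by (rule form_LDS_form[OF l(2) H G])
  interpret g: concise_form n d "LDS_form l H G"
    by (rule concise_form_linear_subst[OF A g f_A[symmetric]])
  show ?thesis
    using g.grad_not_injective_at_if_LDS_form[OF inf l H refl]
    by (rule grad_not_injective_at_if_linear_subst[OF inf A g f_A[symmetric]])
qed

end

subsection \<open>Operators that are self-adjoint for the Hessian\<close>

context concise_form
begin

text \<open>The Hessian of \<open>f\<close> is the bilinear map \<open>(u, v) \<mapsto> \<partial>\<^sub>u \<partial>\<^sub>v f\<close>, with values in forms.\<close>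

definition hessian_self_adjoint :: "((nat \<Rightarrow> 'k) \<Rightarrow> nat \<Rightarrow> 'k) \<Rightarrow> bool" where
  "hessian_self_adjoint Q \<longleftrightarrow>
    (\<forall>u v. dir_deriv n u (dir_deriv n (Q v) f) = dir_deriv n v (dir_deriv n (Q u) f))"

lemma hessian_self_adjointD:
  "hessian_self_adjoint Q \<Longrightarrow> dir_deriv n u (dir_deriv n (Q v) f)
      = dir_deriv n v (dir_deriv n (Q u) f)"
  by (simp add: hessian_self_adjoint_def)

lemma hessian_self_adjoint_if_dir_deriv_eq:
  assumes "\<And>v. dir_deriv n v g = dir_deriv n (Q v) f"
  shows "hessian_self_adjoint Q"
  by (simp add: hessian_self_adjoint_def dir_deriv_commute flip: assms)

lemma hessian_self_adjoint_funpow: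
  assumes "hessian_self_adjoint Q"
  shows "hessian_self_adjoint (Q ^^ r)"
proof (induction r)
  case 0
  show ?case by (simp add: hessian_self_adjoint_def dir_deriv_commute)
next
  case (Suc r)
  have "dir_deriv n u (dir_deriv n ((Q ^^ Suc r) v) f)
      = dir_deriv n v (dir_deriv n ((Q ^^ Suc r) u) f)" for u v
  proof -
    have "dir_deriv n u (dir_deriv n ((Q ^^ Suc r) v) f)
        = dir_deriv n ((Q ^^ r) v) (dir_deriv n (Q u) f)"
      using hessian_self_adjointD[OF assms] by simp
    also have "\<dots> = dir_deriv n (Q u) (dir_deriv n ((Q ^^ r) v) f)" by (rule dir_deriv_commute)
    also have "\<dots> = dir_deriv n v (dir_deriv n ((Q ^^ r) (Q u)) f)"
      by (rule hessian_self_adjointD[OF Suc])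
    finally show ?thesis by (simp add: funpow_swap1)
  qed
  then show ?case by (simp add: hessian_self_adjoint_def)
qed

lemma ex_feval_neq_0_on_summand:
  assumes decomp: "coords.direct_decomposition (coord_space n) U W" and U: "U \<noteq> {0}"
    and split: "\<And>u w. u \<in> U \<Longrightarrow> w \<in> W \<Longrightarrow> feval n f (u + w) = feval n f u + feval n f w"
  obtains u where "u \<in> U" "feval n f u \<noteq> 0"
proof (rule ccontr)
  assume "\<not> thesis"
  with that have zero: "feval n f u = 0" if "u \<in> U" for u using that by blast
  have sub: "vectors.subspace U" and sum: "{u + w | u w. u \<in> U \<and> w \<in> W} = coord_space n"
    using decomp by (auto simp: coords.direct_decomposition_def)
  obtain u0 where u0: "u0 \<in> U" "u0 \<noteq> 0" using U vectors.subspace_0[OF sub] by blast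
  have "feval n f (x + vscale t u0) = feval n f x" for x t
  proof -
    define y where "y i = (if i < n then x i else 0)" for i
    have y: "feval n f (z + x) = feval n f (z + y)" for z by (rule feval_cong) (simp add: y_def)
    have "y \<in> coord_space n" by (simp add: y_def coord_space_def)
    then obtain u w where uw: "u \<in> U" "w \<in> W" "y = u + w" using sum by blast
    have "vscale t u0 + u \<in> U"
      using uw(1) u0(1) sub by (intro vectors.subspace_add vectors.subspace_scale)
    then have "feval n f (vscale t u0 + y) = feval n f w"
      using split[OF _ uw(2)] zero by (simp add: uw(3) flip: add.assoc)
    also have "\<dots> = feval n f (0 + y)" using split[OF uw(1,2)] zero[OF uw(1)] by (simp add: uw(3))
    finally show ?thesis using y[of "vscale t u0"] y[of 0] by (simp add: add.commute)
  qed
  then have "dir_deriv n u0 f = 0" using dir_deriv_eq_0_iff[OF fact_neq_0 form_f] by blast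
  then show False
    using dir_deriv_f_eq_0_iff coords.direct_decomposition_subset(1)[OF decomp] u0 by blast
qed

lemma direct_sum_if_hessian_orthogonal:
  assumes decomp: "coords.direct_decomposition (coord_space n) U W"
    and U: "U \<noteq> {0}" and W: "W \<noteq> {0}"
    and orth: "\<And>u w. u \<in> U \<Longrightarrow> w \<in> W \<Longrightarrow> dir_deriv n u (dir_deriv n w f) = 0"
  shows "direct_sum n (Suc d) f"
proof -
  have split: "feval n f (u + w) = feval n f u + feval n f w" if "u \<in> U" "w \<in> W" for u w
    by (rule feval_add_if_dir_deriv_dir_deriv_0[OF fact_neq_0 form_f orth[OF that]])
  have sub: "vectors.subspace U" "vectors.subspace W"
    using decomp by (auto simp: coords.direct_decomposition_def)
  have "U \<subseteq> coord_space n" "W \<subseteq> coord_space n"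
    using coords.direct_decomposition_subset[OF decomp] by auto
  then obtain m a k b where a: "coords.basis_family U m a" and b: "coords.basis_family W k b"
    using coords.ex_basis_family sub by metis
  let ?A = "\<lambda>i j. append_family m a b j i"
  have basis: "coords.basis_family (coord_space n) (m + k) (append_family m a b)"
    by (rule coords.basis_family_append[OF decomp a b])
  then have n: "n = m + k" by (rule basis_family_coord_space_length[symmetric])
  obtain f1 where f1: "form m (Suc d) f1" "\<And>x. feval m f1 x = feval n f (coords.lincomb m a x)"
    using ex_form_lincomb_subst[OF form_f] by blast
  obtain f2 where f2: "form k (Suc d) f2" "\<And>x. feval k f2 x = feval n f (coords.lincomb k b x)"
    using ex_form_lincomb_subst[OF form_f] by blast
  have "f1 \<noteq> 0"
    using ex_feval_neq_0_on_summand[OF decomp U split] coords.basis_familyD(2)[OF a] f1(2)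
    by (metis feval_0)
  moreover have "f2 \<noteq> 0"
    using ex_feval_neq_0_on_summand[of W U] decomp W split coords.basis_familyD(2)[OF b] f2(2)
    by (metis add.commute coords.direct_decomposition_commute feval_0)
  moreover have "feval n f (lin n ?A x) = feval m f1 x + feval (n - m) f2 (\<lambda>j. x (m + j))" for x
    using split[OF coords.basis_familyD(1)[OF a] coords.basis_familyD(1)[OF b]] f1(2) f2(2)
    by (simp add: lin_columns n coords.lincomb_append)
  moreover have "mdet n ?A \<noteq> 0" using mdet_basis_family basis n by blast
  ultimately show ?thesis
    using f1(1) f2(1) n unfolding direct_sum_def zero_fun_def
    by (intro exI[of _ ?A] exI[of _ m] exI[of _ f1] exI[of _ f2]) simp
qed

lemma direct_sum_if_singular_not_nilpotent:
  assumes Q: "coords.endomorphism n Q"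
    and sym: "hessian_self_adjoint Q"
    and v: "v \<in> coord_space n" "v \<noteq> 0" "Q v = 0"
    and not_nil: "\<And>r. \<exists>w\<in>coord_space n. (Q ^^ r) w \<noteq> 0"
  shows "direct_sum n (Suc d) f"
proof -
  obtain r where r: "1 \<le> r"
    and decomp: "coords.direct_decomposition (coord_space n)
      {u \<in> coord_space n. (Q ^^ r) u = 0} ((Q ^^ r) ` coord_space n)"
    using coords.fitting_decomposition[OF Q] by blast
  have "(Q ^^ r) v = (Q ^^ (r - 1)) (Q v)" using r by (cases r) (simp_all add: funpow_swap1)
  then have v_ker: "v \<in> {u \<in> coord_space n. (Q ^^ r) u = 0}"
    using v coords.endomorphism_0[OF coords.endomorphism_funpow[OF Q]] by simp
  obtain w where w: "w \<in> coord_space n" "(Q ^^ r) w \<noteq> 0" using not_nil by blast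
  show ?thesis
  proof (rule direct_sum_if_hessian_orthogonal[OF decomp])
    fix u w assume u: "u \<in> {u \<in> coord_space n. (Q ^^ r) u = 0}" and "w \<in> (Q ^^ r) ` coord_space n"
    then obtain w' where "w = (Q ^^ r) w'" by blast
    then show "dir_deriv n u (dir_deriv n w f) = 0"
      using hessian_self_adjointD[OF hessian_self_adjoint_funpow[OF sym], of u r w'] u
      by (simp add: dir_deriv_vec.zero dir_deriv_form.zero)
  qed (use v_ker v(2) w in blast)+
qed

text \<open>Self-adjointness of \<open>N\<close> says that the one-form \<open>v \<mapsto> \<partial>\<^bsub>N v\<^esub> f\<close> is closed.\<close>

lemma ex_hessian_primitive:
  assumes N: "Vector_Spaces.linear vscale vscale N" and sym: "hessian_self_adjoint N"
  obtains h where "form n (Suc d) h" "\<And>v. v \<in> coord_space n \<Longrightarrow> dir_deriv n v h = dir_deriv n (N v) f"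
proof -
  interpret N: Vector_Spaces.linear vscale vscale N by (rule N)
  obtain h where h: "form n (Suc d) h"
      "\<And>i. i < n \<Longrightarrow> pderiv_form i h = dir_deriv n (N (std_basis i)) f"
  proof (rule ex_primitive_form[OF Suc_neq_0, of n "\<lambda>i. dir_deriv n (N (std_basis i)) f"])
    show "form n d (dir_deriv n (N (std_basis i)) f)" for i by (rule form_dir_deriv[OF form_f])
    show "pderiv_form j (dir_deriv n (N (std_basis i)) f)
        = pderiv_form i (dir_deriv n (N (std_basis j)) f)"
      if "i < n" "j < n" for i j
      using hessian_self_adjointD[OF sym, of "std_basis j" "std_basis i"] that
      by (simp add: dir_deriv_std_basis)
  qed blast
  have "dir_deriv n v h = dir_deriv n (N v) f" if "v \<in> coord_space n" for v
    by (subst (2) coord_space_expansion[OF that])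
      (simp add: dir_deriv_def[of n v] h(2) N.sum N.scale dir_deriv_vec.sum dir_deriv_vec.scale)
  with h(1) show thesis by (rule that)
qed

lemma feval_translate_if_square_zero:
  assumes N: "coords.endomorphism n N"
    and h: "\<And>v. v \<in> coord_space n \<Longrightarrow> dir_deriv n v h = dir_deriv n (N v) f"
    and u: "u \<in> coord_space n" "N (N u) = 0"
  shows "feval n f (y + N u) = feval n f y + feval n (dir_deriv n u h) y"
proof -
  have "dir_deriv n (N u) h = 0"
    using h[OF coords.endomorphism_in[OF N u(1)]] u(2) by (simp add: dir_deriv_vec.zero)
  then have "dir_deriv n (N u) (dir_deriv n (N u) f) = 0"
    by (simp add: dir_deriv_commute[of n "N u"] dir_deriv_form.zero flip: h[OF u(1)])
  from feval_translate_if_dir_deriv_dir_deriv_0[OF fact_neq_0 form_f this] show ?thesis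
    by (simp add: h[OF u(1)])
qed

lemma feval_translate_lincomb_if_square_zero:
  assumes N: "coords.endomorphism n N"
    and sq: "\<And>v. v \<in> coord_space n \<Longrightarrow> N (N v) = 0"
    and h: "form n (Suc d) h" "\<And>v. v \<in> coord_space n \<Longrightarrow> dir_deriv n v h = dir_deriv n (N v) f"
    and u: "\<And>j. j < l \<Longrightarrow> u j \<in> coord_space n"
  shows "feval n f (y + coords.lincomb l (\<lambda>j. N (u j)) x)
    = feval n f y + (\<Sum>i<l. x i * feval n (dir_deriv n (u i) h) y)"
proof -
  let ?u = "coords.lincomb l u x"
  have "?u \<in> coord_space n" by (rule coords.lincomb_in[OF subspace_coord_space u])
  then have "feval n f (y + N ?u) = feval n f y + feval n (dir_deriv n ?u h) y"
    using feval_translate_if_square_zero[OF N h(2) _ sq] by blast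
  moreover have "feval n (dir_deriv n ?u h) y
      = (\<Sum>i<l. feval n (fscale (x i) (dir_deriv n (u i) h)) y)"
    unfolding coords.lincomb_def dir_deriv_vec.sum dir_deriv_vec.scale
    by (rule feval_sum[of _ _ d]) (intro form_fscale form_dir_deriv h(1))
  ultimately show ?thesis
    by (simp add: coords.linear_lincomb[OF coords.linear_endomorphism[OF N]]
        feval_fscale[OF form_dir_deriv[OF h(1)]])
qed

lemma feval_dir_deriv_translate_kernel:
  assumes N: "coords.endomorphism n N"
    and h: "form n (Suc d) h" "\<And>v. v \<in> coord_space n \<Longrightarrow> dir_deriv n v h = dir_deriv n (N v) f"
    and w: "\<And>j. j < k \<Longrightarrow> w j \<in> coord_space n" "\<And>j. j < k \<Longrightarrow> N (w j) = 0"
  shows "feval n (dir_deriv n v h) (y + coords.lincomb k w c) = feval n (dir_deriv n v h) y"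
proof (rule feval_translate_if_dir_deriv_0[OF fact_neq_0' form_dir_deriv[OF h(1)]])
  let ?w = "coords.lincomb k w c"
  have "N ?w = 0"
    unfolding coords.linear_lincomb[OF coords.linear_endomorphism[OF N]]
    by (simp add: coords.lincomb_def w(2))
  then have "dir_deriv n ?w h = 0"
    using h(2) w(1) by (simp add: coords.lincomb_in[OF subspace_coord_space] dir_deriv_vec.zero)
  then show "dir_deriv n ?w (dir_deriv n v h) = 0"
    by (simp add: dir_deriv_commute[of n ?w] dir_deriv_form.zero)
qed

lemma LDS_if_square_zero:
  assumes N: "coords.endomorphism n N"
    and sym: "hessian_self_adjoint N" and sq: "\<And>v. v \<in> coord_space n \<Longrightarrow> N (N v) = 0"
    and nz: "\<exists>v\<in>coord_space n. N v \<noteq> 0"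
  shows "LDS n d f"
proof -
  obtain h where h: "form n (Suc d) h"
      "\<And>v. v \<in> coord_space n \<Longrightarrow> dir_deriv n v h = dir_deriv n (N v) f"
    using ex_hessian_primitive[OF coords.linear_endomorphism[OF N] sym] by blast
  obtain l k u w where l: "1 \<le> l" and w: "\<And>j. j < k \<Longrightarrow> N (w j) = 0"
    and basis: "coords.basis_family (coord_space n) (l + (l + k))
      (append_family l (\<lambda>j. N (u j)) (append_family l u w))"
    by (rule coords.square_zero_basis_family[OF N _ nz], erule sq, rule that)
  let ?uw = "append_family l u w"
  let ?A = "\<lambda>i j. append_family l (\<lambda>j. N (u j)) ?uw j i"
  have n: "n = l + (l + k)" by (rule basis_family_coord_space_length[OF basis, symmetric])
  have u_in: "u j \<in> coord_space n" if "j < l" for j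
    using coords.basis_family_in[OF basis, of "l + j"] that by simp
  have w_in: "w j \<in> coord_space n" if "j < k" for j
    using coords.basis_family_in[OF basis, of "l + (l + j)"] that by simp
  obtain H where H: "form l (Suc d) H" "\<And>x. feval l H x = feval n h (coords.lincomb l u x)"
    using ex_form_lincomb_subst[OF h(1)] by blast
  obtain G where G: "form (l + k) (Suc d) G"
      "\<And>x. feval (l + k) G x = feval n f (coords.lincomb (l + k) ?uw x)"
    using ex_form_lincomb_subst[OF form_f] by blast
  have dH: "feval n (dir_deriv n (u i) h) (coords.lincomb (l + k) ?uw x)
      = feval l (pderiv_form i H) x"
    if "i < l" for i x
    using feval_dir_deriv_translate_kernel[OF N h w_in w]
    by (simp add: coords.lincomb_append feval_pderiv_form_lincomb_subst[OF fact_neq_0 h(1) H that])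
  have "feval n f (lin n ?A x) =
      (\<Sum>i<l. x i * feval l (pderiv_form i H) (\<lambda>j. x (l + j))) + feval (n - l) G (\<lambda>j. x (l + j))"
    for x
  proof -
    let ?y = "coords.lincomb (l + k) ?uw (\<lambda>j. x (l + j))"
    have "lin n ?A x = ?y + coords.lincomb l (\<lambda>j. N (u j)) x"
      unfolding lin_columns n coords.lincomb_append[of l "l + k"] by (rule add.commute)
    then have "feval n f (lin n ?A x)
        = feval n f ?y + (\<Sum>i<l. x i * feval l (pderiv_form i H) (\<lambda>j. x (l + j)))"
      using feval_translate_lincomb_if_square_zero[OF N sq h u_in] by (simp add: dH)
    then show ?thesis using G(2) by (simp add: n)
  qed
  moreover have "mdet n ?A \<noteq> 0" using mdet_basis_family basis n by blast
  ultimately show ?thesis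
    using l H(1) G(1) n unfolding LDS_def Suc_eq_plus1[symmetric]
    by (intro exI[of _ ?A] exI[of _ l] exI[of _ H] exI[of _ G]) simp
qed
theorem direct_sum_or_LDS_if_singular_self_adjoint:
  assumes Q: "coords.endomorphism n Q"
    and sym: "hessian_self_adjoint Q"
    and v: "v \<in> coord_space n" "v \<noteq> 0" "Q v = 0" and nz: "\<exists>u\<in>coord_space n. Q u \<noteq> 0"
  shows "direct_sum n (Suc d) f \<or> LDS n d f"
proof (cases "\<forall>r. \<exists>w\<in>coord_space n. (Q ^^ r) w \<noteq> 0")
  case True
  then show ?thesis
    using direct_sum_if_singular_not_nilpotent[OF Q sym v] by blast
next
  case False
  then obtain s where "\<exists>u\<in>coord_space n. (Q ^^ s) u \<noteq> 0"
    "\<And>u. u \<in> coord_space n \<Longrightarrow> (Q ^^ s) ((Q ^^ s) u) = 0"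
    using coords.square_zero_power_if_nilpotent[OF Q nz] by metis
  then show ?thesis
    using LDS_if_square_zero coords.endomorphism_funpow[OF Q] hessian_self_adjoint_funpow[OF sym]
    by blast
qed

theorem direct_sum_or_LDS_if_grad_span_subset:
  assumes ac: "alg_closed TYPE('k)"
    and h: "form n (Suc d) h" "\<not> same_point f h" "grad_span n h \<subseteq> grad_span n f"
  shows "direct_sum n (Suc d) f \<or> LDS n d f"
proof -
  obtain M where M: "\<And>v. dir_deriv n v h = dir_deriv n (lin n M v) f"
      "\<And>v. lin n M v \<in> coord_space n"
    using dir_deriv_matrix_if_grad_span_subset[OF h(3)] by blast
  have "0 < n" using same_point_if_no_vars h(1,2) by (cases n) auto
  then obtain a v where v: "v \<in> coord_space n" "v \<noteq> 0" "\<And>i. i < n \<Longrightarrow> lin n M v i = a * v i"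
    using ex_eigenvector[OF ac] by metis
  define Q where "Q u = lin n M u - vscale a u" for u
  define g where "g = h - fscale a f"
  have g: "form n (Suc d) g" unfolding g_def by (intro form_diff form_fscale form_f h(1))
  have dg: "dir_deriv n u g = dir_deriv n (Q u) f" for u
    by (simp add: g_def Q_def dir_deriv_form.diff dir_deriv_form.scale dir_deriv_vec.diff
        dir_deriv_vec.scale M(1))
  show ?thesis
  proof (rule direct_sum_or_LDS_if_singular_self_adjoint[OF _ _ v(1,2)])
    have "Vector_Spaces.linear vscale vscale Q"
      by (simp add: Vector_Spaces.linear_iff vectors.vector_space_axioms Q_def lin.add lin.scale
          vectors.scale_right_distrib vectors.scale_right_diff_distrib mult.commute)
    then show "coords.endomorphism n Q"
      using M(2) subspace_coord_space
      by (auto simp: coords.endomorphism_def Q_def intro: vectors.subspace_diff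
          vectors.subspace_scale)
    show "hessian_self_adjoint Q" using dg by (rule hessian_self_adjoint_if_dir_deriv_eq)
    have "Q v i = 0" for i
      using v(1,3) M(2)[of v] by (cases "i < n") (auto simp: Q_def vscale_def coord_space_def)
    then show "Q v = 0" by (simp add: fun_eq_iff)
    show "\<exists>u\<in>coord_space n. Q u \<noteq> 0"
    proof (rule ccontr)
      assume "\<not> ?thesis"
      then have "pderiv_form i g = 0" if "i < n" for i
        using dg[of "std_basis i"] std_basis_in_coord_space[OF that, where ?'a = 'k] that
        by (simp add: dir_deriv_std_basis dir_deriv_vec.zero)
      then have "g = 0" by (rule form_eq_0_if_pderivs_0[OF Suc_neq_0 g])
      with h(2) show False by (auto simp: g_def same_point_def)
    qed
  qed
qed

subsection \<open>Linear and quadratic forms\<close>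

lemma card_vars_if_linear:
  assumes "d = 0"
  shows "n \<le> 1"
proof (rule ccontr)
  assume "\<not> n \<le> 1"
  then obtain c where c: "c \<in> coord_space n" "c \<noteq> 0"
    and "lin n (\<lambda>_ j. pderiv_form j f (\<lambda>_. 0)) c 0 = 0"
    using ex_kernel_vector[of 1 n] by (metis less_one not_le)
  then have "dir_deriv n c f (\<lambda>_. 0) = 0" by (simp add: dir_deriv_apply lin_def mult.commute)
  then have "dir_deriv n c f = 0"
    using form_dir_deriv[OF form_f, of c] assms by (intro form_degree_0_eqI[of n]) simp_all
  with c show False by (simp add: dir_deriv_f_eq_0_iff)
qed

lemma ex_feval_neq_0:
  assumes "0 < n"
  obtains v where "v \<in> coord_space n" "feval n f v \<noteq> 0"
proof -
  have "f \<noteq> 0" using f_in_Pc[OF assms] by (simp add: Pc_iff)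
  then obtain x where x: "feval n f x \<noteq> 0" using form_eq_0_if_feval_0[OF fact_neq_0 form_f] by blast
  let ?v = "\<lambda>i. if i < n then x i else 0"
  have "feval n f ?v = feval n f x" by (rule feval_cong) simp
  with x show thesis by (intro that[of ?v]) (auto simp: coord_space_def)
qed

lemma dir_deriv_dir_deriv_neq_0:
  assumes "1 \<le> d" "feval n f v \<noteq> 0"
  shows "dir_deriv n v (dir_deriv n v f) \<noteq> 0"
proof
  assume "dir_deriv n v (dir_deriv n v f) = 0"
  then have "feval n f (0 + v) = feval n f 0 + feval n (dir_deriv n v f) 0"
    by (rule feval_translate_if_dir_deriv_dir_deriv_0[OF fact_neq_0 form_f])
  moreover have "feval n (dir_deriv n v f) 0 = 0"
    using assms(1) form_dir_deriv[OF form_f] by (cases d) (auto intro: feval_at_0)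
  ultimately show False using assms(2) feval_at_0[OF form_f] by simp
qed

text \<open>For \<open>f v \<noteq> 0\<close> the operator \<open>w \<mapsto> (\<partial>\<^sub>w \<partial>\<^sub>v f) v\<close> of rank one is singular and not nilpotent.\<close>

lemma direct_sum_if_quadratic:
  assumes d: "d = 1" and n: "2 \<le> n"
  shows "direct_sum n (Suc d) f"
proof -
  obtain v where v: "v \<in> coord_space n" "feval n f v \<noteq> 0" using ex_feval_neq_0 n by auto
  define B where "B w = dir_deriv n w (dir_deriv n v f) (\<lambda>_. 0)" for w
  define Q where "Q w = vscale (B w) v" for w
  have form_ddf: "form n 0 (dir_deriv n u (dir_deriv n w f))" for u w
    using form_dir_deriv[OF form_dir_deriv] form_f d by simp
  have "B v \<noteq> 0"
    using dir_deriv_dir_deriv_neq_0[OF _ v(2)] form_degree_0_eqI[OF form_ddf form_0] d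
    by (auto simp: B_def)
  obtain c where c: "c \<in> coord_space n" "c \<noteq> 0"
    "lin n (\<lambda>_ j. pderiv_form j (dir_deriv n v f) (\<lambda>_. 0)) c 0 = 0"
    using ex_kernel_vector[of 1 n] n by (metis Suc_1 Suc_le_lessD less_one)
  show ?thesis
  proof (rule direct_sum_if_singular_not_nilpotent)
    have "Vector_Spaces.linear vscale vscale Q"
      by (simp add: Vector_Spaces.linear_iff vectors.vector_space_axioms Q_def B_def
          dir_deriv_vec.add dir_deriv_vec.scale vectors.scale_left_distrib fscale_def)
    then show "coords.endomorphism n Q"
      using vectors.subspace_scale[OF subspace_coord_space v(1)]
      by (auto simp: coords.endomorphism_def Q_def)
    have "dir_deriv n u (dir_deriv n (Q w) f) (\<lambda>_. 0) = B w * B u" for u w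
      by (simp add: Q_def B_def dir_deriv_vec.scale dir_deriv_form.scale
          fscale_def[of _ "dir_deriv n u _"])
    then show "hessian_self_adjoint Q"
      unfolding hessian_self_adjoint_def
      by (intro allI form_degree_0_eqI[OF form_ddf form_ddf]) (simp add: mult.commute)
    have "(Q ^^ r) v = vscale (B v ^ r) v" for r
    proof (induction r)
      case (Suc r)
      then show ?case by (simp add: Q_def B_def dir_deriv_vec.scale fscale_def mult.commute)
    qed simp
    then show "\<exists>w\<in>coord_space n. (Q ^^ r) w \<noteq> 0" for r
      using v \<open>B v \<noteq> 0\<close> feval_at_0[OF form_f] by (intro bexI[of _ v]) auto
    show "c \<in> coord_space n" "c \<noteq> 0" "Q c = 0"
      using c by (auto simp: Q_def B_def dir_deriv_apply lin_def mult.commute)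
  qed
qed

end

subsection \<open>Zariski closed sets and fibres of the gradient morphism\<close>

lemma Pforms_iff: "f \<in> Pforms n e \<longleftrightarrow> form n e f \<and> f \<noteq> 0"
  by (simp add: Pforms_def zero_fun_def)

lemma fscale_in_Pforms: "f \<in> Pforms n e \<Longrightarrow> c \<noteq> 0 \<Longrightarrow> fscale c f \<in> Pforms n e"
  by (simp add: Pforms_iff form_fscale)

lemma zclosed_Pforms: "zclosed n e (Pforms n e)"
  unfolding zclosed_def by (intro exI[of _ "{}"]) auto

lemma fscale_in_zclosed:
  assumes Z: "zclosed n e Z" and f: "f \<in> Z" and c: "c \<noteq> 0"
  shows "fscale c f \<in> Z"
proof -
  obtain \<P> where P: "\<And>r P. (r, P) \<in> \<P> \<Longrightarrow> is_hpoly (coeff_idx n e) r P"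
    and Z_eq: "Z = {f \<in> Pforms n e. \<forall>(r, P)\<in>\<P>. peval (coeff_idx n e) P f = 0}"
    using Z unfolding zclosed_def by blast
  have "peval (coeff_idx n e) P (fscale c f) = 0" if "(r, P) \<in> \<P>" for r P
    using peval_homogeneous[OF P[OF that]] that f by (auto simp: Z_eq fscale_def)
  then show ?thesis using f c by (auto simp: Z_eq fscale_in_Pforms)
qed

lemma zclosed_zero_set:
  assumes "\<And>i. i \<in> A \<Longrightarrow> hpoly_fun (coeff_idx n e) (r i) (F i)"
  shows "zclosed n e {g \<in> Pforms n e. \<forall>i\<in>A. F i g = 0}"
proof -
  have "\<exists>P. is_hpoly (coeff_idx n e) (r i) P \<and> (\<forall>g. peval (coeff_idx n e) P g = F i g)"
    if "i \<in> A" for i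
    using ex_hpoly[OF _ assms[OF that]]
    by (metis coeff_idx_eq_monomials finite_lessThan finite_monomials)
  then obtain P where P: "\<And>i. i \<in> A \<Longrightarrow> is_hpoly (coeff_idx n e) (r i) (P i)"
    "\<And>i g. i \<in> A \<Longrightarrow> peval (coeff_idx n e) (P i) g = F i g"
    by metis
  show ?thesis
    unfolding zclosed_def by (intro exI[of _ "(\<lambda>i. (r i, P i)) ` A"]) (auto simp: P)
qed

lemma zclosed_separating_poly:
  assumes "zclosed n e Z" "h \<in> Pforms n e" "h \<notin> Z"
  obtains P where "peval (coeff_idx n e) P h \<noteq> 0" "\<And>g. g \<in> Z \<Longrightarrow> peval (coeff_idx n e) P g = 0"
proof -
  obtain \<P> where "\<forall>(r, P)\<in>\<P>. is_hpoly (coeff_idx n e) r P"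
    and Z: "Z = {f \<in> Pforms n e. \<forall>(r, P)\<in>\<P>. peval (coeff_idx n e) P f = 0}"
    using assms(1) unfolding zclosed_def by (elim exE conjE) (rule that)
  have "\<not> (\<forall>(r, P)\<in>\<P>. peval (coeff_idx n e) P h = 0)" using assms(2,3) by (simp add: Z)
  then obtain r P where P: "(r, P) \<in> \<P>" "peval (coeff_idx n e) P h \<noteq> 0" by blast
  moreover from P(1) have "peval (coeff_idx n e) P g = 0" if "g \<in> Z" for g
    using that unfolding Z by blast
  ultimately show thesis using that by simp
qed

definition proj_point :: "'k::field form \<Rightarrow> 'k form set" where
  "proj_point f = {fscale c f | c. c \<noteq> 0}"

lemma self_in_proj_point: "f \<in> proj_point f"
  by (auto simp: proj_point_def intro!: exI[of _ 1])

lemma zclosed_proj_point: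
  fixes f :: "'k::field form"
  assumes f: "f \<in> Pforms n e"
  shows "zclosed n e (proj_point f)"
proof -
  let ?I = "coeff_idx n e"
  have fin: "finite ?I" by (simp add: coeff_idx_eq_monomials finite_monomials)
  have outside: "g m = 0" if "g \<in> Pforms n e" "m \<notin> ?I" for g :: "'k form" and m
    using that by (auto simp: Pforms_iff form_iff coeff_idx_eq_monomials)
  obtain a where a: "f a \<noteq> 0" using f by (auto simp: Pforms_iff fun_eq_iff)
  then have aI: "a \<in> ?I" using outside[OF f] by blast
  have "proj_point f = {g \<in> Pforms n e. \<forall>m\<in>?I. f a * g m + (- f m) * g a = 0}"
  proof (intro equalityI subsetI)
    fix g assume "g \<in> proj_point f"
    then show "g \<in> {g \<in> Pforms n e. \<forall>m\<in>?I. f a * g m + (- f m) * g a = 0}"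
      using fscale_in_Pforms[OF f] by (auto simp: proj_point_def fscale_def)
  next
    fix g assume "g \<in> {g \<in> Pforms n e. \<forall>m\<in>?I. f a * g m + (- f m) * g a = 0}"
    then have g: "g \<in> Pforms n e" and eq: "\<And>m. m \<in> ?I \<Longrightarrow> f a * g m + (- f m) * g a = 0" by auto
    have "g m = g a / f a * f m" for m
    proof (cases "m \<in> ?I")
      case True
      with eq a show ?thesis by (simp add: field_simps)
    qed (simp add: outside f g)
    then have g_eq: "g = fscale (g a / f a) f" unfolding fscale_def by (rule ext)
    moreover have "g a / f a \<noteq> 0"
      using g g_eq by (metis Pforms_iff forms.scale_zero_left)
    ultimately show "g \<in> proj_point f" unfolding proj_point_def by blast
  qed
  moreover have "hpoly_fun ?I 1 (\<lambda>g. f a * g m + (- f m) * g a)" if "m \<in> ?I" for m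
    by (intro hpoly_fun_add hpoly_fun_cmult hpoly_fun_var fin that aI)
  ultimately show ?thesis
    using zclosed_zero_set[of ?I n e "\<lambda>_. 1" "\<lambda>m g. f a * g m + (- f m) * g a"] by (simp only:)
qed

lemma zirreducible_proj_point: "zirreducible n e (proj_point f)"
proof -
  have "proj_point f \<subseteq> Z" if "zclosed n e Z" "f \<in> Z" for Z
    using fscale_in_zclosed[OF that] by (auto simp: proj_point_def)
  then show ?thesis
    unfolding zirreducible_def using self_in_proj_point[of f] by blast
qed

lemma zirreducible_if_lines_exit_finitely:
  fixes Y :: "'k::field form set"
  assumes inf: "infinite (UNIV :: 'k set)" and Y: "Y \<noteq> {}" "Y \<subseteq> Pforms n e"
    and lines: "\<And>g h. g \<in> Y \<Longrightarrow> h \<in> Y \<Longrightarrow> finite {t. g + fscale t (h - g) \<notin> Y}"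
  shows "zirreducible n e Y"
  unfolding zirreducible_def
proof (intro conjI allI impI)
  fix Z1 Z2 :: "'k form set"
  assume "zclosed n e Z1 \<and> zclosed n e Z2 \<and> Y \<subseteq> Z1 \<union> Z2"
  then have Z: "zclosed n e Z1" "zclosed n e Z2" "Y \<subseteq> Z1 \<union> Z2" by auto
  let ?I = "coeff_idx n e"
  show "Y \<subseteq> Z1 \<or> Y \<subseteq> Z2"
  proof (rule ccontr)
    assume "\<not> ?thesis"
    then obtain g h where g: "g \<in> Y" "g \<notin> Z1" and h: "h \<in> Y" "h \<notin> Z2" by blast
    obtain P1 where P1: "peval ?I P1 g \<noteq> 0" "\<And>f. f \<in> Z1 \<Longrightarrow> peval ?I P1 f = 0"
      using zclosed_separating_poly[OF Z(1) _ g(2)] g(1) Y(2) by blast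
    obtain P2 where P2: "peval ?I P2 h \<noteq> 0" "\<And>f. f \<in> Z2 \<Longrightarrow> peval ?I P2 f = 0"
      using zclosed_separating_poly[OF Z(2) _ h(2)] h(1) Y(2) by blast
    let ?line = "\<lambda>t. g + fscale t (h - g)"
    have "\<exists>r. \<forall>t. poly r t = peval ?I P (?line t)" for P
      using ex_poly_peval[of ?I P "\<lambda>m. [:g m, h m - g m:]"] by (simp add: fscale_def plus_fun_def)
    then obtain r1 r2 where r1: "\<And>t. poly r1 t = peval ?I P1 (?line t)"
      and r2: "\<And>t. poly r2 t = peval ?I P2 (?line t)" by metis
    have "poly r1 0 \<noteq> 0" "poly r2 1 \<noteq> 0" using P1(1) P2(1) by (simp_all add: r1 r2)
    then have "r1 \<noteq> 0" "r2 \<noteq> 0" by auto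
    then have "finite ({t. poly r1 t = 0} \<union> {t. poly r2 t = 0} \<union> {t. ?line t \<notin> Y})"
      by (intro finite_UnI poly_roots_finite lines g(1) h(1))
    from ex_new_if_finite[OF inf this] obtain t where
      t: "poly r1 t \<noteq> 0" "poly r2 t \<noteq> 0" "?line t \<in> Y" by auto
    then have "?line t \<notin> Z1" "?line t \<notin> Z2"
      using P1(2)[of "?line t"] P2(2)[of "?line t"] r1 r2 by auto
    with t(3) Z(3) show False by blast
  qed
qed (rule Y(1))

lemma zirreducible_grad_fiber:
  fixes f :: "'k::field form"
  assumes inf: "infinite (UNIV :: 'k set)" and char: "of_nat (Suc d) \<noteq> (0::'k)"
    and ne: "grad_fiber n d f \<noteq> {}"
  shows "zirreducible n (Suc d) (grad_fiber n d f)"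
proof (rule zirreducible_if_lines_exit_finitely[OF inf ne])
  show "grad_fiber n d f \<subseteq> Pforms n (Suc d)" by (auto simp: grad_fiber_iff Pforms_iff)
  fix g h assume g: "g \<in> grad_fiber n d f" and h: "h \<in> grad_fiber n d f"
  have "pderiv_form i (h - g) \<in> grad_span n f" if "i < n" for i
    using g h pderiv_form_in_grad_span[OF that, of g] pderiv_form_in_grad_span[OF that, of h]
    by (auto simp: pderiv_form.diff grad_fiber_iff grad_span_def intro!: forms.span_diff)
  then have "grad_span n (h - g) \<subseteq> grad_span n f" by (rule grad_span_subsetI)
  then show "finite {t. g + fscale t (h - g) \<notin> grad_fiber n d f}"
    using g h by (intro finite_line_exits_grad_fiber[OF char]) (auto simp: grad_fiber_iff form_diff)
qed

lemma proj_point_subset_grad_fiber: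
  assumes f: "f \<in> grad_fiber n d f"
  shows "proj_point f \<subseteq> grad_fiber n d f"
proof
  fix g assume "g \<in> proj_point f"
  then obtain c where c: "c \<noteq> 0" "g = fscale c f" by (auto simp: proj_point_def)
  have "dir_deriv n v g = dir_deriv n (vscale c v) f"
    "dir_deriv n v f = dir_deriv n (vscale (inverse c) v) g" for v
    using c by (simp_all add: dir_deriv_form.scale dir_deriv_vec.scale)
  then have "grad_span n g = grad_span n f"
    unfolding set_eq_subset grad_span_subset_iff by metis
  then show "g \<in> grad_fiber n d f"
    using f c by (auto simp: grad_fiber_iff grad_dim_def form_fscale)
qed

lemma (in concise_form) pos_fiber_dim_if_not_injective:
  assumes inf: "infinite (UNIV :: 'k set)" and ni: "grad_not_injective_at n d f"
  shows "grad_pos_fiber_dim_at n d f"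
proof -
  let ?Y = "grad_fiber n d f"
  obtain g where g: "g \<in> ?Y" "\<not> same_point f g"
    using ni unfolding grad_not_injective_at_def grad_fiber_def by blast
  have "0 < n" using g same_point_if_no_vars by (cases n) (auto simp: grad_fiber_iff)
  then have f: "f \<in> ?Y" by (rule f_in_grad_fiber)
  have strict: "proj_point f \<subset> ?Y"
    using proj_point_subset_grad_fiber[OF f] g by (auto simp: proj_point_def same_point_def)
  have sub: "?Y \<subseteq> Pforms n (Suc d)" by (auto simp: grad_fiber_iff Pforms_iff)
  have "zclosed_in n (Suc d) ?Y (proj_point f)" "zclosed_in n (Suc d) ?Y ?Y"
    unfolding zclosed_in_def
    using zclosed_proj_point[of f n "Suc d"] zclosed_Pforms[of n "Suc d"] strict sub f by blast+
  then show ?thesis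
    unfolding grad_pos_fiber_dim_at_def local_dim_ge_def Suc_eq_plus1[symmetric]
    using strict f zirreducible_proj_point zirreducible_grad_fiber[OF inf Suc_neq_0, of n f]
    by (intro exI[of _ "\<lambda>i. if i = 0 then proj_point f else ?Y"]) auto
qed

lemma not_injective_if_pos_fiber_dim:
  assumes "grad_pos_fiber_dim_at n d f"
  shows "grad_not_injective_at n d f"
proof (rule ccontr)
  assume inj: "\<not> grad_not_injective_at n d f"
  let ?Y = "grad_fiber n d f"
  obtain T where "(\<forall>i\<le>1. zclosed_in n (Suc d) ?Y (T i) \<and> zirreducible n (Suc d) (T i)) \<and>
    (\<forall>i<1. T i \<subset> T (Suc i)) \<and> f \<in> T 1"
    using assms
      unfolding grad_pos_fiber_dim_at_def local_dim_ge_def Suc_eq_plus1[symmetric] by (rule exE)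
  then have T: "zclosed_in n (Suc d) ?Y (T 0)" "zclosed_in n (Suc d) ?Y (T 1)"
    "T 0 \<noteq> {}" "T 0 \<subset> T 1" by (auto simp: zirreducible_def)
  obtain Z where Z: "zclosed n (Suc d) Z" "T 0 = ?Y \<inter> Z"
    using T(1) unfolding zclosed_in_def by blast
  then obtain g where g: "g \<in> ?Y" "g \<in> Z" using T(3) by blast
  have multiple: "\<exists>c. c \<noteq> 0 \<and> h = fscale c f" if h: "h \<in> ?Y" for h
  proof -
    obtain c where c: "h = fscale c f"
      using inj h unfolding grad_not_injective_at_def grad_fiber_def same_point_def by blast
    moreover from c have "c \<noteq> 0" using h by (auto simp: grad_fiber_iff)
    ultimately show ?thesis by blast
  qed
  have "T 1 \<subseteq> T 0"
  proof
    fix h assume "h \<in> T 1"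
    then have h: "h \<in> ?Y" using T(2) unfolding zclosed_in_def by blast
    obtain b c where "b \<noteq> 0" "g = fscale b f" "c \<noteq> 0" "h = fscale c f"
      using multiple[OF g(1)] multiple[OF h] by blast
    then have "h \<in> Z" using fscale_in_zclosed[OF Z(1) g(2), of "c / b"] by simp
    then show "h \<in> T 0" using h Z(2) by blast
  qed
  with T(4) show False by blast
qed

subsection \<open>Destabilizing one-parameter subgroups\<close>

lemma prod_power_int_power:
  fixes t :: "'k::field"
  assumes "t \<noteq> 0"
  shows "(\<Prod>i\<in>I. (t powi w i) ^ m i) = t powi (\<Sum>i\<in>I. w i * int (m i))"
  by (induction I rule: infinite_finite_induct)
    (simp_all add: assms power_int_add power_int_mult)

lemma ex_form_linear_monomial:
  assumes m: "m \<in> monomials {..<n} e"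
  shows "\<exists>g. form n e g \<and> (\<forall>x. feval n g x = (\<Prod>i<n. lin n B x i ^ m i))"
proof -
  let ?m = "\<lambda>\<mu>. if \<mu> = m then 1 else 0 :: 'k::field"
  have form: "form n e ?m" using m by (simp add: form_iff)
  have eval: "feval n ?m x = (\<Prod>i<n. x i ^ m i)" for x
    unfolding feval_form[OF form] using m
    by (simp add: finite_monomials if_distrib[of "\<lambda>c. c * _"] cong: if_cong)
  obtain g where "form n e g" "\<And>x. feval n g x = feval n ?m (lin n B x)"
    using ex_form_linear_subst[OF form] by blast
  then show ?thesis by (auto simp only: eval)
qed

lemma ex_weight_degeneration:
  fixes h :: "'k::field form"
  assumes h: "form n e h" and pos: "\<And>m. h m \<noteq> 0 \<Longrightarrow> 0 < (\<Sum>i<n. w i * int (m i))"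
  obtains q where "\<And>\<alpha>. poly (q \<alpha>) 0 = 0" "\<And>t. form n e (\<lambda>\<alpha>. poly (q \<alpha>) t)"
    "\<And>t x. t \<noteq> 0 \<Longrightarrow> feval n (\<lambda>\<alpha>. poly (q \<alpha>) t) x = feval n h (\<lambda>i. t powi w i * lin n B x i)"
proof -
  let ?M = "monomials {..<n} e" and ?k = "\<lambda>m. nat (\<Sum>i<n. w i * int (m i))"
  obtain g where g: "\<And>m. m \<in> ?M \<Longrightarrow> form n e (g m)"
    "\<And>m x. m \<in> ?M \<Longrightarrow> feval n (g m) x = (\<Prod>i<n. lin n B x i ^ m i)"
    using ex_form_linear_monomial[of _ n e B] by metis
  define q where "q \<alpha> = (\<Sum>m\<in>?M. monom (h m * g m \<alpha>) (?k m))" for \<alpha>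
  have q: "(\<lambda>\<alpha>. poly (q \<alpha>) t) = (\<Sum>m\<in>?M. fscale (h m * t ^ ?k m) (g m))" for t
    by (rule ext) (simp add: q_def poly_sum poly_monom sum_fun_apply fscale_def mult_ac)
  show thesis
  proof (rule that)
    show "poly (q \<alpha>) 0 = 0" for \<alpha>
      unfolding q_def poly_sum using pos by (intro sum.neutral) (force simp: poly_monom)
    show "form n e (\<lambda>\<alpha>. poly (q \<alpha>) t)" for t
      unfolding q by (intro form_sum form_fscale g(1))
    fix t :: 'k and x assume t: "t \<noteq> 0"
    have "feval n (\<lambda>\<alpha>. poly (q \<alpha>) t) x = (\<Sum>m\<in>?M. h m * t ^ ?k m * (\<Prod>i<n. lin n B x i ^ m i))"
      unfolding q
      by (subst feval_sum[of _ n e]) (auto intro!: form_fscale sum.cong simp: g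
          feval_fscale[OF g(1)])
    also have "\<dots> = (\<Sum>m\<in>?M. h m * (\<Prod>i<n. (t powi w i * lin n B x i) ^ m i))"
    proof (rule sum.cong[OF refl])
      fix m
      have "t ^ ?k m = (\<Prod>i<n. (t powi w i) ^ m i)" if "h m \<noteq> 0"
        unfolding prod_power_int_power[OF t] using pos[OF that] by (simp add: power_int_def)
      then show "h m * t ^ ?k m * (\<Prod>i<n. lin n B x i ^ m i)
          = h m * (\<Prod>i<n. (t powi w i * lin n B x i) ^ m i)"
        by (cases "h m = 0") (simp_all add: power_mult_distrib prod.distrib)
    qed
    also have "\<dots> = feval n h (\<lambda>i. t powi w i * lin n B x i)" by (simp add: feval_form[OF h])
    finally show "feval n (\<lambda>\<alpha>. poly (q \<alpha>) t) x = feval n h (\<lambda>i. t powi w i * lin n B x i)" .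
  qed
qed

lemma in_SL_orbit_if_diagonal_subst:
  fixes f g :: "'k::field form"
  assumes B: "mdet n A * mdet n B = 1" and w: "(\<Sum>i<n. w i) = 0" and t: "t \<noteq> 0"
    and g: "form n e g" "\<And>x. feval n g x = feval n f (lin n A (\<lambda>i. t powi w i * lin n B x i))"
  shows "g \<in> SL_orbit n e f"
proof -
  let ?S = "\<lambda>i j. if i = j then t powi w i else 0"
  let ?D = "mmul n A (mmul n ?S B)"
  have "mdet n ?S = 1"
    using prod_power_int_power[OF t, of w "\<lambda>_. 1" "{..<n}"] w by (simp add: mdet_diag)
  then have "mdet n ?D = 1" using B by (simp add: mdet_mmul)
  moreover have "feval n g x = feval n f (lin n ?D x)" for x
  proof -
    have "lin n ?S y i = t powi w i * y i" if "i < n" for y i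
      using that by (simp add: lin_def if_distrib[of "\<lambda>z. z * _"] cong: if_cong)
    then have "lin n ?D x = lin n A (\<lambda>i. t powi w i * lin n B x i)"
      unfolding lin_mmul by (intro lin_cong) simp
    then show ?thesis by (simp add: g(2))
  qed
  ultimately show ?thesis using g(1) unfolding SL_orbit_def by blast
qed

text \<open>The easy half of the Hilbert-Mumford criterion.\<close>

lemma not_semistable_if_positive_weights:
  fixes f h :: "'k::field form"
  assumes inf: "infinite (UNIV :: 'k set)" and A: "mdet n A \<noteq> 0"
    and h: "form n e h" "\<And>x. feval n h x = feval n f (lin n A x)"
    and w: "(\<Sum>i<n. w i) = 0" "\<And>m. h m \<noteq> 0 \<Longrightarrow> 0 < (\<Sum>i<n. w i * int (m i))"
  shows "\<not> semistable n e f"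
proof
  assume "semistable n e f"
  then obtain P :: "((nat \<Rightarrow> nat) \<Rightarrow> nat) \<Rightarrow> 'k" where
    P: "\<And>g. g \<in> SL_orbit n e f \<Longrightarrow> peval (coeff_idx n e) P g = 0"
        "peval (coeff_idx n e) P (\<lambda>_. 0) \<noteq> 0"
    unfolding semistable_def by blast
  obtain B where B: "mdet n A * mdet n B = 1" using ex_inverse_matrix[OF A] by metis
  obtain q where q: "\<And>\<alpha>. poly (q \<alpha>) 0 = 0" "\<And>t. form n e (\<lambda>\<alpha>. poly (q \<alpha>) t)"
    "\<And>t x. t \<noteq> 0 \<Longrightarrow> feval n (\<lambda>\<alpha>. poly (q \<alpha>) t) x = feval n h (\<lambda>i. t powi w i * lin n B x i)"
    by (rule ex_weight_degeneration[OF h(1), of w B], erule w(2), rule that)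
  have orbit: "(\<lambda>\<alpha>. poly (q \<alpha>) t) \<in> SL_orbit n e f" if "t \<noteq> 0" for t
    using that q(2)
    by (rule in_SL_orbit_if_diagonal_subst[OF B w(1)]) (simp add: q(3)[OF that] h(2))
  obtain r where r: "\<And>t. poly r t = peval (coeff_idx n e) P (\<lambda>\<alpha>. poly (q \<alpha>) t)"
    using ex_poly_peval by metis
  have "{t. poly r t = 0} \<supseteq> - {0}" using P(1)[OF orbit] by (auto simp: r)
  then have "infinite {t. poly r t = 0}"
    using inf by (metis finite.emptyI finite_compl finite_insert finite_subset)
  then have "r = 0" using poly_roots_finite by blast
  then show False using r[of 0] P(2) by (simp add: q(1))
qed

lemma concise_if_semistable:
  fixes f :: "'k::field form"
  assumes inf: "infinite (UNIV :: 'k set)" and f: "form n (Suc e) f"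
    and ss: "semistable n (Suc e) f"
  shows "concise n (Suc e) f"
proof (rule ccontr)
  assume "\<not> concise n (Suc e) f"
  then obtain c
      where c: "c \<in> coord_space n" "c \<noteq> 0" "\<And>x t. feval n f (x + vscale t c) = feval n f x"
    unfolding concise_iff[OF f] by blast
  then obtain k where k: "n = Suc k" by (cases n) (auto simp: coord_space_def fun_eq_iff)
  obtain A h where A: "mdet n A \<noteq> 0"
      and h: "form k (Suc e) h" "\<And>x. feval n f (lin n A x) = feval k h x"
    using ex_eliminating_substitution[OF f c] k by auto
  define w where "w i = (if i = k then - int k else 1)" for i
  have "(\<Sum>i<k. w i) = (\<Sum>i<k. 1)" by (rule sum.cong) (simp_all add: w_def)
  then have "(\<Sum>i<n. w i) = 0" by (simp add: k w_def)
  moreover have "0 < (\<Sum>i<n. w i * int (m i))" if "h m \<noteq> 0" for m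
  proof -
    have m: "sum m {..<k} = Suc e" "m k = 0" using h(1) that by (auto simp: form_iff monomials_def)
    have "(\<Sum>i<k. w i * int (m i)) = (\<Sum>i<k. int (m i))" by (rule sum.cong) (simp_all add: w_def)
    then show ?thesis using m by (simp add: k flip: of_nat_sum)
  qed
  moreover have "form n (Suc e) h" "\<And>x. feval n h x = feval n f (lin n A x)"
    using form_mono[OF h(1), of n] h(2) k by auto
  ultimately show False using not_semistable_if_positive_weights[OF inf A] ss by blast
qed

text \<open>The three blocks of variables of an LDS form get weights \<open>-a\<close>, \<open>b\<close> and \<open>c\<close>.\<close>

lemma ex_LDS_weights:
  assumes "1 \<le> l" "2 * l \<le> n" "2 \<le> (d::nat)"
  obtains a b c where "1 \<le> b" "1 \<le> c" "a < b * d" "a * l = b * l + c * (n - 2 * l)"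
proof (cases "n = 2 * l")
  case True
  then show thesis using assms by (intro that[of 1 1 1]) auto
next
  case False
  obtain d' where d: "d = d' + 2" using assms(3) by (metis add.commute le_Suc_ex)
  define k where "k = n - 2 * l"
  have k: "1 \<le> k" using False assms(2) by (simp add: k_def)
  show thesis
  proof (rule that[of "2 * k" "l * (2 * d' + 1)" "k * (2 * d' + 3)"])
    show "k * (2 * d' + 3) < 2 * k * d" using k by (simp add: d algebra_simps)
    show "k * (2 * d' + 3) * l = 2 * k * l + l * (2 * d' + 1) * (n - 2 * l)"
      unfolding k_def[symmetric] by (simp add: algebra_simps)
  qed (use k assms in auto)
qed

lemma LDS_term_monomial_weight:
  fixes w :: "nat \<Rightarrow> int"
  assumes l: "2 * l \<le> n" and H: "form l (Suc d) H"
    and i: "i < l" "xmul i (shift_form l (pderiv_form i H)) m \<noteq> 0"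
    and w: "\<And>i. i < l \<Longrightarrow> w i = - a" "\<And>i. i < l \<Longrightarrow> w (l + i) = b"
  shows "(\<Sum>i<n. w i * int (m i)) = b * int d - a"
proof -
  let ?m = "m(i := m i - 1)"
  have mi: "m i \<noteq> 0" and shift: "shift_form l (pderiv_form i H) ?m \<noteq> 0"
    using i(2) by (auto simp: xmul_def split: if_splits)
  note m' = shift_form_neq_0D[OF form_pderiv_form[OF H i(1)] shift]
  have "m j = (if j = i then 1 else 0)" if "j < l" for j
    using m'(2)[OF that] mi by (auto split: if_splits)
  then have "(\<Sum>j<l. w j * int (m j)) = - a"
    using i(1) w(1) by (simp add: if_distrib[of "\<lambda>c. _ * int c"] cong: if_cong)
  moreover have "(\<Sum>j<n - l. w (l + j) * int (m (l + j))) = b * int d"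
  proof -
    have m_l: "(\<lambda>j. m (l + j)) \<in> monomials {..<l} d" using m'(1) i(1) by simp
    have "(\<Sum>j<n - l. w (l + j) * int (m (l + j))) = (\<Sum>j<l. w (l + j) * int (m (l + j)))"
      using l m_l by (intro sum.mono_neutral_right) (auto simp: monomials_def)
    also have "\<dots> = b * int (\<Sum>j<l. m (l + j))" by (simp add: w(2) sum_distrib_left)
    also have "(\<Sum>j<l. m (l + j)) = d" using m_l by (simp add: monomials_def)
    finally show ?thesis .
  qed
  ultimately show ?thesis using l by (simp add: sum_split_lessThan[of l n])
qed

lemma LDS_form_monomial_weight_pos:
  fixes w :: "nat \<Rightarrow> int"
  assumes l: "2 * l \<le> n" and H: "form l (Suc d) H" and G: "form (n - l) (Suc d) G"
    and m: "LDS_form l H G m \<noteq> 0"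
    and w: "\<And>i. i < l \<Longrightarrow> w i = - a" "\<And>i. i < l \<Longrightarrow> w (l + i) = b" "\<And>i. i < n - l \<Longrightarrow> 1 \<le> w (l + i)"
    and ab: "a < b * int d"
  shows "0 < (\<Sum>i<n. w i * int (m i))"
proof -
  consider (linear) i where "i < l" "xmul i (shift_form l (pderiv_form i H)) m \<noteq> 0"
    | (rest) "shift_form l G m \<noteq> 0"
    using m by (force simp: LDS_form_def sum_fun_apply elim!: sum.not_neutral_contains_not_neutral)
  then show ?thesis
  proof cases
    case linear
    have "(\<Sum>i<n. w i * int (m i)) = b * int d - a"
      by (rule LDS_term_monomial_weight[OF l H linear]) (simp_all add: w(1,2))
    with ab show ?thesis by simp
  next
    case rest
    note m' = shift_form_neq_0D[OF G rest]
    have "int (Suc d) = (\<Sum>j<n - l. int (m (l + j)))"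
      using m'(1) by (simp add: monomials_def flip: of_nat_sum)
    also have "\<dots> \<le> (\<Sum>j<n - l. w (l + j) * int (m (l + j)))"
      by (intro sum_mono) (use w(3) in \<open>simp add: mult_le_cancel_right1\<close>)
    finally show ?thesis using l m'(2) by (simp add: sum_split_lessThan[of l n])
  qed
qed

lemma not_semistable_if_LDS:
  fixes f :: "'k::field form"
  assumes inf: "infinite (UNIV :: 'k set)" and d: "2 \<le> d" and lds: "LDS n d f"
  shows "\<not> semistable n (Suc d) f"
proof -
  obtain A l H G where A: "mdet n A \<noteq> 0" and l: "1 \<le> l" "2 * l \<le> n"
    and H: "form l (Suc d) H" and G: "form (n - l) (Suc d) G"
    and f_A: "\<And>x. feval n f (lin n A x) = feval n (LDS_form l H G) x"
    using lds unfolding LDS_iff_LDS_form by blast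
  obtain a b c where abc: "1 \<le> b" "1 \<le> c" "a < b * d" "a * l = b * l + c * (n - 2 * l)"
    using ex_LDS_weights[OF l d] by metis
  define w where "w i = (if i < l then - int a else if i < 2 * l then int b else int c)" for i
  obtain k where n: "n = l + (l + k)" using l(2) by (metis add.assoc le_Suc_ex mult_2)
  have "(\<Sum>i<n. w i) = - int (a * l) + (int (b * l) + int (c * k))"
    by (simp add: n sum.lessThan_add w_def mult.commute)
  also have "\<dots> = 0" using abc(4) n by (simp flip: of_nat_mult of_nat_add)
  finally have "(\<Sum>i<n. w i) = 0" .
  moreover have "0 < (\<Sum>i<n. w i * int (m i))" if "LDS_form l H G m \<noteq> 0" for m
    by (rule LDS_form_monomial_weight_pos[OF l(2) H G that, where a = "int a" and b = "int b"])
      (use abc in \<open>auto simp: w_def simp flip: of_nat_mult\<close>)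
  ultimately show ?thesis
    using not_semistable_if_positive_weights[OF inf A form_LDS_form[OF l(2) H G] f_A[symmetric]]
    by blast
qed

subsection \<open>Fibres of the gradient morphism\<close>

context concise_form
begin

theorem direct_sum_or_LDS_iff_not_injective:
  assumes ac: "alg_closed TYPE('k)"
  shows "direct_sum n (Suc d) f \<or> LDS n d f \<longleftrightarrow> grad_not_injective_at n d f"
proof -
  note inf = infinite_UNIV_if_alg_closed[OF ac]
  show ?thesis
    using grad_not_injective_at_if_direct_sum[OF inf] grad_not_injective_at_if_LDS[OF inf]
      direct_sum_or_LDS_if_grad_span_subset[OF ac]
    unfolding grad_not_injective_at_iff[OF inf] by blast
qed

theorem not_injective_iff_pos_fiber_dim:
  assumes "infinite (UNIV :: 'k set)"
  shows "grad_not_injective_at n d f \<longleftrightarrow> grad_pos_fiber_dim_at n d f"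
  using pos_fiber_dim_if_not_injective[OF assms] not_injective_if_pos_fiber_dim by blast

theorem direct_sum_if_semistable_LDS:
  assumes "infinite (UNIV :: 'k set)" "semistable n (Suc d) f" "LDS n d f"
  shows "direct_sum n (Suc d) f"
proof -
  have n: "2 \<le> n" using assms(3) unfolding LDS_def by auto
  have "d < 2" using not_semistable_if_LDS[OF assms(1) _ assms(3)] assms(2) by (meson not_le)
  moreover have "d \<noteq> 0" using card_vars_if_linear n by auto
  ultimately have "d = 1" by simp
  then show ?thesis using n by (rule direct_sum_if_quadratic)
qed

end

theorem theorem3p2:
  fixes n d :: nat and f :: "'k::field form"
  assumes "alg_closed TYPE('k)"
    and "of_nat (fact (d + 1)) \<noteq> (0::'k)"
    and "form n (d + 1) f"
  shows "(concise n (d + 1) f \<longrightarrow>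
            ((direct_sum n (d + 1) f \<or> LDS n d f) \<longleftrightarrow> grad_not_injective_at n d f) \<and>
            (grad_not_injective_at n d f \<longleftrightarrow> grad_pos_fiber_dim_at n d f))
       \<and> (semistable n (d + 1) f \<longrightarrow>
            (direct_sum n (d + 1) f \<longleftrightarrow> grad_not_injective_at n d f) \<and>
            (grad_not_injective_at n d f \<longleftrightarrow> grad_pos_fiber_dim_at n d f))"
proof -
  note inf = infinite_UNIV_if_alg_closed[OF assms(1)]
  have concise: "concise_form n d f" if "concise n (Suc d) f"
    using assms(2,3) that unfolding Suc_eq_plus1[symmetric] by (rule concise_form.intro)
  have semistable: "concise n (Suc d) f" if "semistable n (Suc d) f"
    using concise_if_semistable[OF inf _ that] assms(3) by simp
  have "direct_sum n (Suc d) f" if "semistable n (Suc d) f" "LDS n d f"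
    using concise_form.direct_sum_if_semistable_LDS[OF concise inf that] semistable that by blast
  then show ?thesis
    using semistable concise_form.direct_sum_or_LDS_iff_not_injective[OF concise assms(1)]
      concise_form.not_injective_iff_pos_fiber_dim[OF concise inf]
    unfolding Suc_eq_plus1[symmetric] by blast
qed

end
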